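(* A category is equivalent to the category $\mathbf{PAsm}(\mathcal{A},\cdot)$ of partitioned assemblies over some partial combinatory algebra $(\mathcal{A},\cdot)$ if and only if it is weakly locally cartesian closed and well-pointed local, and has a discrete generic object.
   Context: **Partial terms.** For partially defined terms, $t\downarrow$ means that $t$ is defined, and $s\preceq t$ means: if $s$ is defined then $t$ is defined and $s=t$. **PCAs.** A partial applicative structure is a set $\mathcal{A}$ with a partial binary operation $(-\cdot-):\mathcal{A}\times\mathcal{A}\rightharpoonup\mathcal{A}$ (application, associating to the left). A polynomial over $\mathcal{A}$ is a term $t[x_1,\dots,x_n]$ built from variables $x_1,\dots,x_n$, constants in $\mathcal{A}$, and application. A partial combinatory algebra (PCA) is a partial applicative structure such that for every polynomial $t[x_1,\dots,x_{n+1}]$ there is an $e\in\mathcal{A}$ with $e\cdot a_1\cdot\ldots\cdot a_n\downarrow$ and $t[a_1,\dots,a_{n+1}]\preceq e\cdot a_1\cdot\ldots\cdot a_{n+1}$ for all $a_1,\dots,a_{n+1}\in\mathcal{A}$. **Partitioned assemblies.** $\mathbf{PAsm}(\mathcal{A},\cdot)$ has as objects pairs $(I,\varphi)$ with $I$ a set and $\varphi:I\to\mathcal{A}$ a function; a morphism $(I,\varphi)\to(J,\psi)$ is a function $f:I\to J$ for which there is an $e\in\mathcal{A}$ such that $e\cdot\varphi(i)$ is defined and equal to $\psi(f(i))$ for all $i\in I$. **Local categories.** A local category is a locally small category $\mathbb{C}$ with finite limits whose global sections functor $\Gamma=\mathbb{C}(1,-):\mathbb{C}\to\mathbf{Set}$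 has a right adjoint $\nabla$; the unit is denoted $\eta:\mathrm{id}\to\nabla\Gamma$. It is well-pointed local if $\Gamma$ is faithful. An arrow $f:B\to A$ in $\mathbb{C}$ is closed if the naturality square of $\eta$ at $f$ (with sides $f$, $\eta_B$, $\eta_A$, $\nabla\Gamma f$) is a pullback. An object $G$ is generic if for every $C\in\mathbb{C}$ there is a closed $f:C\to G$. An object $G$ is discrete if for any span $C\xleftarrow{e}D\xrightarrow{f}G$ with $e$ closed and $\Gamma e$ surjective there is a unique $g:C\to G$ with $ge=f$. **Weak local cartesian closure.** A finite-limit category $\mathbb{C}$ is weakly locally cartesian closed if for all arrows $b:B\to J$ and $u:J\to I$ the presheaf $(\mathbb{C}/J)(u^*-,b):(\mathbb{C}/I)^{\mathrm{op}}\to\mathbf{Set}$ is weakly representable, i.e. admits a (pointwise surjective) cover by a representable presheaf. *)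

theory Defs
  imports "HOL-Library.FuncSet" "HOL-Library.Equipollence"
begin

section \<open>Small sets\<close>

text \<open>
  A universe is a family \<open>U\<close> of subsets of an ambient type, the \<^emph>\<open>small\<close> sets, with the
  closure properties of a Grothendieck universe; arbitrary subsets of the type play the role of
  classes.  Since elements of the type are not themselves sets, a power set is asked to be
  equipollent to a member of \<open>U\<close>, and \<open>U\<close> is asked to be closed under injective
  replacement (hence also under subsets).
  As in the usual definition without an axiom of infinity, the finite sets form a universe; the
  infinite case amounts to a strongly inaccessible bound on cardinality.
\<close>

definition universe :: "'u set set \<Rightarrow> bool" where
  "universe U \<longleftrightarrow>
     (\<forall>x y. {x, y} \<in> U) \<and>
     (\<forall>X\<in>U. \<forall>Y::'u set. Y \<lesssim> X \<longrightarrow> Y \<in> U) \<and>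
     (\<forall>X\<in>U. \<exists>Y\<in>U. Pow X \<approx> Y) \<and>
     (\<forall>X\<in>U. \<forall>F. (\<forall>x\<in>X. F x \<in> U) \<longrightarrow> (\<Union>x\<in>X. F x) \<in> U)"

lemma universe_finite: "universe {X::nat set. finite X}"
proof -
  have "\<exists>Y::nat set. finite Y \<and> Pow X \<approx> Y" if "finite X" for X :: "nat set"
    using that by (intro exI[of _ "{..<card (Pow X)}"]) (simp add: eqpoll_iff_card card_Pow)
  then show ?thesis
    by (auto simp: universe_def lepoll_def dest: inj_on_finite)
qed


section \<open>Categories, functors, natural transformations\<close>

record ('o, 'm) category =
  Obj :: "'o set"
  Arr :: "'m set"
  Dom :: "'m \<Rightarrow> 'o"
  Cod :: "'m \<Rightarrow> 'o"
  Ide :: "'o \<Rightarrow> 'm"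
  Comp :: "'m \<Rightarrow> 'm \<Rightarrow> 'm"  (infixl \<open>\<cdot>\<index>\<close> 70)

definition hom :: "('o, 'm) category \<Rightarrow> 'o \<Rightarrow> 'o \<Rightarrow> 'm set" where
  "hom C X Y = {f \<in> Arr C. Dom C f = X \<and> Cod C f = Y}"

definition is_category :: "('o, 'm) category \<Rightarrow> bool" where
  "is_category C \<longleftrightarrow>
     (\<forall>f\<in>Arr C. Dom C f \<in> Obj C \<and> Cod C f \<in> Obj C) \<and>
     (\<forall>X\<in>Obj C. Ide C X \<in> hom C X X) \<and>
     (\<forall>f\<in>Arr C. \<forall>g\<in>Arr C. Cod C f = Dom C g \<longrightarrow> g \<cdot>\<^bsub>C\<^esub> f \<in> hom C (Dom C f) (Cod C g)) \<and>
     (\<forall>f\<in>Arr C. f \<cdot>\<^bsub>C\<^esub> Ide C (Dom C f) = f \<and> Ide C (Cod C f) \<cdot>\<^bsub>C\<^esub> f = f) \<and>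
     (\<forall>f\<in>Arr C. \<forall>g\<in>Arr C. \<forall>h\<in>Arr C. Cod C f = Dom C g \<and> Cod C g = Dom C h \<longrightarrow>
        (h \<cdot>\<^bsub>C\<^esub> g) \<cdot>\<^bsub>C\<^esub> f = h \<cdot>\<^bsub>C\<^esub> (g \<cdot>\<^bsub>C\<^esub> f))"

definition op_cat :: "('o, 'm) category \<Rightarrow> ('o, 'm) category" where
  "op_cat C = \<lparr>Obj = Obj C, Arr = Arr C, Dom = Cod C, Cod = Dom C, Ide = Ide C,
     Comp = (\<lambda>g f. f \<cdot>\<^bsub>C\<^esub> g)\<rparr>"

record ('o, 'm, 'p, 'n) cfunctor =
  FObj :: "'o \<Rightarrow> 'p"
  FArr :: "'m \<Rightarrow> 'n"

definition is_functor ::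
  "('o, 'm) category \<Rightarrow> ('p, 'n) category \<Rightarrow> ('o, 'm, 'p, 'n) cfunctor \<Rightarrow> bool" where
  "is_functor C D F \<longleftrightarrow> is_category C \<and> is_category D \<and>
     (\<forall>X\<in>Obj C. FObj F X \<in> Obj D) \<and>
     (\<forall>f\<in>Arr C. FArr F f \<in> hom D (FObj F (Dom C f)) (FObj F (Cod C f))) \<and>
     (\<forall>X\<in>Obj C. FArr F (Ide C X) = Ide D (FObj F X)) \<and>
     (\<forall>f\<in>Arr C. \<forall>g\<in>Arr C. Cod C f = Dom C g \<longrightarrow>
        FArr F (g \<cdot>\<^bsub>C\<^esub> f) = FArr F g \<cdot>\<^bsub>D\<^esub> FArr F f)"

definition id_functor :: "('o, 'm, 'o, 'm) cfunctor" where
  "id_functor = \<lparr>FObj = (\<lambda>X. X), FArr = (\<lambda>f. f)\<rparr>"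

definition comp_functor ::
  "('p, 'n, 'q, 'k) cfunctor \<Rightarrow> ('o, 'm, 'p, 'n) cfunctor \<Rightarrow> ('o, 'm, 'q, 'k) cfunctor"
  (infixl \<open>\<circ>\<^sub>F\<close> 70) where
  "G \<circ>\<^sub>F F = \<lparr>FObj = (\<lambda>X. FObj G (FObj F X)), FArr = (\<lambda>f. FArr G (FArr F f))\<rparr>"

definition faithful ::
  "('o, 'm) category \<Rightarrow> ('o, 'm, 'p, 'n) cfunctor \<Rightarrow> bool" where
  "faithful C F \<longleftrightarrow>
     (\<forall>X\<in>Obj C. \<forall>Y\<in>Obj C. inj_on (FArr F) (hom C X Y))"

definition nat_trans ::
  "('o, 'm) category \<Rightarrow> ('p, 'n) category \<Rightarrow> ('o, 'm, 'p, 'n) cfunctor \<Rightarrow>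
    ('o, 'm, 'p, 'n) cfunctor \<Rightarrow> ('o \<Rightarrow> 'n) \<Rightarrow> bool" where
  "nat_trans C D F G \<tau> \<longleftrightarrow> is_functor C D F \<and> is_functor C D G \<and>
     (\<forall>X\<in>Obj C. \<tau> X \<in> hom D (FObj F X) (FObj G X)) \<and>
     (\<forall>f\<in>Arr C. FArr G f \<cdot>\<^bsub>D\<^esub> \<tau> (Dom C f) = \<tau> (Cod C f) \<cdot>\<^bsub>D\<^esub> FArr F f)"

definition is_iso :: "('o, 'm) category \<Rightarrow> 'm \<Rightarrow> bool" where
  "is_iso C f \<longleftrightarrow> f \<in> Arr C \<and>
     (\<exists>g \<in> hom C (Cod C f) (Dom C f).
        g \<cdot>\<^bsub>C\<^esub> f = Ide C (Dom C f) \<and> f \<cdot>\<^bsub>C\<^esub> g = Ide C (Cod C f))"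

definition nat_iso ::
  "('o, 'm) category \<Rightarrow> ('p, 'n) category \<Rightarrow> ('o, 'm, 'p, 'n) cfunctor \<Rightarrow>
    ('o, 'm, 'p, 'n) cfunctor \<Rightarrow> ('o \<Rightarrow> 'n) \<Rightarrow> bool" where
  "nat_iso C D F G \<tau> \<longleftrightarrow> nat_trans C D F G \<tau> \<and> (\<forall>X\<in>Obj C. is_iso D (\<tau> X))"

definition equivalent_cats :: "('o, 'm) category \<Rightarrow> ('p, 'n) category \<Rightarrow> bool" where
  "equivalent_cats C D \<longleftrightarrow>
     (\<exists>F G \<alpha> \<beta>. is_functor C D F \<and> is_functor D C G \<and>
        nat_iso C C id_functor (G \<circ>\<^sub>F F) \<alpha> \<and> nat_iso D D (F \<circ>\<^sub>F G) id_functor \<beta>)"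

definition adjunction ::
  "('o, 'm) category \<Rightarrow> ('p, 'n) category \<Rightarrow> ('o, 'm, 'p, 'n) cfunctor \<Rightarrow>
    ('p, 'n, 'o, 'm) cfunctor \<Rightarrow> ('o \<Rightarrow> 'm) \<Rightarrow> ('p \<Rightarrow> 'n) \<Rightarrow> bool" where
  "adjunction C D F G \<eta> \<epsilon> \<longleftrightarrow> is_functor C D F \<and> is_functor D C G \<and>
     nat_trans C C id_functor (G \<circ>\<^sub>F F) \<eta> \<and>
     nat_trans D D (F \<circ>\<^sub>F G) id_functor \<epsilon> \<and>
     (\<forall>X\<in>Obj C. \<epsilon> (FObj F X) \<cdot>\<^bsub>D\<^esub> FArr F (\<eta> X) = Ide D (FObj F X)) \<and>
     (\<forall>Y\<in>Obj D. FArr G (\<epsilon> Y) \<cdot>\<^bsub>C\<^esub> \<eta> (FObj G Y) = Ide C (FObj G Y))"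


section \<open>Sets and hom functors\<close>

text \<open>
  Functions are represented extensionally on their domain, so that equality of arrows is equality
  of functions.  \<open>set_cat U\<close> with a universe \<open>U\<close> is the category of small sets;
  \<open>set_cat UNIV\<close> is the category of all sets of elements of the given type.
\<close>

type_synonym 'a set_arrow = "'a set \<times> ('a \<Rightarrow> 'a) \<times> 'a set"

definition set_cat :: "'a set set \<Rightarrow> ('a set, 'a set_arrow) category" where
  "set_cat U = \<lparr>
     Obj = U,
     Arr = {(X, f, Y). X \<in> U \<and> Y \<in> U \<and> f \<in> X \<rightarrow>\<^sub>E Y},
     Dom = (\<lambda>(X, f, Y). X),
     Cod = (\<lambda>(X, f, Y). Y),
     Ide = (\<lambda>X. (X, restrict (\<lambda>x. x) X, X)),
     Comp = (\<lambda>(_, g, Z) (X, f, _). (X, compose X g f, Z))\<rparr>"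

definition surjective :: "'a set_arrow \<Rightarrow> bool" where
  "surjective = (\<lambda>(X, f, Y). f ` X = Y)"

definition covariant_hom :: "('o, 'm) category \<Rightarrow> 'o \<Rightarrow> ('o, 'm, 'm set, 'm set_arrow) cfunctor"
  where
  "covariant_hom C T = \<lparr>
     FObj = (\<lambda>X. hom C T X),
     FArr = (\<lambda>f. (hom C T (Dom C f), restrict (\<lambda>h. f \<cdot>\<^bsub>C\<^esub> h) (hom C T (Dom C f)),
                  hom C T (Cod C f)))\<rparr>"

text \<open>The representable presheaf of \<open>B\<close>, a functor on \<open>op_cat C\<close>.\<close>

definition presheaf_hom :: "('o, 'm) category \<Rightarrow> 'o \<Rightarrow> ('o, 'm, 'm set, 'm set_arrow) cfunctor"
  where
  "presheaf_hom C B = \<lparr>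
     FObj = (\<lambda>X. hom C X B),
     FArr = (\<lambda>f. (hom C (Cod C f) B, restrict (\<lambda>h. h \<cdot>\<^bsub>C\<^esub> f) (hom C (Cod C f) B),
                  hom C (Dom C f) B))\<rparr>"

definition weakly_representable ::
  "('o, 'm) category \<Rightarrow> ('o, 'm, 'm set, 'm set_arrow) cfunctor \<Rightarrow> bool" where
  "weakly_representable C F \<longleftrightarrow>
     (\<exists>P\<in>Obj C. \<exists>\<tau>. nat_trans (op_cat C) (set_cat UNIV) (presheaf_hom C P) F \<tau> \<and>
        (\<forall>X\<in>Obj C. surjective (\<tau> X)))"


section \<open>Finite limits, slices, weak local cartesian closure\<close>

definition is_cone ::
  "('o, 'm) category \<Rightarrow> ('j, 'k) category \<Rightarrow> ('j, 'k, 'o, 'm) cfunctor \<Rightarrow> 'o \<Rightarrow> ('j \<Rightarrow> 'm) \<Rightarrow> bool"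
  where
  "is_cone C J D L \<pi> \<longleftrightarrow> L \<in> Obj C \<and>
     (\<forall>j\<in>Obj J. \<pi> j \<in> hom C L (FObj D j)) \<and>
     (\<forall>k\<in>Arr J. FArr D k \<cdot>\<^bsub>C\<^esub> \<pi> (Dom J k) = \<pi> (Cod J k))"

definition is_limit ::
  "('o, 'm) category \<Rightarrow> ('j, 'k) category \<Rightarrow> ('j, 'k, 'o, 'm) cfunctor \<Rightarrow> 'o \<Rightarrow> ('j \<Rightarrow> 'm) \<Rightarrow> bool"
  where
  "is_limit C J D L \<pi> \<longleftrightarrow> is_cone C J D L \<pi> \<and>
     (\<forall>M \<mu>. is_cone C J D M \<mu> \<longrightarrow>
        (\<exists>!h. h \<in> hom C M L \<and> (\<forall>j\<in>Obj J. \<pi> j \<cdot>\<^bsub>C\<^esub> h = \<mu> j)))"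

text \<open>
  Every finite category is isomorphic to one whose objects and arrows are natural numbers, so
  these suffice as shapes of diagrams.
\<close>

definition has_finite_limits :: "('o, 'm) category \<Rightarrow> bool" where
  "has_finite_limits C \<longleftrightarrow>
     (\<forall>(J :: (nat, nat) category) D. finite (Obj J) \<and> finite (Arr J) \<and> is_functor J C D \<longrightarrow>
        (\<exists>L \<pi>. is_limit C J D L \<pi>))"

definition is_terminal :: "('o, 'm) category \<Rightarrow> 'o \<Rightarrow> bool" where
  "is_terminal C T \<longleftrightarrow> T \<in> Obj C \<and> (\<forall>X\<in>Obj C. \<exists>!h. h \<in> hom C X T)"

text \<open>\<open>is_pullback C p q f g\<close>: the span \<open>(p, q)\<close> is a pullback of the cospan \<open>(f, g)\<close>,
  with \<open>f \<cdot> p = g \<cdot> q\<close>.\<close>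

definition is_pullback :: "('o, 'm) category \<Rightarrow> 'm \<Rightarrow> 'm \<Rightarrow> 'm \<Rightarrow> 'm \<Rightarrow> bool" where
  "is_pullback C p q f g \<longleftrightarrow>
     f \<in> Arr C \<and> g \<in> Arr C \<and> Cod C f = Cod C g \<and>
     p \<in> Arr C \<and> q \<in> Arr C \<and> Dom C p = Dom C q \<and> Cod C p = Dom C f \<and> Cod C q = Dom C g \<and>
     f \<cdot>\<^bsub>C\<^esub> p = g \<cdot>\<^bsub>C\<^esub> q \<and>
     (\<forall>X\<in>Obj C. \<forall>a\<in>hom C X (Dom C f). \<forall>b\<in>hom C X (Dom C g). f \<cdot>\<^bsub>C\<^esub> a = g \<cdot>\<^bsub>C\<^esub> b \<longrightarrow>
        (\<exists>!h. h \<in> hom C X (Dom C p) \<and> p \<cdot>\<^bsub>C\<^esub> h = a \<and> q \<cdot>\<^bsub>C\<^esub> h = b))"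

text \<open>An arrow \<open>(x, h, y)\<close> of the slice is the arrow \<open>h\<close> of \<open>C\<close> regarded as \<open>x \<rightarrow> y\<close>.\<close>

definition slice :: "('o, 'm) category \<Rightarrow> 'o \<Rightarrow> ('m, 'm \<times> 'm \<times> 'm) category" where
  "slice C I = \<lparr>
     Obj = {x \<in> Arr C. Cod C x = I},
     Arr = {(x, h, y). x \<in> Arr C \<and> y \<in> Arr C \<and> Cod C x = I \<and> Cod C y = I \<and>
              h \<in> hom C (Dom C x) (Dom C y) \<and> y \<cdot>\<^bsub>C\<^esub> h = x},
     Dom = (\<lambda>(x, h, y). x),
     Cod = (\<lambda>(x, h, y). y),
     Ide = (\<lambda>x. (x, Ide C (Dom C x), x)),
     Comp = (\<lambda>(_, k, z) (x, h, _). (x, k \<cdot>\<^bsub>C\<^esub> h, z))\<rparr>"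

text \<open>
  \<open>pullback_functor C u S \<pi>\<close>: \<open>S\<close> is a functor \<open>u\<^sup>*\<close> from the slice over the codomain of \<open>u\<close> to
  the slice over its domain, given by chosen pullback squares with projections \<open>\<pi> x\<close> from the
  domain of \<open>u\<^sup>* x\<close> to the domain of \<open>x\<close>.
\<close>

definition pullback_functor ::
  "('o, 'm) category \<Rightarrow> 'm \<Rightarrow> ('m, 'm \<times> 'm \<times> 'm, 'm, 'm \<times> 'm \<times> 'm) cfunctor \<Rightarrow> ('m \<Rightarrow> 'm) \<Rightarrow> bool"
  where
  "pullback_functor C u S \<pi> \<longleftrightarrow>
     is_functor (slice C (Cod C u)) (slice C (Dom C u)) S \<and>
     (\<forall>x\<in>Obj (slice C (Cod C u)). is_pullback C (FObj S x) (\<pi> x) u x) \<and>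
     (\<forall>(x, h, y)\<in>Arr (slice C (Cod C u)).
        \<pi> y \<cdot>\<^bsub>C\<^esub> fst (snd (FArr S (x, h, y))) = h \<cdot>\<^bsub>C\<^esub> \<pi> x)"

text \<open>
  Pullback functors along a fixed arrow are unique up to isomorphism, so the choice of \<open>S\<close> below
  is immaterial.  The same functor data serves for the functor between the opposite categories.
\<close>

definition weakly_locally_cartesian_closed :: "('o, 'm) category \<Rightarrow> bool" where
  "weakly_locally_cartesian_closed C \<longleftrightarrow> is_category C \<and> has_finite_limits C \<and>
     (\<forall>b\<in>Arr C. \<forall>u\<in>Arr C. Cod C b = Dom C u \<longrightarrow>
        (\<exists>S \<pi>. pullback_functor C u S \<pi> \<and>
           weakly_representable (slice C (Cod C u)) (presheaf_hom (slice C (Dom C u)) b \<circ>\<^sub>F S)))"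


section \<open>Local categories\<close>

text \<open>
  The hom-sets of \<open>C\<close> are sets of elements of the ambient type of the universe, so that for a
  locally small \<open>C\<close> they are objects of \<open>set_cat U\<close>.  The chosen terminal object \<open>T\<close>, the
  right adjoint \<open>N\<close> of the global sections functor and the unit \<open>\<eta>\<close> are carried along as
  parameters; they are determined up to isomorphism, and all notions below are independent of
  the choice.
\<close>

definition locally_small :: "'u set set \<Rightarrow> ('o, 'u) category \<Rightarrow> bool" where
  "locally_small U C \<longleftrightarrow> (\<forall>X\<in>Obj C. \<forall>Y\<in>Obj C. hom C X Y \<in> U)"

abbreviation global_sections ::
  "('o, 'u) category \<Rightarrow> 'o \<Rightarrow> ('o, 'u, 'u set, 'u set_arrow) cfunctor" where
  "global_sections C T \<equiv> covariant_hom C T"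

definition local_category ::
  "'u set set \<Rightarrow> ('o, 'u) category \<Rightarrow> 'o \<Rightarrow> ('u set, 'u set_arrow, 'o, 'u) cfunctor \<Rightarrow>
    ('o \<Rightarrow> 'u) \<Rightarrow> bool" where
  "local_category U C T N \<eta> \<longleftrightarrow>
     is_category C \<and> locally_small U C \<and> has_finite_limits C \<and> is_terminal C T \<and>
     (\<exists>\<epsilon>. adjunction C (set_cat U) (global_sections C T) N \<eta> \<epsilon>)"

definition well_pointed_local ::
  "'u set set \<Rightarrow> ('o, 'u) category \<Rightarrow> 'o \<Rightarrow> ('u set, 'u set_arrow, 'o, 'u) cfunctor \<Rightarrow>
    ('o \<Rightarrow> 'u) \<Rightarrow> bool" where
  "well_pointed_local U C T N \<eta> \<longleftrightarrow>
     local_category U C T N \<eta> \<and> faithful C (global_sections C T)"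

definition closed_arrow ::
  "('o, 'u) category \<Rightarrow> 'o \<Rightarrow> ('u set, 'u set_arrow, 'o, 'u) cfunctor \<Rightarrow> ('o \<Rightarrow> 'u) \<Rightarrow> 'u \<Rightarrow> bool"
  where
  "closed_arrow C T N \<eta> f \<longleftrightarrow> f \<in> Arr C \<and>
     is_pullback C f (\<eta> (Dom C f)) (\<eta> (Cod C f)) (FArr (N \<circ>\<^sub>F global_sections C T) f)"

definition generic_object ::
  "('o, 'u) category \<Rightarrow> 'o \<Rightarrow> ('u set, 'u set_arrow, 'o, 'u) cfunctor \<Rightarrow> ('o \<Rightarrow> 'u) \<Rightarrow> 'o \<Rightarrow> bool"
  where
  "generic_object C T N \<eta> G \<longleftrightarrow> G \<in> Obj C \<and>
     (\<forall>X\<in>Obj C. \<exists>f\<in>hom C X G. closed_arrow C T N \<eta> f)"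

definition discrete_object ::
  "('o, 'u) category \<Rightarrow> 'o \<Rightarrow> ('u set, 'u set_arrow, 'o, 'u) cfunctor \<Rightarrow> ('o \<Rightarrow> 'u) \<Rightarrow> 'o \<Rightarrow> bool"
  where
  "discrete_object C T N \<eta> G \<longleftrightarrow> G \<in> Obj C \<and>
     (\<forall>X\<in>Obj C. \<forall>D\<in>Obj C. \<forall>e\<in>hom C D X. \<forall>f\<in>hom C D G.
        closed_arrow C T N \<eta> e \<and> surjective (FArr (global_sections C T) e) \<longrightarrow>
        (\<exists>!g. g \<in> hom C X G \<and> g \<cdot>\<^bsub>C\<^esub> e = f))"


section \<open>Partial combinatory algebras and partitioned assemblies\<close>

text \<open>Undefined terms are represented by \<open>None\<close>.\<close>

definition partial_le :: "'a option \<Rightarrow> 'a option \<Rightarrow> bool"  (infix \<open>\<preceq>\<close> 50) where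
  "s \<preceq> t \<longleftrightarrow> (s \<noteq> None \<longrightarrow> t \<noteq> None \<and> s = t)"

type_synonym 'a papp = "'a \<Rightarrow> 'a \<Rightarrow> 'a option"

definition partial_applicative_structure :: "'a set \<Rightarrow> 'a papp \<Rightarrow> bool" where
  "partial_applicative_structure A app \<longleftrightarrow>
     (\<forall>a\<in>A. \<forall>b\<in>A. \<forall>c. app a b = Some c \<longrightarrow> c \<in> A)"

definition app_opt :: "'a papp \<Rightarrow> 'a option \<Rightarrow> 'a option \<Rightarrow> 'a option" where
  "app_opt app s t = Option.bind s (\<lambda>a. Option.bind t (\<lambda>b. app a b))"

text \<open>\<open>app_list app e [a\<^sub>1, \<dots>, a\<^sub>n]\<close> is \<open>e \<cdot> a\<^sub>1 \<cdot> \<dots> \<cdot> a\<^sub>n\<close>, associated to the left.\<close>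

definition app_list :: "'a papp \<Rightarrow> 'a \<Rightarrow> 'a list \<Rightarrow> 'a option" where
  "app_list app e as = foldl (\<lambda>s a. app_opt app s (Some a)) (Some e) as"

datatype 'a polynomial = Var nat | Const 'a | App "'a polynomial" "'a polynomial"

text \<open>Variables are numbered from \<open>0\<close>: \<open>poly_over A n t\<close> says that \<open>t\<close> has its constants in \<open>A\<close>
  and its variables among the first \<open>n\<close>.\<close>

primrec poly_over :: "'a set \<Rightarrow> nat \<Rightarrow> 'a polynomial \<Rightarrow> bool" where
  "poly_over A n (Var i) \<longleftrightarrow> i < n"
| "poly_over A n (Const a) \<longleftrightarrow> a \<in> A"
| "poly_over A n (App s t) \<longleftrightarrow> poly_over A n s \<and> poly_over A n t"

primrec poly_eval :: "'a papp \<Rightarrow> 'a list \<Rightarrow> 'a polynomial \<Rightarrow> 'a option" where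
  "poly_eval app as (Var i) = Some (as ! i)"
| "poly_eval app as (Const a) = Some a"
| "poly_eval app as (App s t) = app_opt app (poly_eval app as s) (poly_eval app as t)"

definition pca :: "'a set \<Rightarrow> 'a papp \<Rightarrow> bool" where
  "pca A app \<longleftrightarrow> partial_applicative_structure A app \<and>
     (\<forall>n t. poly_over A (Suc n) t \<longrightarrow>
        (\<exists>e\<in>A. \<forall>as b. length as = n \<and> set as \<subseteq> A \<and> b \<in> A \<longrightarrow>
           app_list app e as \<noteq> None \<and>
           poly_eval app (as @ [b]) t \<preceq> app_list app e (as @ [b])))"

type_synonym 'a assembly = "'a set \<times> ('a \<Rightarrow> 'a)"

definition PAsm ::
  "'u set set \<Rightarrow> 'u set \<Rightarrow> 'u papp \<Rightarrow> ('u assembly, 'u assembly \<times> ('u \<Rightarrow> 'u) \<times> 'u assembly) category"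
  where
  "PAsm U A app = \<lparr>
     Obj = {(I, \<phi>). I \<in> U \<and> \<phi> \<in> I \<rightarrow>\<^sub>E A},
     Arr = {((I, \<phi>), f, (J, \<psi>)).
              I \<in> U \<and> \<phi> \<in> I \<rightarrow>\<^sub>E A \<and> J \<in> U \<and> \<psi> \<in> J \<rightarrow>\<^sub>E A \<and> f \<in> I \<rightarrow>\<^sub>E J \<and>
              (\<exists>e\<in>A. \<forall>i\<in>I. app e (\<phi> i) = Some (\<psi> (f i)))},
     Dom = (\<lambda>(X, f, Y). X),
     Cod = (\<lambda>(X, f, Y). Y),
     Ide = (\<lambda>X. (X, restrict (\<lambda>i. i) (fst X), X)),
     Comp = (\<lambda>(_, g, Z) (X, f, _). (X, compose (fst X) g f, Z))\<rparr>"

end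

(*
By full faithfulness and essential surjectivity, C is equivalent to PAsm(A) iff its objects and
arrows can be presented as A-coded sets and tracked functions, and for such a C all the required
structure is computed on points: a closed arrow is one along which the code of a point can be
recovered from the code of its image, and G = (A, id).

Conversely, in a well-pointed local category an arrow is a function on global points, and arrows
into a closed f : X -> Y are functions on points whose composite with f is an arrow.  With A the
set of points of the discrete generic object G, every object has a closed map to G, and
discreteness makes every arrow X -> G factor through the image of that map, so C is determined by
its realizable partial functions on A.  A closed map G x G -> G is a pairing with realizable
projections, and a weak dependent product over the indiscrete object on Pow A is a generic family
of realizable partial functions; transporting its evaluation along closed maps to G gives the
application.  Currying then yields combinatory completeness by induction on polynomials.
*)
theory Submission
  imports Defs
begin

section \<open>Categories and equivalences\<close>

text \<open>Application has to be partial, so an object of total functions from \<open>G\<close> to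
  \<open>G\<close> would not do. Currying a realizable \<open>h\<close> on \<open>M\<close> leaves,
  for each \<open>a\<close>, a function whose domain is the fibre of \<open>M\<close> over
  \<open>a\<close>, and this domain varies with \<open>a\<close>. Indexing by the indiscrete object
  on the subsets of \<open>A\<close> absorbs the variation: arrows into it are arbitrary functions
  on points, so \<open>a\<close> may be sent to its fibre without any realizability condition. Weak
  universality is enough, since currying only needs some index for each function. The price is that
  different indices may share a code in \<open>G\<close>; discreteness makes the value of an index
  depend on its code and argument alone, so that application is single-valued. In the other
  direction the dependent product is merely weak because one section may be tracked by many elements
  of \<open>A\<close>, and each of them gives a different point.\<close>

lemma homD:
  assumes "f \<in> hom C X Y"
  shows "f \<in> Arr C" "Dom C f = X" "Cod C f = Y"
  using assms by (auto simp: hom_def)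

locale cat =
  fixes C :: "('o, 'm) category" (structure)
  assumes is_cat: "is_category C"
begin

lemma hom_obj: "f \<in> hom C X Y \<Longrightarrow> X \<in> Obj C" "f \<in> hom C X Y \<Longrightarrow> Y \<in> Obj C"
  using is_cat unfolding is_category_def hom_def by blast+

lemma arr_hom: "f \<in> Arr C \<Longrightarrow> f \<in> hom C (Dom C f) (Cod C f)"
  by (simp add: hom_def)

lemma arr_obj: "f \<in> Arr C \<Longrightarrow> Dom C f \<in> Obj C" "f \<in> Arr C \<Longrightarrow> Cod C f \<in> Obj C"
  using is_cat unfolding is_category_def by blast+

lemma ide_hom: "X \<in> Obj C \<Longrightarrow> Ide C X \<in> hom C X X"
  using is_cat unfolding is_category_def by blast

lemma comp_hom: "f \<in> hom C X Y \<Longrightarrow> g \<in> hom C Y Z \<Longrightarrow> g \<cdot> f \<in> hom C X Z"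
  using is_cat unfolding is_category_def hom_def by auto

lemma comp_ide: "f \<in> hom C X Y \<Longrightarrow> f \<cdot> Ide C X = f"
  using is_cat unfolding is_category_def hom_def by auto

lemma ide_comp: "f \<in> hom C X Y \<Longrightarrow> Ide C Y \<cdot> f = f"
  using is_cat unfolding is_category_def hom_def by auto

lemma assoc:
  "f \<in> hom C W X \<Longrightarrow> g \<in> hom C X Y \<Longrightarrow> h \<in> hom C Y Z \<Longrightarrow> (h \<cdot> g) \<cdot> f = h \<cdot> (g \<cdot> f)"
  using is_cat unfolding is_category_def hom_def by auto

lemma isoI:
  assumes "f \<in> hom C X Y" "g \<in> hom C Y X" "g \<cdot> f = Ide C X" "f \<cdot> g = Ide C Y"
  shows "is_iso C f"
  using assms unfolding is_iso_def hom_def by auto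

lemma isoE:
  assumes "is_iso C f" "f \<in> hom C X Y"
  obtains g where "g \<in> hom C Y X" "g \<cdot> f = Ide C X" "f \<cdot> g = Ide C Y"
  using assms unfolding is_iso_def hom_def by auto

lemma iso_cancel_left:
  assumes f: "is_iso C f" "f \<in> hom C X Y" and "g \<in> hom C W X" "h \<in> hom C W X"
    and eq: "f \<cdot> g = f \<cdot> h"
  shows "g = h"
proof -
  obtain k where k: "k \<in> hom C Y X" "k \<cdot> f = Ide C X"
    using f by (rule isoE)
  have "k \<cdot> (f \<cdot> g) = k \<cdot> (f \<cdot> h)"
    using eq by simp
  then show ?thesis
    using assoc[OF assms(3) f(2) k(1)] assoc[OF assms(4) f(2) k(1)] k(2)
      ide_comp[OF assms(3)] ide_comp[OF assms(4)] by simp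
qed

lemma iso_cancel_right:
  assumes f: "is_iso C f" "f \<in> hom C X Y" and "g \<in> hom C Y Z" "h \<in> hom C Y Z"
    and eq: "g \<cdot> f = h \<cdot> f"
  shows "g = h"
proof -
  obtain k where k: "k \<in> hom C Y X" "f \<cdot> k = Ide C Y"
    using f by (rule isoE)
  have "(g \<cdot> f) \<cdot> k = (h \<cdot> f) \<cdot> k"
    using eq by simp
  then show ?thesis
    using assoc[OF k(1) f(2) assms(3)] assoc[OF k(1) f(2) assms(4)] k(2)
      comp_ide[OF assms(3)] comp_ide[OF assms(4)] by simp
qed

lemma pullbackI:
  assumes "f \<in> hom C X Z" "g \<in> hom C Y Z" "p \<in> hom C P X" "q \<in> hom C P Y" "f \<cdot> p = g \<cdot> q"
    and "\<And>W a b. W \<in> Obj C \<Longrightarrow> a \<in> hom C W X \<Longrightarrow> b \<in> hom C W Y \<Longrightarrow> f \<cdot> a = g \<cdot> b \<Longrightarrow>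
           \<exists>!h. h \<in> hom C W P \<and> p \<cdot> h = a \<and> q \<cdot> h = b"
  shows "is_pullback C p q f g"
proof -
  have "Dom C f = X" "Dom C g = Y" "Dom C p = P"
    using assms by (auto dest: homD)
  then show ?thesis
    unfolding is_pullback_def using assms by (auto dest: homD)
qed

lemma pullback_comm: "is_pullback C p q f g \<Longrightarrow> f \<cdot> p = g \<cdot> q"
  unfolding is_pullback_def by blast

lemma pullback_hom:
  assumes "is_pullback C p q f g" "f \<in> hom C X Z" "g \<in> hom C Y Z"
  shows "p \<in> hom C (Dom C p) X" "q \<in> hom C (Dom C p) Y"
  using assms unfolding is_pullback_def hom_def by auto

lemma pullback_ex1:
  assumes "is_pullback C p q f g" "p \<in> hom C P X" "q \<in> hom C P Y"
    and "a \<in> hom C W X" "b \<in> hom C W Y" "f \<cdot> a = g \<cdot> b"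
  shows "\<exists>!h. h \<in> hom C W P \<and> p \<cdot> h = a \<and> q \<cdot> h = b"
proof -
  have "W \<in> Obj C" "Dom C f = X" "Dom C g = Y" "Dom C p = P"
    using assms hom_obj unfolding is_pullback_def hom_def by auto
  then show ?thesis
    using assms unfolding is_pullback_def by metis
qed

end

section \<open>Functors, natural transformations and equivalences\<close>

lemma functor_cats:
  assumes "is_functor C D F"
  shows "is_category C" "is_category D"
  using assms unfolding is_functor_def by auto

lemma functor_obj: "is_functor C D F \<Longrightarrow> X \<in> Obj C \<Longrightarrow> FObj F X \<in> Obj D"
  unfolding is_functor_def by auto

lemma functor_hom:
  "is_functor C D F \<Longrightarrow> f \<in> hom C X Y \<Longrightarrow> FArr F f \<in> hom D (FObj F X) (FObj F Y)"
  unfolding is_functor_def hom_def by auto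

lemma functor_ide: "is_functor C D F \<Longrightarrow> X \<in> Obj C \<Longrightarrow> FArr F (Ide C X) = Ide D (FObj F X)"
  unfolding is_functor_def by auto

lemma functor_comp:
  "is_functor C D F \<Longrightarrow> f \<in> hom C X Y \<Longrightarrow> g \<in> hom C Y Z \<Longrightarrow>
    FArr F (g \<cdot>\<^bsub>C\<^esub> f) = FArr F g \<cdot>\<^bsub>D\<^esub> FArr F f"
  unfolding is_functor_def hom_def by auto

lemma functorI:
  assumes "is_category C" "is_category D"
    and "\<And>X. X \<in> Obj C \<Longrightarrow> FObj F X \<in> Obj D"
    and "\<And>f X Y. f \<in> hom C X Y \<Longrightarrow> FArr F f \<in> hom D (FObj F X) (FObj F Y)"
    and "\<And>X. X \<in> Obj C \<Longrightarrow> FArr F (Ide C X) = Ide D (FObj F X)"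
    and "\<And>f g X Y Z. f \<in> hom C X Y \<Longrightarrow> g \<in> hom C Y Z \<Longrightarrow>
           FArr F (g \<cdot>\<^bsub>C\<^esub> f) = FArr F g \<cdot>\<^bsub>D\<^esub> FArr F f"
  shows "is_functor C D F"
  unfolding is_functor_def
proof (intro conjI ballI impI)
  fix f g assume "f \<in> Arr C" "g \<in> Arr C" "Cod C f = Dom C g"
  then have "f \<in> hom C (Dom C f) (Dom C g)" "g \<in> hom C (Dom C g) (Cod C g)"
    by (auto simp: hom_def)
  then show "FArr F (g \<cdot>\<^bsub>C\<^esub> f) = FArr F g \<cdot>\<^bsub>D\<^esub> FArr F f"
    by (rule assms(6))
qed (use assms in \<open>auto simp: hom_def\<close>)

lemma id_functor: "is_category C \<Longrightarrow> is_functor C C id_functor"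
  unfolding is_functor_def id_functor_def hom_def by simp

lemma comp_functor:
  assumes "is_functor C D F" "is_functor D E G"
  shows "is_functor C E (G \<circ>\<^sub>F F)"
proof (rule functorI)
  fix f g X Y Z assume "f \<in> hom C X Y" "g \<in> hom C Y Z"
  then show "FArr (G \<circ>\<^sub>F F) (g \<cdot>\<^bsub>C\<^esub> f) = FArr (G \<circ>\<^sub>F F) g \<cdot>\<^bsub>E\<^esub> FArr (G \<circ>\<^sub>F F) f"
    using assms by (simp add: comp_functor_def functor_comp[of C D F f X Y g Z]
        functor_comp[OF assms(2) functor_hom functor_hom])
qed (use assms functor_cats[OF assms(1)] functor_cats[OF assms(2)] in
    \<open>auto simp: comp_functor_def functor_ide[of C D F] functor_ide[of D E G] functor_obj functor_hom\<close>)

lemma nat_transI: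
  assumes "is_functor C D F" "is_functor C D G"
    and "\<And>X. X \<in> Obj C \<Longrightarrow> \<tau> X \<in> hom D (FObj F X) (FObj G X)"
    and "\<And>f X Y. f \<in> hom C X Y \<Longrightarrow> FArr G f \<cdot>\<^bsub>D\<^esub> \<tau> X = \<tau> Y \<cdot>\<^bsub>D\<^esub> FArr F f"
  shows "nat_trans C D F G \<tau>"
  using assms unfolding nat_trans_def hom_def by auto

lemma nat_transD:
  assumes "nat_trans C D F G \<tau>"
  shows "X \<in> Obj C \<Longrightarrow> \<tau> X \<in> hom D (FObj F X) (FObj G X)"
    and "f \<in> hom C X Y \<Longrightarrow> FArr G f \<cdot>\<^bsub>D\<^esub> \<tau> X = \<tau> Y \<cdot>\<^bsub>D\<^esub> FArr F f"
  using assms unfolding nat_trans_def hom_def by auto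

text \<open>A quasi-inverse is chosen objectwise: \<open>g0 Y\<close> with an isomorphism
  \<open>b Y\<close> onto \<open>Y\<close>. Equations in \<open>C\<close> are then proved after
  applying \<open>F\<close>, which is injective on hom-sets, and equations in \<open>D\<close> by
  cancelling \<open>b\<close>.\<close>

lemma equivalence_of_fully_faithful:
  assumes F: "is_functor C D F"
    and ff: "\<And>X Y. X \<in> Obj C \<Longrightarrow> Y \<in> Obj C \<Longrightarrow>
      bij_betw (FArr F) (hom C X Y) (hom D (FObj F X) (FObj F Y))"
    and eso: "\<And>Y. Y \<in> Obj D \<Longrightarrow> \<exists>X\<in>Obj C. \<exists>f\<in>hom D (FObj F X) Y. is_iso D f"
  shows "equivalent_cats C D"
proof -
  interpret C: cat C by (unfold_locales) (rule functor_cats[OF F])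
  interpret D: cat D by (unfold_locales) (rule functor_cats[OF F])
  obtain g0 b where gb: "\<And>Y. Y \<in> Obj D \<Longrightarrow> g0 Y \<in> Obj C"
    "\<And>Y. Y \<in> Obj D \<Longrightarrow> b Y \<in> hom D (FObj F (g0 Y)) Y" "\<And>Y. Y \<in> Obj D \<Longrightarrow> is_iso D (b Y)"
    using eso by metis
  have "\<forall>Y\<in>Obj D. \<exists>b'. b' \<in> hom D Y (FObj F (g0 Y)) \<and>
      b' \<cdot>\<^bsub>D\<^esub> b Y = Ide D (FObj F (g0 Y)) \<and> b Y \<cdot>\<^bsub>D\<^esub> b' = Ide D Y"
    using gb by (metis D.isoE)
  then obtain b' where b': "\<And>Y. Y \<in> Obj D \<Longrightarrow> b' Y \<in> hom D Y (FObj F (g0 Y))"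
    "\<And>Y. Y \<in> Obj D \<Longrightarrow> b' Y \<cdot>\<^bsub>D\<^esub> b Y = Ide D (FObj F (g0 Y))"
    "\<And>Y. Y \<in> Obj D \<Longrightarrow> b Y \<cdot>\<^bsub>D\<^esub> b' Y = Ide D Y"
    by metis
  define lift where "lift X Y = inv_into (hom C X Y) (FArr F)" for X Y
  have lift: "lift X Y h \<in> hom C X Y" "FArr F (lift X Y h) = h"
    if "X \<in> Obj C" "Y \<in> Obj C" "h \<in> hom D (FObj F X) (FObj F Y)" for X Y h
    using ff[OF that(1,2)] that(3) unfolding lift_def
    by (auto simp: bij_betw_def inv_into_into f_inv_into_f)
  have F_eq: "f = f'" if "f \<in> hom C X Y" "f' \<in> hom C X Y" "FArr F f = FArr F f'" for f f' X Y
    using ff[of X Y] that C.hom_obj[OF that(1)] unfolding bij_betw_def inj_on_def by blast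
  \<comment> \<open>Conjugation by the isomorphisms \<open>b\<close>: the arrow to which
    \<open>F\<close> must send \<open>FArr G g\<close> if \<open>b\<close> is to be natural.\<close>
  define conj where "conj Y Y' g = b' Y' \<cdot>\<^bsub>D\<^esub> (g \<cdot>\<^bsub>D\<^esub> b Y)" for Y Y' g
  have conj: "conj Y Y' g \<in> hom D (FObj F (g0 Y)) (FObj F (g0 Y'))"
    and b_conj: "b Y' \<cdot>\<^bsub>D\<^esub> conj Y Y' g = g \<cdot>\<^bsub>D\<^esub> b Y"
    if g: "g \<in> hom D Y Y'" for Y Y' g
  proof -
    have Y: "Y \<in> Obj D" "Y' \<in> Obj D"
      using D.hom_obj g by auto
    have gbY: "g \<cdot>\<^bsub>D\<^esub> b Y \<in> hom D (FObj F (g0 Y)) Y'"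
      using gb(2)[OF Y(1)] g by (rule D.comp_hom)
    then show "conj Y Y' g \<in> hom D (FObj F (g0 Y)) (FObj F (g0 Y'))"
      unfolding conj_def using b'(1)[OF Y(2)] by (rule D.comp_hom)
    show "b Y' \<cdot>\<^bsub>D\<^esub> conj Y Y' g = g \<cdot>\<^bsub>D\<^esub> b Y"
      unfolding conj_def
      by (simp add: D.assoc[OF gbY b'(1)[OF Y(2)] gb(2)[OF Y(2)], symmetric] b'(3)[OF Y(2)]
          D.ide_comp[OF gbY])
  qed
  define G where "G = \<lparr>FObj = g0, FArr = (\<lambda>g. lift (g0 (Dom D g)) (g0 (Cod D g))
      (conj (Dom D g) (Cod D g) g))\<rparr>"
  have G_arr: "FArr G g = lift (g0 Y) (g0 Y') (conj Y Y' g)" if "g \<in> hom D Y Y'" for g Y Y'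
    using that by (simp add: G_def homD)
  have G_hom: "FArr G g \<in> hom C (FObj G Y) (FObj G Y')" and FG: "FArr F (FArr G g) = conj Y Y' g"
    if g: "g \<in> hom D Y Y'" for g Y Y'
    using lift[OF gb(1) gb(1) conj[OF g]] D.hom_obj[OF g] G_arr[OF g] by (auto simp: G_def)
  have G0: "FObj G = g0" by (simp add: G_def)
  have G: "is_functor D C G"
  proof (rule functorI)
    fix X assume X: "X \<in> Obj D"
    show "FArr G (Ide D X) = Ide C (FObj G X)"
    proof (rule F_eq)
      show "FArr G (Ide D X) \<in> hom C (g0 X) (g0 X)"
        using G_hom[OF D.ide_hom[OF X]] G0 by simp
      show "Ide C (FObj G X) \<in> hom C (g0 X) (g0 X)"
        using C.ide_hom gb(1)[OF X] G0 by simp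
      show "FArr F (FArr G (Ide D X)) = FArr F (Ide C (FObj G X))"
        using FG[OF D.ide_hom[OF X]] X
        by (simp add: conj_def D.ide_comp[OF gb(2)] b' G0 functor_ide[OF F gb(1)])
    qed
  next
    fix f g X Y Z assume f: "f \<in> hom D X Y" and g: "g \<in> hom D Y Z"
    have gf: "g \<cdot>\<^bsub>D\<^esub> f \<in> hom D X Z"
      using f g by (rule D.comp_hom)
    have Obj: "X \<in> Obj D" "Y \<in> Obj D" "Z \<in> Obj D"
      using D.hom_obj f g by auto
    show "FArr G (g \<cdot>\<^bsub>D\<^esub> f) = FArr G g \<cdot>\<^bsub>C\<^esub> FArr G f"
    proof (rule F_eq[OF G_hom[OF gf] C.comp_hom[OF G_hom[OF f] G_hom[OF g]]])
      have "conj X Z (g \<cdot>\<^bsub>D\<^esub> f) = conj Y Z g \<cdot>\<^bsub>D\<^esub> conj X Y f"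
      proof (rule D.iso_cancel_left[OF gb(3) gb(2) conj[OF gf] D.comp_hom[OF conj[OF f] conj[OF g]]])
        show "b Z \<cdot>\<^bsub>D\<^esub> conj X Z (g \<cdot>\<^bsub>D\<^esub> f) = b Z \<cdot>\<^bsub>D\<^esub> (conj Y Z g \<cdot>\<^bsub>D\<^esub> conj X Y f)"
          using D.assoc[OF conj[OF f] conj[OF g] gb(2)[OF Obj(3)]]
            D.assoc[OF conj[OF f] gb(2)[OF Obj(2)] g] D.assoc[OF gb(2)[OF Obj(1)] f g]
          by (simp add: b_conj[OF f] b_conj[OF g] b_conj[OF gf])
      qed (use Obj in auto)
      then show "FArr F (FArr G (g \<cdot>\<^bsub>D\<^esub> f)) = FArr F (FArr G g \<cdot>\<^bsub>C\<^esub> FArr G f)"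
        by (simp add: functor_comp[OF F G_hom[OF f] G_hom[OF g]] FG[OF f] FG[OF g] FG[OF gf])
    qed
  qed (use G_hom in \<open>simp_all add: gb(1) G0 C.is_cat D.is_cat\<close>)
  \<comment> \<open>Fullness lifts the inverse of \<open>b\<close> at \<open>F X\<close> to the
    unit; \<open>a'\<close> below lifts \<open>b\<close> itself and is inverse to the unit.\<close>
  define \<alpha> where "\<alpha> X = lift X (g0 (FObj F X)) (b' (FObj F X))" for X
  have \<alpha>: "\<alpha> X \<in> hom C X (g0 (FObj F X))" "FArr F (\<alpha> X) = b' (FObj F X)" if "X \<in> Obj C" for X
    using lift[OF that gb(1) b'(1)] functor_obj[OF F that] unfolding \<alpha>_def by auto
  have "nat_iso C C id_functor (G \<circ>\<^sub>F F) \<alpha>"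
    unfolding nat_iso_def
  proof (intro conjI ballI nat_transI)
    fix X assume X: "X \<in> Obj C"
    show "\<alpha> X \<in> hom C (FObj id_functor X) (FObj (G \<circ>\<^sub>F F) X)"
      using \<alpha> X by (simp add: id_functor_def comp_functor_def G0)
    have FX: "FObj F X \<in> Obj D"
      by (rule functor_obj[OF F X])
    define a' where "a' = lift (g0 (FObj F X)) X (b (FObj F X))"
    have a': "a' \<in> hom C (g0 (FObj F X)) X" "FArr F a' = b (FObj F X)"
      using lift[OF gb(1) X gb(2)] FX unfolding a'_def by auto
    show "is_iso C (\<alpha> X)"
    proof (rule C.isoI[OF \<alpha>(1)[OF X] a'(1)])
      show "a' \<cdot>\<^bsub>C\<^esub> \<alpha> X = Ide C X"
        by (rule F_eq[OF C.comp_hom[OF \<alpha>(1)[OF X] a'(1)] C.ide_hom[OF X]])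
          (simp add: functor_comp[OF F \<alpha>(1)[OF X] a'(1)] \<alpha>(2)[OF X] a'(2) b'(3)[OF FX]
            functor_ide[OF F X])
      show "\<alpha> X \<cdot>\<^bsub>C\<^esub> a' = Ide C (g0 (FObj F X))"
        by (rule F_eq[OF C.comp_hom[OF a'(1) \<alpha>(1)[OF X]] C.ide_hom[OF gb(1)[OF FX]]])
          (simp add: functor_comp[OF F a'(1) \<alpha>(1)[OF X]] \<alpha>(2)[OF X] a'(2) b'(2)[OF FX]
            functor_ide[OF F gb(1)[OF FX]])
    qed
  next
    fix f X Y assume f: "f \<in> hom C X Y"
    have X: "X \<in> Obj C" and Y: "Y \<in> Obj C"
      using C.hom_obj f by auto
    note Ff = functor_hom[OF F f]
    have FX: "FObj F X \<in> Obj D" and FY: "FObj F Y \<in> Obj D"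
      using functor_obj[OF F] X Y by auto
    note GFf = G_hom[OF Ff, unfolded G0]
    have "FArr G (FArr F f) \<cdot>\<^bsub>C\<^esub> \<alpha> X = \<alpha> Y \<cdot>\<^bsub>C\<^esub> f"
    proof (rule F_eq[OF C.comp_hom[OF \<alpha>(1)[OF X] GFf] C.comp_hom[OF f \<alpha>(1)[OF Y]]])
      have "conj (FObj F X) (FObj F Y) (FArr F f) \<cdot>\<^bsub>D\<^esub> b' (FObj F X) = b' (FObj F Y) \<cdot>\<^bsub>D\<^esub> FArr F f"
      proof (rule D.iso_cancel_left[OF gb(3)[OF FY] gb(2)[OF FY]
              D.comp_hom[OF b'(1)[OF FX] conj[OF Ff]] D.comp_hom[OF Ff b'(1)[OF FY]]])
        show "b (FObj F Y) \<cdot>\<^bsub>D\<^esub> (conj (FObj F X) (FObj F Y) (FArr F f) \<cdot>\<^bsub>D\<^esub> b' (FObj F X)) =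
          b (FObj F Y) \<cdot>\<^bsub>D\<^esub> (b' (FObj F Y) \<cdot>\<^bsub>D\<^esub> FArr F f)"
          using D.assoc[OF b'(1)[OF FX] conj[OF Ff] gb(2)[OF FY]]
            D.assoc[OF b'(1)[OF FX] gb(2)[OF FX] Ff] D.assoc[OF Ff b'(1)[OF FY] gb(2)[OF FY]]
          by (simp add: b_conj[OF Ff] b'(3)[OF FX] b'(3)[OF FY] D.comp_ide[OF Ff] D.ide_comp[OF Ff])
      qed
      then show "FArr F (FArr G (FArr F f) \<cdot>\<^bsub>C\<^esub> \<alpha> X) = FArr F (\<alpha> Y \<cdot>\<^bsub>C\<^esub> f)"
        by (simp add: functor_comp[OF F \<alpha>(1)[OF X] GFf] functor_comp[OF F f \<alpha>(1)[OF Y]]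
            \<alpha>(2)[OF X] \<alpha>(2)[OF Y] FG[OF Ff])
    qed
    then show "FArr (G \<circ>\<^sub>F F) f \<cdot>\<^bsub>C\<^esub> \<alpha> X = \<alpha> Y \<cdot>\<^bsub>C\<^esub> FArr id_functor f"
      by (simp add: comp_functor_def id_functor_def)
  qed (intro id_functor C.is_cat comp_functor[OF F G])+
  moreover have "nat_iso D D (F \<circ>\<^sub>F G) id_functor b"
    unfolding nat_iso_def
  proof (intro conjI ballI nat_transI)
    fix f X Y assume f: "f \<in> hom D X Y"
    show "FArr id_functor f \<cdot>\<^bsub>D\<^esub> b X = b Y \<cdot>\<^bsub>D\<^esub> FArr (F \<circ>\<^sub>F G) f"
      by (simp add: comp_functor_def id_functor_def FG[OF f] b_conj[OF f])
  next
    fix X assume "X \<in> Obj D"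
    then show "b X \<in> hom D (FObj (F \<circ>\<^sub>F G) X) (FObj id_functor X)" "is_iso D (b X)"
      using gb by (auto simp: comp_functor_def id_functor_def G0)
  qed (intro id_functor D.is_cat comp_functor[OF G F])+
  ultimately show ?thesis
    unfolding equivalent_cats_def using F G by blast
qed

text \<open>Faithfulness cancels the isomorphism \<alpha> from its naturality square, and essential
  surjectivity is witnessed by \<open>G\<close> and \<beta>. Fullness is the step that needs both
  transformations.\<close>

lemma equivalence_fully_faithful:
  assumes "equivalent_cats C D"
  obtains F where "is_functor C D F"
    and "\<And>X Y f g. f \<in> hom C X Y \<Longrightarrow> g \<in> hom C X Y \<Longrightarrow> FArr F f = FArr F g \<Longrightarrow> f = g"
    and "\<And>X Y h. X \<in> Obj C \<Longrightarrow> Y \<in> Obj C \<Longrightarrow> h \<in> hom D (FObj F X) (FObj F Y) \<Longrightarrow>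
      \<exists>f\<in>hom C X Y. FArr F f = h"
    and "\<And>Y. Y \<in> Obj D \<Longrightarrow> \<exists>X\<in>Obj C. \<exists>f\<in>hom D (FObj F X) Y. is_iso D f"
proof -
  from assms obtain F G \<alpha> \<beta> where F: "is_functor C D F" and G: "is_functor D C G"
    and nat: "nat_iso C C id_functor (G \<circ>\<^sub>F F) \<alpha>" "nat_iso D D (F \<circ>\<^sub>F G) id_functor \<beta>"
    unfolding equivalent_cats_def by auto
  interpret C: cat C by (unfold_locales) (rule functor_cats[OF F])
  interpret D: cat D by (unfold_locales) (rule functor_cats[OF F])
  note GF = functor_hom[OF G functor_hom[OF F]]
  have \<alpha>: "\<alpha> X \<in> hom C X (FObj G (FObj F X))" "is_iso C (\<alpha> X)" if "X \<in> Obj C" for X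
    using nat(1) that nat_transD(1)[of C C id_functor "G \<circ>\<^sub>F F" \<alpha> X]
    unfolding nat_iso_def by (auto simp: id_functor_def comp_functor_def)
  have \<beta>: "\<beta> X \<in> hom D (FObj F (FObj G X)) X" "is_iso D (\<beta> X)" if "X \<in> Obj D" for X
    using nat(2) that nat_transD(1)[of D D "F \<circ>\<^sub>F G" id_functor \<beta> X]
    unfolding nat_iso_def by (auto simp: id_functor_def comp_functor_def)
  have nat_\<alpha>: "FArr G (FArr F f) \<cdot>\<^bsub>C\<^esub> \<alpha> X = \<alpha> Y \<cdot>\<^bsub>C\<^esub> f" if "f \<in> hom C X Y" for f X Y
    using nat(1) that nat_transD(2)[of C C id_functor "G \<circ>\<^sub>F F" \<alpha> f X Y]
    unfolding nat_iso_def by (auto simp: id_functor_def comp_functor_def)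
  have nat_\<beta>: "f \<cdot>\<^bsub>D\<^esub> \<beta> X = \<beta> Y \<cdot>\<^bsub>D\<^esub> FArr F (FArr G f)" if "f \<in> hom D X Y" for f X Y
    using nat(2) that nat_transD(2)[of D D "F \<circ>\<^sub>F G" id_functor \<beta> f X Y]
    unfolding nat_iso_def by (auto simp: id_functor_def comp_functor_def)
  show ?thesis
  proof (rule that[OF F])
    fix X Y f g assume f: "f \<in> hom C X Y" and g: "g \<in> hom C X Y" and eq: "FArr F f = FArr F g"
    have "Y \<in> Obj C"
      using C.hom_obj f by auto
    then show "f = g"
      using nat_\<alpha>[OF f] nat_\<alpha>[OF g] eq by (intro C.iso_cancel_left[OF \<alpha>(2,1) f g]) auto
  next
    fix X Y h assume X: "X \<in> Obj C" and Y: "Y \<in> Obj C" and h: "h \<in> hom D (FObj F X) (FObj F Y)"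
    obtain a' where a': "a' \<in> hom C (FObj G (FObj F Y)) Y"
      "\<alpha> Y \<cdot>\<^bsub>C\<^esub> a' = Ide C (FObj G (FObj F Y))"
      using C.isoE[OF \<alpha>(2,1)[OF Y]] by metis
    note Gh = functor_hom[OF G h]
    note Gha = C.comp_hom[OF \<alpha>(1)[OF X] Gh]
    \<comment> \<open>Solves the naturality square of \<alpha> for \<open>f\<close>, with
      \<open>FArr G h\<close> in place of \<open>FArr G (FArr F f)\<close>. Hence
      \<open>FArr F f\<close> and \<open>h\<close> agree after \<open>G\<close>, and naturality of
      \<beta> cancels \<open>G\<close>.\<close>
    define f where "f = a' \<cdot>\<^bsub>C\<^esub> (FArr G h \<cdot>\<^bsub>C\<^esub> \<alpha> X)"
    have f: "f \<in> hom C X Y"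
      unfolding f_def by (rule C.comp_hom[OF Gha a'(1)])
    have "\<alpha> Y \<cdot>\<^bsub>C\<^esub> f = FArr G h \<cdot>\<^bsub>C\<^esub> \<alpha> X"
      unfolding f_def using C.assoc[OF Gha a'(1) \<alpha>(1)[OF Y]] a'(2) C.ide_comp[OF Gha] by simp
    then have GFf: "FArr G (FArr F f) = FArr G h"
      by (intro C.iso_cancel_right[OF \<alpha>(2,1)[OF X] GF[OF f] Gh]) (simp add: nat_\<alpha>[OF f])
    note Ff = functor_hom[OF F f]
    have "FArr F f = h"
      by (rule D.iso_cancel_right[OF \<beta>(2,1)[OF functor_obj[OF F X]] Ff h])
        (simp add: nat_\<beta>[OF Ff] nat_\<beta>[OF h] GFf)
    then show "\<exists>f\<in>hom C X Y. FArr F f = h"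
      using f by blast
  next
    fix Y assume "Y \<in> Obj D"
    then show "\<exists>X\<in>Obj C. \<exists>f\<in>hom D (FObj F X) Y. is_iso D f"
      using \<beta> functor_obj[OF G] by blast
  qed
qed

section \<open>Smallness\<close>

locale grothendieck_universe =
  fixes U :: "'u set set"
  assumes universe: "universe U"
begin

text \<open>\<open>U\<close> only has sets over \<open>'u\<close> as members, while the proof meets
  sets of pairs, triples and functions. Smallness is therefore a cardinality bound on sets of any
  type, and \<open>small_code\<close> turns a small set back into a member of
  \<open>U\<close>.\<close>

definition small :: "'v set \<Rightarrow> bool" where
  "small W \<longleftrightarrow> (\<exists>Z\<in>U. W \<lesssim> Z)"

lemma small_in_U: "small W \<Longrightarrow> W \<in> U" for W :: "'u set"
  using universe unfolding universe_def small_def by blast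

lemma small_member: "W \<in> U \<Longrightarrow> small W"
  unfolding small_def by (blast intro: lepoll_refl)

lemma small_lepoll: "small W \<Longrightarrow> V \<lesssim> W \<Longrightarrow> small V"
  unfolding small_def by (blast intro: lepoll_trans)

lemma small_subset: "small W \<Longrightarrow> V \<subseteq> W \<Longrightarrow> small V"
  by (blast intro: small_lepoll subset_imp_lepoll)

lemma small_inj: "small W \<Longrightarrow> inj_on f V \<Longrightarrow> f \<in> V \<rightarrow> W \<Longrightarrow> small V"
  by (rule small_lepoll) (auto simp: lepoll_def)

lemma small_singleton: "small {x}"
proof -
  have "{undefined, undefined} \<in> U"
    using universe unfolding universe_def by blast
  then show ?thesis
    by (auto simp: small_def lepoll_def inj_on_def)
qed

text \<open>Over a finite type some member of \<open>U\<close> would have the largest cardinality,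
  but its power set is equipollent to a member. An infinite type admits the pairing function that
  \<open>small_Times\<close> needs.\<close>

lemma infinite_UNIV: "infinite (UNIV :: 'u set)"
proof
  assume fin: "finite (UNIV :: 'u set)"
  have fin_U: "finite U"
    using fin by (simp add: Finite_Set.finite_set finite_subset[OF subset_UNIV])
  have "U \<noteq> {}"
    using universe unfolding universe_def by blast
  then have "Max (card ` U) \<in> card ` U"
    using fin_U by (intro Max_in) auto
  then obtain X where X: "X \<in> U" "card X = Max (card ` U)"
    by auto
  obtain Y where Y: "Y \<in> U" "Pow X \<approx> Y"
    using universe X(1) unfolding universe_def by blast
  have "card Y = card (Pow X)"
    using Y(2) by (auto simp: eqpoll_def dest: bij_betw_same_card)
  then have "card X < card Y"
    using finite_subset[OF subset_UNIV fin] by (simp add: card_Pow)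
  moreover have "card Y \<le> Max (card ` U)"
    using Y(1) fin_U by simp
  ultimately show False
    using X(2) by simp
qed

lemma small_Times:
  fixes V :: "'v set" and W :: "'w set"
  assumes "small V" "small W"
  shows "small (V \<times> W)"
proof -
  obtain X Y where XY: "X \<in> U" "Y \<in> U" "V \<lesssim> X" "W \<lesssim> Y"
    using assms unfolding small_def by auto
  obtain p :: "'u \<times> 'u \<Rightarrow> 'u" where "bij_betw p (UNIV \<times> UNIV) UNIV"
    using card_of_Times_same_infinite[OF infinite_UNIV] card_of_ordIso by blast
  then have inj: "inj p"
    by (simp add: bij_betw_def)
  \<comment> \<open>The product is the union over \<open>X\<close> of copies of \<open>Y\<close>,
    one for each first coordinate, so closure under unions of families in \<open>U\<close>
    applies.\<close>
  have "(\<lambda>y. p (x, y)) ` Y \<in> U" for x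
    by (rule small_in_U[OF small_lepoll[OF small_member[OF XY(2)] image_lepoll]])
  then have "(\<Union>x\<in>X. (\<lambda>y. p (x, y)) ` Y) \<in> U"
    using universe XY(1) unfolding universe_def by simp
  moreover have "X \<times> Y \<lesssim> (\<Union>x\<in>X. (\<lambda>y. p (x, y)) ` Y)"
    unfolding lepoll_def by (intro exI[of _ p] conjI inj_on_subset[OF inj]) auto
  ultimately have "small (X \<times> Y)"
    unfolding small_def by blast
  moreover obtain f g where "inj_on f V" "f ` V \<subseteq> X" "inj_on g W" "g ` W \<subseteq> Y"
    using XY unfolding lepoll_def by auto
  then have "inj_on (map_prod f g) (V \<times> W)" "map_prod f g \<in> V \<times> W \<rightarrow> X \<times> Y"
    by (auto simp: image_subset_iff intro: map_prod_inj_on)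
  ultimately show ?thesis
    by (rule small_inj)
qed

lemma small_Pow:
  assumes "small V"
  shows "small (Pow V)"
proof -
  obtain X where X: "X \<in> U" "V \<lesssim> X"
    using assms unfolding small_def by auto
  then obtain f where f: "inj_on f V" "f ` V \<subseteq> X"
    unfolding lepoll_def by auto
  obtain Y where Y: "Y \<in> U" "Pow X \<approx> Y"
    using universe X(1) unfolding universe_def by blast
  have "Pow X \<lesssim> Y"
    using Y(2) by (rule eqpoll_imp_lepoll)
  then have "small (Pow X)"
    using Y(1) unfolding small_def by blast
  moreover have "inj_on ((`) f) (Pow V)" "(`) f \<in> Pow V \<rightarrow> Pow X"
    using f by (auto simp: inj_on_image_Pow)
  ultimately show ?thesis
    by (rule small_inj)
qed

lemma small_insert:
  assumes "small Y"
  shows "small (insert x Y)"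
proof (rule small_inj[OF small_Times[OF small_Pow[OF assms] small_Pow[OF small_singleton]]])
  \<comment> \<open>A point of \<open>Y\<close> goes to \<open>({z}, {})\<close>, and
    \<open>x\<close> outside \<open>Y\<close> to \<open>({}, {x})\<close>. This embeds the union in
    a product of power sets, so closure under binary unions at an arbitrary type need not be proved
    first.\<close>
  show "inj_on (\<lambda>z. ({z} \<inter> Y, {z} - Y)) (insert x Y)"
    by (auto simp: inj_on_def)
  show "(\<lambda>z. ({z} \<inter> Y, {z} - Y)) \<in> insert x Y \<rightarrow> Pow Y \<times> Pow {x}"
    by auto
qed

lemma small_PiE:
  assumes "small X" "small Y"
  shows "small (X \<rightarrow>\<^sub>E Y)"
proof (rule small_inj[OF small_Pow[OF small_Times[OF assms]]])
  \<comment> \<open>Extensional functions are determined by their graphs, which are subsets of the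
    product.\<close>
  let ?graph = "\<lambda>f. (\<lambda>x. (x, f x)) ` X"
  show "inj_on ?graph (X \<rightarrow>\<^sub>E Y)"
  proof (intro inj_onI PiE_ext)
    fix f g x assume "?graph f = ?graph g" "x \<in> X"
    then have "(x, f x) \<in> ?graph g"
      by blast
    then show "f x = g x"
      by auto
  qed
  show "?graph \<in> (X \<rightarrow>\<^sub>E Y) \<rightarrow> Pow (X \<times> Y)"
    by auto
qed

text \<open>Families with varying codomains are needed for limits of finite diagrams; splitting off
  one index reduces them to binary products.\<close>

lemma small_finite_PiE:
  assumes "finite I" "\<And>i. i \<in> I \<Longrightarrow> small (X i)"
  shows "small (PiE I X)"
  using assms
proof (induction I)
  case empty
  then show ?case by (simp add: small_singleton)
next
  case (insert i I)
  then have "small (X i \<times> PiE I X)"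
    by (intro small_Times) auto
  then show ?case
  proof (rule small_inj)
    show "inj_on (\<lambda>f. (f i, restrict f I)) (PiE (insert i I) X)"
    proof (intro inj_onI PiE_ext)
      fix f g j assume "(f i, restrict f I) = (g i, restrict g I)" "j \<in> insert i I"
      then show "f j = g j"
        by (metis insertE prod.inject restrict_apply')
    qed
  qed auto
qed

lemma small_code:
  assumes "small W"
  obtains Z j where "Z \<in> U" "bij_betw j Z W"
proof -
  obtain Y f where Y: "Y \<in> U" "inj_on f W" "f ` W \<subseteq> Y"
    using assms unfolding small_def lepoll_def by auto
  have "f ` W \<in> U"
    by (rule small_in_U[OF small_subset[OF small_member[OF Y(1)] Y(3)]])
  moreover have "bij_betw (inv_into W f) (f ` W) W"
    using Y(2) by (intro bij_betw_inv_into) (simp add: bij_betw_def)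
  ultimately show ?thesis
    by (rule that)
qed

end

section \<open>Global sections\<close>

lemma set_hom_iff:
  "a \<in> hom (set_cat U) X Y \<longleftrightarrow> X \<in> U \<and> Y \<in> U \<and> (\<exists>f\<in>X \<rightarrow>\<^sub>E Y. a = (X, f, Y))"
  by (auto simp: hom_def set_cat_def)

lemma set_comp [simp]: "(Y, g, Z) \<cdot>\<^bsub>set_cat U\<^esub> (X, f, Y') = (X, compose X g f, Z)"
  by (simp add: set_cat_def)

lemma set_obj [simp]: "Obj (set_cat U) = U"
  by (simp add: set_cat_def)

lemma set_ide [simp]: "Ide (set_cat U) X = (X, restrict (\<lambda>x. x) X, X)"
  by (simp add: set_cat_def)

lemma is_category_set_cat: "is_category (set_cat U)"
  unfolding is_category_def
proof (intro conjI ballI impI)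
  fix f assume "f \<in> Arr (set_cat U)"
  then obtain X g Y where f: "f = (X, g, Y)" "g \<in> X \<rightarrow>\<^sub>E Y"
    by (auto simp: set_cat_def)
  then show "f \<cdot>\<^bsub>set_cat U\<^esub> Ide (set_cat U) (Dom (set_cat U) f) = f"
    "Ide (set_cat U) (Cod (set_cat U) f) \<cdot>\<^bsub>set_cat U\<^esub> f = f"
    by (auto simp: set_cat_def compose_def PiE_iff fun_eq_iff extensional_def restrict_def)
qed (auto simp: set_cat_def hom_def compose_def fun_eq_iff)

locale based_cat = cat C for C :: "('o, 'u) category" (structure) +
  fixes U :: "'u set set" and T :: 'o
  assumes locally_small: "locally_small U C" and terminal: "is_terminal C T"
begin

lemma T_obj: "T \<in> Obj C"
  using terminal unfolding is_terminal_def by blast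

lemma to_T_ex: "X \<in> Obj C \<Longrightarrow> \<exists>h. h \<in> hom C X T"
  using terminal unfolding is_terminal_def by blast

lemma to_T_eq: "f \<in> hom C X T \<Longrightarrow> g \<in> hom C X T \<Longrightarrow> f = g"
  using terminal hom_obj unfolding is_terminal_def by blast

lemma points_T: "hom C T T = {Ide C T}"
  using ide_hom[OF T_obj] to_T_eq by blast

lemma points_in_U: "X \<in> Obj C \<Longrightarrow> hom C T X \<in> U"
  using locally_small T_obj unfolding locally_small_def by blast

lemma sections_arr:
  "f \<in> hom C X Y \<Longrightarrow> FArr (global_sections C T) f =
    (hom C T X, restrict (\<lambda>x. f \<cdot> x) (hom C T X), hom C T Y)"
  by (simp add: covariant_hom_def homD)

lemma sections_obj: "FObj (global_sections C T) X = hom C T X"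
  by (simp add: covariant_hom_def)

lemma sections_functor: "is_functor C (set_cat U) (global_sections C T)"
proof (rule functorI)
  fix f X Y assume "f \<in> hom C X Y"
  then show "FArr (global_sections C T) f \<in>
      hom (set_cat U) (FObj (global_sections C T) X) (FObj (global_sections C T) Y)"
    using hom_obj[of f X Y] by (auto simp: sections_arr sections_obj set_hom_iff points_in_U intro: comp_hom)
next
  fix f g X Y Z assume f: "f \<in> hom C X Y" and g: "g \<in> hom C Y Z"
  have "(g \<cdot> f) \<cdot> x = g \<cdot> (f \<cdot> x)" "f \<cdot> x \<in> hom C T Y" if "x \<in> hom C T X" for x
    using that f g by (auto intro: assoc comp_hom)
  then show "FArr (global_sections C T) (g \<cdot> f) =
      FArr (global_sections C T) g \<cdot>\<^bsub>set_cat U\<^esub> FArr (global_sections C T) f"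
    by (simp add: sections_arr[OF f] sections_arr[OF g] sections_arr[OF comp_hom[OF f g]]
        compose_def fun_eq_iff)
qed (auto simp: sections_arr[OF ide_hom] sections_obj is_cat is_category_set_cat points_in_U
    ide_comp fun_eq_iff)

text \<open>A right adjoint from universal arrows, with the counit given as a function on points.
  Existence and uniqueness of lifts make \<open>N\<close> functorial and \<eta> natural: each
  equation between arrows into \<open>N0 S\<close> is tested by \<open>ep S\<close> on points, where
  it becomes an equation of functions.\<close>

lemma adjunction_of_universal_arrows:
  assumes N0: "\<And>S. S \<in> U \<Longrightarrow> N0 S \<in> Obj C"
    and ep: "\<And>S x. S \<in> U \<Longrightarrow> x \<in> hom C T (N0 S) \<Longrightarrow> ep S x \<in> S"
    and ex: "\<And>S X g. S \<in> U \<Longrightarrow> X \<in> Obj C \<Longrightarrow> g \<in> hom C T X \<rightarrow> S \<Longrightarrow>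
      \<exists>h\<in>hom C X (N0 S). \<forall>x\<in>hom C T X. ep S (h \<cdot> x) = g x"
    and uniq: "\<And>S X h h'. S \<in> U \<Longrightarrow> h \<in> hom C X (N0 S) \<Longrightarrow> h' \<in> hom C X (N0 S) \<Longrightarrow>
      (\<And>x. x \<in> hom C T X \<Longrightarrow> ep S (h \<cdot> x) = ep S (h' \<cdot> x)) \<Longrightarrow> h = h'"
  shows "\<exists>N \<eta> \<epsilon>. adjunction C (set_cat U) (global_sections C T) N \<eta> \<epsilon>"
proof -
  interpret set: cat "set_cat U"
    by unfold_locales (rule is_category_set_cat)
  define lift where "lift X S g = (SOME h. h \<in> hom C X (N0 S) \<and> (\<forall>x\<in>hom C T X. ep S (h \<cdot> x) = g x))"
    for X S g
  have lift: "lift X S g \<in> hom C X (N0 S)" "x \<in> hom C T X \<Longrightarrow> ep S (lift X S g \<cdot> x) = g x"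
    if "S \<in> U" "X \<in> Obj C" "g \<in> hom C T X \<rightarrow> S" for S X g x
    using someI_ex[OF ex[OF that, unfolded Bex_def]] unfolding lift_def[symmetric] by simp_all
  define N where "N = \<lparr>FObj = N0, FArr = (\<lambda>(S, g, S'). lift (N0 S) S' (\<lambda>y. g (ep S y)))\<rparr>"
  have N_obj: "FObj N = N0" by (simp add: N_def)
  have N_arr: "FArr N (S, g, S') \<in> hom C (N0 S) (N0 S')"
    "y \<in> hom C T (N0 S) \<Longrightarrow> ep S' (FArr N (S, g, S') \<cdot> y) = g (ep S y)"
    if "S \<in> U" "S' \<in> U" "g \<in> S \<rightarrow>\<^sub>E S'" for S S' g y
  proof -
    have g: "(\<lambda>y. g (ep S y)) \<in> hom C T (N0 S) \<rightarrow> S'"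
      using that ep by auto
    show "FArr N (S, g, S') \<in> hom C (N0 S) (N0 S')"
      "y \<in> hom C T (N0 S) \<Longrightarrow> ep S' (FArr N (S, g, S') \<cdot> y) = g (ep S y)"
      using lift[OF that(2) N0[OF that(1)] g] by (simp_all add: N_def)
  qed
  have N: "is_functor (set_cat U) C N"
  proof (rule functorI)
    fix a X Y assume "a \<in> hom (set_cat U) X Y"
    then show "FArr N a \<in> hom C (FObj N X) (FObj N Y)"
      by (auto simp: set_hom_iff N_obj intro: N_arr)
  next
    fix X assume "X \<in> Obj (set_cat U)"
    then have X: "X \<in> U" by simp
    have "restrict (\<lambda>x. x) X \<in> X \<rightarrow>\<^sub>E X"
      by simp
    note NI = N_arr[OF X X this]
    have "FArr N (X, restrict (\<lambda>x. x) X, X) = Ide C (N0 X)"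
      by (rule uniq[OF X NI(1) ide_hom[OF N0[OF X]]]) (simp add: NI(2) ide_comp ep[OF X])
    then show "FArr N (Ide (set_cat U) X) = Ide C (FObj N X)"
      by (simp add: N_obj)
  next
    fix a b X Y Z assume a: "a \<in> hom (set_cat U) X Y" and b: "b \<in> hom (set_cat U) Y Z"
    then obtain f g where fg: "a = (X, f, Y)" "b = (Y, g, Z)" "f \<in> X \<rightarrow>\<^sub>E Y" "g \<in> Y \<rightarrow>\<^sub>E Z"
      and U: "X \<in> U" "Y \<in> U" "Z \<in> U"
      by (auto simp: set_hom_iff)
    have gf: "compose X g f \<in> X \<rightarrow>\<^sub>E Z"
      using fg by (auto simp: compose_def)
    note Nf = N_arr[OF U(1,2) fg(3)] and Ng = N_arr[OF U(2,3) fg(4)] and Ngf = N_arr[OF U(1,3) gf]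
    have "FArr N (X, compose X g f, Z) = FArr N (Y, g, Z) \<cdot> FArr N (X, f, Y)"
    proof (rule uniq[OF U(3) Ngf(1) comp_hom[OF Nf(1) Ng(1)]])
      fix x assume x: "x \<in> hom C T (N0 X)"
      show "ep Z (FArr N (X, compose X g f, Z) \<cdot> x) = ep Z (FArr N (Y, g, Z) \<cdot> FArr N (X, f, Y) \<cdot> x)"
        by (simp add: assoc[OF x Nf(1) Ng(1)] Ng(2)[OF comp_hom[OF x Nf(1)]] Nf(2)[OF x] Ngf(2)[OF x]
            compose_eq[OF ep[OF U(1) x]])
    qed
    then show "FArr N (b \<cdot>\<^bsub>set_cat U\<^esub> a) = FArr N b \<cdot> FArr N a"
      by (simp add: fg)
  qed (simp_all add: N0 N_obj is_cat is_category_set_cat)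
  \<comment> \<open>The unit is the lift of the identity function on the points of \<open>X\<close>,
    so one triangle identity holds by the choice of the lift.\<close>
  define \<eta> where "\<eta> X = lift X (hom C T X) (\<lambda>x. x)" for X
  have \<eta>: "\<eta> X \<in> hom C X (N0 (hom C T X))" "x \<in> hom C T X \<Longrightarrow> ep (hom C T X) (\<eta> X \<cdot> x) = x"
    if "X \<in> Obj C" for X x
    using lift[OF points_in_U[OF that] that, of "\<lambda>x. x"] unfolding \<eta>_def by auto
  define \<epsilon> where "\<epsilon> S = (hom C T (N0 S), restrict (ep S) (hom C T (N0 S)), S)" for S
  have nat_\<eta>: "nat_trans C C id_functor (N \<circ>\<^sub>F global_sections C T) \<eta>"
  proof (rule nat_transI)
    fix X assume "X \<in> Obj C"
    then show "\<eta> X \<in> hom C (FObj id_functor X) (FObj (N \<circ>\<^sub>F global_sections C T) X)"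
      using \<eta> by (simp add: comp_functor_def id_functor_def N_obj sections_obj)
  next
    fix f X Y assume f: "f \<in> hom C X Y"
    have X: "X \<in> Obj C" and Y: "Y \<in> Obj C"
      using f hom_obj by auto
    have "restrict ((\<cdot>) f) (hom C T X) \<in> hom C T X \<rightarrow>\<^sub>E hom C T Y"
      using f by (auto intro: comp_hom)
    note Nf = N_arr[OF points_in_U[OF X] points_in_U[OF Y] this]
    have "FArr N (FArr (global_sections C T) f) \<cdot> \<eta> X = \<eta> Y \<cdot> f"
    proof (unfold sections_arr[OF f], rule uniq[OF points_in_U[OF Y] comp_hom[OF \<eta>(1)[OF X] Nf(1)]
            comp_hom[OF f \<eta>(1)[OF Y]]])
      fix x assume x: "x \<in> hom C T X"
      show "ep (hom C T Y) (FArr N (hom C T X, restrict ((\<cdot>) f) (hom C T X), hom C T Y) \<cdot> \<eta> X \<cdot> x) =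
        ep (hom C T Y) (\<eta> Y \<cdot> f \<cdot> x)"
        using x by (simp add: assoc[OF x \<eta>(1)[OF X] Nf(1)] assoc[OF x f \<eta>(1)[OF Y]]
            Nf(2)[OF comp_hom[OF x \<eta>(1)[OF X]]] \<eta>(2)[OF X x] \<eta>(2)[OF Y comp_hom[OF x f]])
    qed
    then show "FArr (N \<circ>\<^sub>F global_sections C T) f \<cdot> \<eta> X = \<eta> Y \<cdot> FArr id_functor f"
      by (simp add: comp_functor_def id_functor_def)
  qed (intro id_functor is_cat comp_functor[OF sections_functor N])+
  have \<epsilon>: "\<epsilon> S \<in> hom (set_cat U) (hom C T (N0 S)) S" if "S \<in> U" for S
    using that N0[OF that] ep[OF that] points_in_U unfolding \<epsilon>_def by (auto simp: set_hom_iff)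
  have nat_\<epsilon>: "nat_trans (set_cat U) (set_cat U) (global_sections C T \<circ>\<^sub>F N) id_functor \<epsilon>"
  proof (rule nat_transI)
    fix S assume "S \<in> Obj (set_cat U)"
    then show "\<epsilon> S \<in> hom (set_cat U) (FObj (global_sections C T \<circ>\<^sub>F N) S) (FObj id_functor S)"
      using \<epsilon> by (simp add: comp_functor_def id_functor_def N_obj sections_obj)
  next
    fix a X Y assume a: "a \<in> hom (set_cat U) X Y"
    then obtain f where f: "a = (X, f, Y)" "f \<in> X \<rightarrow>\<^sub>E Y" and U: "X \<in> U" "Y \<in> U"
      by (auto simp: set_hom_iff)
    note Nf = N_arr[OF U f(2)]
    show "FArr id_functor a \<cdot>\<^bsub>set_cat U\<^esub> \<epsilon> X = \<epsilon> Y \<cdot>\<^bsub>set_cat U\<^esub> FArr (global_sections C T \<circ>\<^sub>F N) a"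
      by (auto simp: comp_functor_def id_functor_def f(1) sections_arr[OF Nf(1)] \<epsilon>_def compose_def
          Nf(2) comp_hom[OF _ Nf(1)] fun_eq_iff)
  qed (intro id_functor is_category_set_cat comp_functor[OF N sections_functor])+
  have "\<epsilon> (FObj (global_sections C T) X) \<cdot>\<^bsub>set_cat U\<^esub> FArr (global_sections C T) (\<eta> X) =
      Ide (set_cat U) (FObj (global_sections C T) X)" if X: "X \<in> Obj C" for X
    by (auto simp: sections_obj sections_arr[OF \<eta>(1)[OF X]] \<epsilon>_def compose_def \<eta>(2)[OF X]
        comp_hom[OF _ \<eta>(1)[OF X]] fun_eq_iff)
  moreover have "FArr N (\<epsilon> S) \<cdot> \<eta> (FObj N S) = Ide C (FObj N S)" if "S \<in> Obj (set_cat U)" for S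
  proof -
    have S: "S \<in> U" using that by simp
    have "restrict (ep S) (hom C T (N0 S)) \<in> hom C T (N0 S) \<rightarrow>\<^sub>E S"
      using ep[OF S] by auto
    note N\<epsilon> = N_arr[OF points_in_U[OF N0[OF S]] S this]
    note \<eta>N = \<eta>[OF N0[OF S]]
    show ?thesis
      unfolding \<epsilon>_def N_obj
    proof (rule uniq[OF S comp_hom[OF \<eta>N(1) N\<epsilon>(1)] ide_hom[OF N0[OF S]]])
      fix x assume x: "x \<in> hom C T (N0 S)"
      show "ep S (FArr N (hom C T (N0 S), restrict (ep S) (hom C T (N0 S)), S) \<cdot> \<eta> (N0 S) \<cdot> x) =
          ep S (Ide C (N0 S) \<cdot> x)"
        using x by (simp add: assoc[OF x \<eta>N(1) N\<epsilon>(1)] N\<epsilon>(2)[OF comp_hom[OF x \<eta>N(1)]] \<eta>N(2)[OF x]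
            ide_comp[OF x])
    qed
  qed
  ultimately have "adjunction C (set_cat U) (global_sections C T) N \<eta> \<epsilon>"
    unfolding adjunction_def using sections_functor N nat_\<eta> nat_\<epsilon> by simp
  then show ?thesis
    by blast
qed

end

section \<open>Well-pointed local categories\<close>

text \<open>Arrows 0, 1, 2 are the identities, 3 goes from 0 to 2 and 4 from 1 to 2. A composable
  pair always contains an identity, and \<open>g \<le> 2\<close> tests whether \<open>g\<close> is
  one.\<close>

definition cospan_shape :: "(nat, nat) category" where
  "cospan_shape = \<lparr>Obj = {0, 1, 2}, Arr = {0, 1, 2, 3, 4},
     Dom = (\<lambda>k. if k = 3 then 0 else if k = 4 then 1 else k),
     Cod = (\<lambda>k. if k = 3 \<or> k = 4 then 2 else k),
     Ide = (\<lambda>j. j), Comp = (\<lambda>g f. if g \<le> 2 then f else g)\<rparr>"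

lemma is_category_cospan_shape: "is_category cospan_shape"
  unfolding is_category_def cospan_shape_def hom_def by auto

context cat
begin

lemma pullback_exists:
  assumes lim: "has_finite_limits C" and f: "f \<in> hom C X Z" and g: "g \<in> hom C Y Z"
  obtains P p q where "p \<in> hom C P X" "q \<in> hom C P Y" "is_pullback C p q f g"
proof -
  define D :: "(nat, nat, _, _) cfunctor" where
    "D = \<lparr>FObj = (\<lambda>j. if j = 0 then X else if j = 1 then Y else Z),
       FArr = (\<lambda>k. if k = 0 then Ide C X else if k = 1 then Ide C Y else if k = 2 then Ide C Z
         else if k = 3 then f else g)\<rparr>"
  note objs = hom_obj[OF f] hom_obj[OF g]
  note ids = ide_hom[OF objs(1)] ide_hom[OF objs(2)] ide_hom[OF objs(3)]
  have D: "is_functor cospan_shape C D"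
    unfolding is_functor_def
  proof (intro conjI ballI impI)
    fix a b assume "a \<in> Arr cospan_shape" "b \<in> Arr cospan_shape"
      "Cod cospan_shape a = Dom cospan_shape b"
    then show "FArr D (b \<cdot>\<^bsub>cospan_shape\<^esub> a) = FArr D b \<cdot> FArr D a"
      using comp_ide[OF f] comp_ide[OF g] ide_comp[OF f] ide_comp[OF g]
        ide_comp[OF ids(1)] ide_comp[OF ids(2)] ide_comp[OF ids(3)]
      by (auto simp: cospan_shape_def D_def split: if_splits)
  qed (use objs ids f g is_cat is_category_cospan_shape in \<open>auto simp: cospan_shape_def D_def\<close>)
  have "finite (Obj cospan_shape)" "finite (Arr cospan_shape)"
    by (auto simp: cospan_shape_def)
  then obtain L \<pi> where L: "is_limit C cospan_shape D L \<pi>"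
    using lim D unfolding has_finite_limits_def by blast
  have cone_iff: "is_cone C cospan_shape D M \<mu> \<longleftrightarrow> M \<in> Obj C \<and> \<mu> 0 \<in> hom C M X \<and> \<mu> 1 \<in> hom C M Y \<and>
      \<mu> 2 \<in> hom C M Z \<and> f \<cdot> \<mu> 0 = \<mu> 2 \<and> g \<cdot> \<mu> 1 = \<mu> 2" for M \<mu>
    unfolding is_cone_def cospan_shape_def D_def by (auto simp: ide_comp)
  have \<pi>: "\<pi> 0 \<in> hom C L X" "\<pi> 1 \<in> hom C L Y" "\<pi> 2 = f \<cdot> \<pi> 0" "f \<cdot> \<pi> 0 = g \<cdot> \<pi> 1"
    using L unfolding is_limit_def cone_iff by auto
  have "is_pullback C (\<pi> 0) (\<pi> 1) f g"
  proof (rule pullbackI[OF f g \<pi>(1,2,4)])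
    fix W a b assume W: "W \<in> Obj C" and a: "a \<in> hom C W X" and b: "b \<in> hom C W Y"
      and eq: "f \<cdot> a = g \<cdot> b"
    \<comment> \<open>The leg of the cone at the vertex 2 is forced to be the common
      composite.\<close>
    define \<mu> :: "nat \<Rightarrow> 'm" where "\<mu> = (\<lambda>j. if j = 0 then a else if j = 1 then b else f \<cdot> a)"
    have "is_cone C cospan_shape D W \<mu>"
      using W a b eq comp_hom[OF a f] unfolding cone_iff by (simp add: \<mu>_def)
    then have ex1: "\<exists>!h. h \<in> hom C W L \<and> (\<forall>j\<in>Obj cospan_shape. \<pi> j \<cdot> h = \<mu> j)"
      using L unfolding is_limit_def by blast
    have iff: "h \<in> hom C W L \<and> (\<forall>j\<in>Obj cospan_shape. \<pi> j \<cdot> h = \<mu> j) \<longleftrightarrow>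
        h \<in> hom C W L \<and> \<pi> 0 \<cdot> h = a \<and> \<pi> 1 \<cdot> h = b" for h
      using assoc[of h W L "\<pi> 0" X f Z] \<pi> f by (auto simp: cospan_shape_def \<mu>_def)
    show "\<exists>!h. h \<in> hom C W L \<and> \<pi> 0 \<cdot> h = a \<and> \<pi> 1 \<cdot> h = b"
      using ex1 unfolding iff .
  qed
  then show ?thesis
    by (rule that[OF \<pi>(1,2)])
qed

end

locale well_pointed_cat = based_cat C U T for C :: "('o, 'u) category" (structure) and U T +
  fixes N \<eta> \<epsilon>
  assumes adj: "adjunction C (set_cat U) (global_sections C T) N \<eta> \<epsilon>"
    and faithful: "faithful C (global_sections C T)"
begin

section \<open>The universal property of \<nabla> in terms of global points\<close>

lemma points_eqI:
  assumes f: "f \<in> hom C X Y" and g: "g \<in> hom C X Y" and "\<And>x. x \<in> hom C T X \<Longrightarrow> f \<cdot> x = g \<cdot> x"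
  shows "f = g"
proof -
  have "FArr (global_sections C T) f = FArr (global_sections C T) g"
    using assms by (simp add: sections_arr[OF f] sections_arr[OF g] fun_eq_iff)
  then show ?thesis
    using faithful f g hom_obj[OF f] unfolding faithful_def inj_on_def by blast
qed

text \<open>The function underlying the counit at \<open>S\<close>. \<open>counit_surj\<close> and
  \<open>counit_inj\<close> make it a bijection, so that points of \<open>nabla S\<close> can be
  treated as elements of \<open>S\<close>.\<close>

definition counit :: "'u set \<Rightarrow> 'u \<Rightarrow> 'u" where
  "counit S = fst (snd (\<epsilon> S))"

abbreviation nabla :: "'u set \<Rightarrow> 'o" where
  "nabla S \<equiv> FObj N S"

lemma N_functor: "is_functor (set_cat U) C N"
  using adj unfolding adjunction_def by blast

lemma nabla_obj: "S \<in> U \<Longrightarrow> nabla S \<in> Obj C"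
  using functor_obj[OF N_functor] by simp

lemma nabla_arr:
  "S \<in> U \<Longrightarrow> S' \<in> U \<Longrightarrow> g \<in> S \<rightarrow>\<^sub>E S' \<Longrightarrow> FArr N (S, g, S') \<in> hom C (nabla S) (nabla S')"
  by (rule functor_hom[OF N_functor]) (auto simp: set_hom_iff)

lemma \<epsilon>_eq:
  assumes S: "S \<in> U"
  shows "\<epsilon> S = (hom C T (nabla S), counit S, S)" "counit S \<in> hom C T (nabla S) \<rightarrow>\<^sub>E S"
proof -
  have "nat_trans (set_cat U) (set_cat U) (global_sections C T \<circ>\<^sub>F N) id_functor \<epsilon>"
    using adj unfolding adjunction_def by blast
  from nat_transD(1)[OF this] S have "\<epsilon> S \<in> hom (set_cat U) (hom C T (nabla S)) S"
    by (simp add: comp_functor_def id_functor_def sections_obj)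
  then show "\<epsilon> S = (hom C T (nabla S), counit S, S)" "counit S \<in> hom C T (nabla S) \<rightarrow>\<^sub>E S"
    by (auto simp: set_hom_iff counit_def)
qed

lemma counit_in: "S \<in> U \<Longrightarrow> y \<in> hom C T (nabla S) \<Longrightarrow> counit S y \<in> S"
  using \<epsilon>_eq(2)[of S] by auto

lemma counit_nabla:
  assumes S: "S \<in> U" "S' \<in> U" and g: "g \<in> S \<rightarrow>\<^sub>E S'" and y: "y \<in> hom C T (nabla S)"
  shows "counit S' (FArr N (S, g, S') \<cdot> y) = g (counit S y)"
proof -
  have nat: "nat_trans (set_cat U) (set_cat U) (global_sections C T \<circ>\<^sub>F N) id_functor \<epsilon>"
    using adj unfolding adjunction_def by blast
  have "(S, g, S') \<in> hom (set_cat U) S S'"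
    using S g by (simp add: set_hom_iff)
  from nat_transD(2)[OF nat this] have "compose (hom C T (nabla S)) g (counit S) y =
      compose (hom C T (nabla S)) (counit S')
        (restrict (\<lambda>x. FArr N (S, g, S') \<cdot> x) (hom C T (nabla S))) y"
    by (simp add: id_functor_def comp_functor_def sections_arr[OF nabla_arr[OF S g]]
        \<epsilon>_eq(1)[OF S(1)] \<epsilon>_eq(1)[OF S(2)])
  then show ?thesis
    using y by (simp add: compose_eq)
qed

lemma \<eta>_hom: "X \<in> Obj C \<Longrightarrow> \<eta> X \<in> hom C X (nabla (hom C T X))"
proof -
  have "nat_trans C C id_functor (N \<circ>\<^sub>F global_sections C T) \<eta>"
    using adj unfolding adjunction_def by blast
  from nat_transD(1)[OF this] show "X \<in> Obj C \<Longrightarrow> ?thesis"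
    by (simp add: comp_functor_def id_functor_def sections_obj)
qed

lemma counit_\<eta>:
  assumes X: "X \<in> Obj C" and x: "x \<in> hom C T X"
  shows "counit (hom C T X) (\<eta> X \<cdot> x) = x"
proof -
  have "\<epsilon> (FObj (global_sections C T) X) \<cdot>\<^bsub>set_cat U\<^esub> FArr (global_sections C T) (\<eta> X) =
      Ide (set_cat U) (FObj (global_sections C T) X)"
    using adj X unfolding adjunction_def by blast
  then have "compose (hom C T X) (counit (hom C T X)) (restrict (\<lambda>x. \<eta> X \<cdot> x) (hom C T X)) x =
      restrict (\<lambda>x. x) (hom C T X) x"
    by (simp add: sections_obj sections_arr[OF \<eta>_hom[OF X]] \<epsilon>_eq(1)[OF points_in_U[OF X]])
  then show ?thesis
    using x by (simp add: compose_eq)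
qed

lemma nabla_lift:
  assumes S: "S \<in> U" and X: "X \<in> Obj C" and g: "g \<in> hom C T X \<rightarrow> S"
  obtains h where "h \<in> hom C X (nabla S)" "\<And>x. x \<in> hom C T X \<Longrightarrow> counit S (h \<cdot> x) = g x"
proof -
  let ?g = "restrict g (hom C T X)"
  have g': "?g \<in> hom C T X \<rightarrow>\<^sub>E S"
    using g by auto
  note Ng = nabla_arr[OF points_in_U[OF X] S g']
  note h = comp_hom[OF \<eta>_hom[OF X] Ng]
  show ?thesis
  proof (rule that[OF h])
    fix x assume x: "x \<in> hom C T X"
    show "counit S (FArr N (hom C T X, ?g, S) \<cdot> \<eta> X \<cdot> x) = g x"
      using x by (simp add: assoc[OF x \<eta>_hom[OF X] Ng] counit_\<eta>[OF X x]
          counit_nabla[OF points_in_U[OF X] S g' comp_hom[OF x \<eta>_hom[OF X]]])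
  qed
qed

text \<open>The constant function with value \<open>s\<close> on the points of \<open>T\<close>
  lifts to an arrow from \<open>T\<close> to \<open>nabla S\<close>, which is itself a
  point.\<close>

lemma counit_surj:
  assumes S: "S \<in> U" and s: "s \<in> S"
  obtains y where "y \<in> hom C T (nabla S)" "counit S y = s"
proof -
  obtain h where h: "h \<in> hom C T (nabla S)" "\<And>x. x \<in> hom C T T \<Longrightarrow> counit S (h \<cdot> x) = s"
    using s by (auto intro: nabla_lift[OF S T_obj, of "\<lambda>_. s"])
  then have "counit S h = s"
    using h(2)[OF ide_hom[OF T_obj]] by (simp add: comp_ide[OF h(1)])
  then show ?thesis
    using that h(1) by blast
qed

text \<open>Uniqueness half of the adjunction: by naturality of \<eta> and a triangle identity every
  \<open>k\<close> is recovered from the function \<open>?c k\<close> on points.\<close>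

lemma nabla_eqI:
  assumes S: "S \<in> U" and h: "h \<in> hom C X (nabla S)" and h': "h' \<in> hom C X (nabla S)"
    and eq: "\<And>x. x \<in> hom C T X \<Longrightarrow> counit S (h \<cdot> x) = counit S (h' \<cdot> x)"
  shows "h = h'"
proof -
  have X: "X \<in> Obj C"
    using hom_obj h by blast
  let ?c = "\<lambda>k. restrict (\<lambda>x. counit S (k \<cdot> x)) (hom C T X)"
  have "k = FArr N (hom C T X, ?c k, S) \<cdot> \<eta> X" if k: "k \<in> hom C X (nabla S)" for k
  proof -
    note NS = nabla_obj[OF S]
    note Nk = functor_hom[OF N_functor functor_hom[OF sections_functor k], unfolded sections_obj]
    note N\<epsilon> = nabla_arr[OF points_in_U[OF NS] S \<epsilon>_eq(2)[OF S]]
    have Nck: "FArr N (hom C T X, ?c k, S) =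
        FArr N (hom C T (nabla S), counit S, S) \<cdot> FArr N (FArr (global_sections C T) k)"
    proof -
      have a: "FArr (global_sections C T) k \<in> hom (set_cat U) (hom C T X) (hom C T (nabla S))"
        using functor_hom[OF sections_functor k] by (simp add: sections_obj)
      have b: "(hom C T (nabla S), counit S, S) \<in> hom (set_cat U) (hom C T (nabla S)) S"
        using \<epsilon>_eq(2)[OF S] S points_in_U[OF NS] by (simp add: set_hom_iff)
      have "(hom C T (nabla S), counit S, S) \<cdot>\<^bsub>set_cat U\<^esub> FArr (global_sections C T) k =
          (hom C T X, ?c k, S)"
        by (simp add: sections_arr[OF k] compose_def fun_eq_iff)
      then show ?thesis
        using functor_comp[OF N_functor a b] by simp
    qed
    have "nat_trans C C id_functor (N \<circ>\<^sub>F global_sections C T) \<eta>"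
      using adj unfolding adjunction_def by blast
    from nat_transD(2)[OF this k]
    have nat: "FArr N (FArr (global_sections C T) k) \<cdot> \<eta> X = \<eta> (nabla S) \<cdot> k"
      by (simp add: comp_functor_def id_functor_def)
    have tri: "FArr N (hom C T (nabla S), counit S, S) \<cdot> \<eta> (nabla S) = Ide C (nabla S)"
      using adj S \<epsilon>_eq(1)[OF S] unfolding adjunction_def by force
    show ?thesis
      unfolding Nck using assoc[OF \<eta>_hom[OF X] Nk N\<epsilon>] assoc[OF k \<eta>_hom[OF NS] N\<epsilon>]
      by (simp add: nat tri ide_comp[OF k])
  qed
  moreover have "?c h = ?c h'"
    using eq by (simp add: fun_eq_iff)
  ultimately show ?thesis
    using h h' by metis
qed

text \<open>An instance of \<open>nabla_eqI\<close> for arrows out of \<open>T\<close>, whose only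
  point is its identity.\<close>

lemma counit_inj:
  assumes S: "S \<in> U" and "y \<in> hom C T (nabla S)" "y' \<in> hom C T (nabla S)"
    and "counit S y = counit S y'"
  shows "y = y'"
  using assms by (intro nabla_eqI[OF S, of y T y']) (auto simp: points_T comp_ide)

abbreviation closed :: "'u \<Rightarrow> bool" where
  "closed \<equiv> closed_arrow C T N \<eta>"

text \<open>Arrows into \<open>\<nabla>S\<close> are functions on points, so the pullback condition only asks that functions
  on points lifting an arrow are themselves arrows.\<close>

lemma closed_iff:
  assumes f: "f \<in> hom C X Y"
  shows "closed f \<longleftrightarrow> (\<forall>Z a b. a \<in> hom C Z Y \<longrightarrow>
      (\<forall>z\<in>hom C T Z. b z \<in> hom C T X \<and> f \<cdot> b z = a \<cdot> z) \<longrightarrow>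
      (\<exists>h\<in>hom C Z X. \<forall>z\<in>hom C T Z. h \<cdot> z = b z))"
proof -
  have X: "X \<in> Obj C" and Y: "Y \<in> Obj C"
    using f hom_obj by auto
  let ?f = "restrict (\<lambda>x. f \<cdot> x) (hom C T X)"
  let ?Nf = "FArr N (hom C T X, ?f, hom C T Y)"
  have f': "?f \<in> hom C T X \<rightarrow>\<^sub>E hom C T Y"
    using comp_hom[OF _ f] by auto
  note Nf = nabla_arr[OF points_in_U[OF X] points_in_U[OF Y] f']
  have closed: "closed f \<longleftrightarrow> is_pullback C f (\<eta> X) (\<eta> Y) ?Nf"
    using homD[OF f] unfolding closed_arrow_def by (simp add: comp_functor_def sections_arr[OF f])
  have "nat_trans C C id_functor (N \<circ>\<^sub>F global_sections C T) \<eta>"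
    using adj unfolding adjunction_def by blast
  from nat_transD(2)[OF this f] have nat: "\<eta> Y \<cdot> f = ?Nf \<cdot> \<eta> X"
    by (simp add: comp_functor_def id_functor_def sections_arr[OF f])
  \<comment> \<open>A cone over the naturality square, read on points: \<open>b\<close> is a choice
    of points of \<open>X\<close>, and commutativity says that \<open>f\<close> maps this choice to
    \<open>a\<close>.\<close>
  have sq: "\<eta> Y \<cdot> a = ?Nf \<cdot> b \<longleftrightarrow> (\<forall>z\<in>hom C T Z. a \<cdot> z = f \<cdot> counit (hom C T X) (b \<cdot> z))"
    if a: "a \<in> hom C Z Y" and b: "b \<in> hom C Z (nabla (hom C T X))" for a b Z
  proof -
    have l: "counit (hom C T Y) (\<eta> Y \<cdot> a \<cdot> z) = a \<cdot> z" if z: "z \<in> hom C T Z" for z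
      by (simp add: assoc[OF z a \<eta>_hom[OF Y]] counit_\<eta>[OF Y comp_hom[OF z a]])
    have r: "counit (hom C T Y) (?Nf \<cdot> b \<cdot> z) = f \<cdot> counit (hom C T X) (b \<cdot> z)"
      if z: "z \<in> hom C T Z" for z
      using counit_in[OF points_in_U[OF X] comp_hom[OF z b]]
      by (simp add: assoc[OF z b Nf] counit_nabla[OF points_in_U[OF X] points_in_U[OF Y] f' comp_hom[OF z b]])
    show ?thesis
    proof
      assume "\<eta> Y \<cdot> a = ?Nf \<cdot> b"
      then show "\<forall>z\<in>hom C T Z. a \<cdot> z = f \<cdot> counit (hom C T X) (b \<cdot> z)"
        using l r by metis
    next
      assume "\<forall>z\<in>hom C T Z. a \<cdot> z = f \<cdot> counit (hom C T X) (b \<cdot> z)"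
      then show "\<eta> Y \<cdot> a = ?Nf \<cdot> b"
        using l r by (intro nabla_eqI[OF points_in_U[OF Y] comp_hom[OF a \<eta>_hom[OF Y]] comp_hom[OF b Nf]]) simp
    qed
  qed
  \<comment> \<open>Likewise, the second leg is matched exactly when \<open>h\<close> induces the
    choice of points given by \<open>b\<close>.\<close>
  have \<eta>_eq: "\<eta> X \<cdot> h = b \<longleftrightarrow> (\<forall>z\<in>hom C T Z. h \<cdot> z = counit (hom C T X) (b \<cdot> z))"
    if h: "h \<in> hom C Z X" and b: "b \<in> hom C Z (nabla (hom C T X))" for h b Z
  proof -
    have l: "counit (hom C T X) (\<eta> X \<cdot> h \<cdot> z) = h \<cdot> z" if z: "z \<in> hom C T Z" for z
      by (simp add: assoc[OF z h \<eta>_hom[OF X]] counit_\<eta>[OF X comp_hom[OF z h]])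
    show ?thesis
    proof
      assume "\<forall>z\<in>hom C T Z. h \<cdot> z = counit (hom C T X) (b \<cdot> z)"
      then show "\<eta> X \<cdot> h = b"
        using l by (intro nabla_eqI[OF points_in_U[OF X] comp_hom[OF h \<eta>_hom[OF X]] b]) simp
    qed (use l in auto)
  qed
  show ?thesis
    unfolding closed
  proof (intro iffI allI impI)
    fix Z a b assume pb: "is_pullback C f (\<eta> X) (\<eta> Y) ?Nf" and a: "a \<in> hom C Z Y"
      and b: "\<forall>z\<in>hom C T Z. b z \<in> hom C T X \<and> f \<cdot> b z = a \<cdot> z"
    have Z: "Z \<in> Obj C"
      using a hom_obj by auto
    obtain b' where b': "b' \<in> hom C Z (nabla (hom C T X))"
      "\<And>z. z \<in> hom C T Z \<Longrightarrow> counit (hom C T X) (b' \<cdot> z) = b z"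
      using b nabla_lift[OF points_in_U[OF X] Z, of b] by blast
    have "\<eta> Y \<cdot> a = ?Nf \<cdot> b'"
      unfolding sq[OF a b'(1)] using b b'(2) by simp
    from pullback_ex1[OF pb f \<eta>_hom[OF X] a b'(1) this]
    obtain h where h: "h \<in> hom C Z X" "\<eta> X \<cdot> h = b'"
      by blast
    then show "\<exists>h\<in>hom C Z X. \<forall>z\<in>hom C T Z. h \<cdot> z = b z"
      using \<eta>_eq[OF h(1) b'(1)] b'(2) by auto
  next
    assume R: "\<forall>Z a b. a \<in> hom C Z Y \<longrightarrow>
      (\<forall>z\<in>hom C T Z. b z \<in> hom C T X \<and> f \<cdot> b z = a \<cdot> z) \<longrightarrow>
      (\<exists>h\<in>hom C Z X. \<forall>z\<in>hom C T Z. h \<cdot> z = b z)"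
    show "is_pullback C f (\<eta> X) (\<eta> Y) ?Nf"
    proof (rule pullbackI[OF \<eta>_hom[OF Y] Nf f \<eta>_hom[OF X] nat])
      fix Z a b assume a: "a \<in> hom C Z Y" and b: "b \<in> hom C Z (nabla (hom C T X))"
        and eq: "\<eta> Y \<cdot> a = ?Nf \<cdot> b"
      have eq': "a \<cdot> z = f \<cdot> counit (hom C T X) (b \<cdot> z)" if "z \<in> hom C T Z" for z
        using eq that unfolding sq[OF a b] by blast
      have "\<exists>h\<in>hom C Z X. \<forall>z\<in>hom C T Z. h \<cdot> z = counit (hom C T X) (b \<cdot> z)"
        using R[rule_format, OF a, of "\<lambda>z. counit (hom C T X) (b \<cdot> z)"] eq'
          counit_in[OF points_in_U[OF X] comp_hom[OF _ b]] by simp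
      then obtain h where h: "h \<in> hom C Z X" "\<And>z. z \<in> hom C T Z \<Longrightarrow> h \<cdot> z = counit (hom C T X) (b \<cdot> z)"
        by blast
      show "\<exists>!h. h \<in> hom C Z X \<and> f \<cdot> h = a \<and> \<eta> X \<cdot> h = b"
      proof (intro ex1I[of _ h] conjI)
        show "f \<cdot> h = a"
          by (rule points_eqI[OF comp_hom[OF h(1) f] a]) (simp add: assoc[OF _ h(1) f] h(2) eq')
        show "\<eta> X \<cdot> h = b"
          unfolding \<eta>_eq[OF h(1) b] using h(2) by simp
        fix k assume k: "k \<in> hom C Z X \<and> f \<cdot> k = a \<and> \<eta> X \<cdot> k = b"
        then have "\<forall>z\<in>hom C T Z. k \<cdot> z = counit (hom C T X) (b \<cdot> z)"
          using \<eta>_eq[of k Z b] b by blast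
        then show "k = h"
          using k h by (intro points_eqI[of k Z X h]) auto
      qed (rule h(1))
    qed
  qed
qed

lemma closed_lift:
  assumes "closed f" and f: "f \<in> hom C X Y" and "a \<in> hom C Z Y"
    and "\<And>z. z \<in> hom C T Z \<Longrightarrow> b z \<in> hom C T X" "\<And>z. z \<in> hom C T Z \<Longrightarrow> f \<cdot> b z = a \<cdot> z"
  obtains h where "h \<in> hom C Z X" "\<And>z. z \<in> hom C T Z \<Longrightarrow> h \<cdot> z = b z"
  using assms(1,3-5) unfolding closed_iff[OF f] by blast

lemma closedI:
  assumes f: "f \<in> hom C X Y"
    and "\<And>Z a b. a \<in> hom C Z Y \<Longrightarrow> (\<And>z. z \<in> hom C T Z \<Longrightarrow> b z \<in> hom C T X) \<Longrightarrow>
      (\<And>z. z \<in> hom C T Z \<Longrightarrow> f \<cdot> b z = a \<cdot> z) \<Longrightarrow> \<exists>h\<in>hom C Z X. \<forall>z\<in>hom C T Z. h \<cdot> z = b z"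
  shows "closed f"
  unfolding closed_iff[OF f] using assms(2) by blast

end

lemma well_pointed_local_iff:
  "well_pointed_local U C T N \<eta> \<longleftrightarrow>
    has_finite_limits C \<and> (\<exists>\<epsilon>. well_pointed_cat C U T N \<eta> \<epsilon>)"
  unfolding well_pointed_local_def local_category_def well_pointed_cat_def well_pointed_cat_axioms_def
    based_cat_def based_cat_axioms_def cat_def by blast

section \<open>Weak local cartesian closure\<close>

lemma op_cat_simps [simp]:
  "Obj (op_cat C) = Obj C" "Arr (op_cat C) = Arr C" "Dom (op_cat C) = Cod C" "Cod (op_cat C) = Dom C"
  "Ide (op_cat C) = Ide C" "g \<cdot>\<^bsub>op_cat C\<^esub> f = f \<cdot>\<^bsub>C\<^esub> g"
  by (simp_all add: op_cat_def)

lemma op_hom [simp]: "hom (op_cat C) X Y = hom C Y X"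
  by (auto simp: hom_def)

lemma is_category_op: "is_category C \<Longrightarrow> is_category (op_cat C)"
  by (auto simp: is_category_def)

lemma op_functor:
  assumes "is_functor C D F"
  shows "is_functor (op_cat C) (op_cat D) F"
proof (rule functorI)
  fix f g X Y Z assume "f \<in> hom (op_cat C) X Y" "g \<in> hom (op_cat C) Y Z"
  then show "FArr F (g \<cdot>\<^bsub>op_cat C\<^esub> f) = FArr F g \<cdot>\<^bsub>op_cat D\<^esub> FArr F f"
    using functor_comp[OF assms] by simp
qed (use assms functor_cats[OF assms] in
    \<open>simp_all add: is_category_op functor_obj functor_hom functor_ide\<close>)

section \<open>Representable presheaves and weakly universal elements\<close>

context cat
begin

lemma presheaf_arr:
  "f \<in> hom C X Y \<Longrightarrow> FArr (presheaf_hom C B) f =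
    (hom C Y B, restrict (\<lambda>h. h \<cdot> f) (hom C Y B), hom C X B)"
  by (simp add: presheaf_hom_def homD)

lemma presheaf_obj: "FObj (presheaf_hom C B) X = hom C X B"
  by (simp add: presheaf_hom_def)

lemma presheaf_functor: "is_functor (op_cat C) (set_cat UNIV) (presheaf_hom C B)"
proof (rule functorI)
  fix f X Y assume "f \<in> hom (op_cat C) X Y"
  then show "FArr (presheaf_hom C B) f \<in>
      hom (set_cat UNIV) (FObj (presheaf_hom C B) X) (FObj (presheaf_hom C B) Y)"
    by (auto simp: presheaf_arr presheaf_obj set_hom_iff intro: comp_hom)
next
  fix f g X Y Z assume "f \<in> hom (op_cat C) X Y" "g \<in> hom (op_cat C) Y Z"
  then have f: "f \<in> hom C Y X" and g: "g \<in> hom C Z Y"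
    by auto
  show "FArr (presheaf_hom C B) (g \<cdot>\<^bsub>op_cat C\<^esub> f) =
      FArr (presheaf_hom C B) g \<cdot>\<^bsub>set_cat UNIV\<^esub> FArr (presheaf_hom C B) f"
    by (auto simp: presheaf_arr[OF f] presheaf_arr[OF g] presheaf_arr[OF comp_hom[OF g f]]
        compose_def fun_eq_iff assoc[OF g f] comp_hom[OF f])
next
  fix X assume X: "X \<in> Obj (op_cat C)"
  then have "X \<in> Obj C" by simp
  then show "FArr (presheaf_hom C B) (Ide (op_cat C) X) =
      Ide (set_cat UNIV) (FObj (presheaf_hom C B) X)"
    by (auto simp: presheaf_arr[OF ide_hom] presheaf_obj fun_eq_iff comp_ide)
qed (simp_all add: is_category_op is_cat is_category_set_cat)

text \<open>The Yoneda lemma turns a cover by a representable into a weakly universal element.\<close>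

lemma weakly_representable_iff:
  assumes F: "is_functor (op_cat C) (set_cat UNIV) F"
  shows "weakly_representable C F \<longleftrightarrow> (\<exists>P\<in>Obj C. \<exists>v\<in>FObj F P. \<forall>X\<in>Obj C. \<forall>w\<in>FObj F X.
    \<exists>m\<in>hom C X P. fst (snd (FArr F m)) v = w)"
proof -
  have F_arr: "\<exists>f\<in>FObj F Y \<rightarrow>\<^sub>E FObj F X. FArr F m = (FObj F Y, f, FObj F X)"
    if "m \<in> hom C X Y" for m X Y
    using functor_hom[OF F, of m Y X] that by (auto simp: set_hom_iff)
  show ?thesis
  proof
    assume "weakly_representable C F"
    then obtain P \<tau> where P: "P \<in> Obj C" and \<tau>: "nat_trans (op_cat C) (set_cat UNIV) (presheaf_hom C P) F \<tau>"
      and surj: "\<And>X. X \<in> Obj C \<Longrightarrow> surjective (\<tau> X)"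
      unfolding weakly_representable_def by auto
    define t where "t X = fst (snd (\<tau> X))" for X
    have t: "\<tau> X = (hom C X P, t X, FObj F X)" "t X ` hom C X P = FObj F X" if "X \<in> Obj C" for X
      using nat_transD(1)[OF \<tau>, of X] surj[OF that] that
      by (auto simp: presheaf_obj set_hom_iff t_def surjective_def)
    let ?v = "t P (Ide C P)"
    have "\<exists>m\<in>hom C X P. fst (snd (FArr F m)) ?v = w" if X: "X \<in> Obj C" and w: "w \<in> FObj F X" for X w
    proof -
      obtain m where m: "m \<in> hom C X P" "w = t X m"
        using t(2)[OF X] w by blast
      obtain f where f: "FArr F m = (FObj F P, f, FObj F X)"
        using F_arr[OF m(1)] by blast
      have "FArr F m \<cdot>\<^bsub>set_cat UNIV\<^esub> \<tau> P = \<tau> X \<cdot>\<^bsub>set_cat UNIV\<^esub> FArr (presheaf_hom C P) m"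
        using nat_transD(2)[OF \<tau>, of m P X] m(1) by simp
      then have "compose (hom C P P) f (t P) (Ide C P) =
          compose (hom C P P) (t X) (restrict (\<lambda>h. h \<cdot> m) (hom C P P)) (Ide C P)"
        by (simp add: f t(1)[OF P] t(1)[OF X] presheaf_arr[OF m(1)])
      then have "f ?v = t X m"
        by (simp add: compose_eq ide_hom[OF P] ide_comp[OF m(1)])
      then show ?thesis
        using m f by (intro bexI[of _ m]) auto
    qed
    moreover have "?v \<in> FObj F P"
      using t(2)[OF P] ide_hom[OF P] by blast
    ultimately show "\<exists>P\<in>Obj C. \<exists>v\<in>FObj F P. \<forall>X\<in>Obj C. \<forall>w\<in>FObj F X.
        \<exists>m\<in>hom C X P. fst (snd (FArr F m)) v = w"
      using P by blast
  next
    assume "\<exists>P\<in>Obj C. \<exists>v\<in>FObj F P. \<forall>X\<in>Obj C. \<forall>w\<in>FObj F X.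
        \<exists>m\<in>hom C X P. fst (snd (FArr F m)) v = w"
    then obtain P v where P: "P \<in> Obj C" and v: "v \<in> FObj F P"
      and cover: "\<And>X w. X \<in> Obj C \<Longrightarrow> w \<in> FObj F X \<Longrightarrow> \<exists>m\<in>hom C X P. fst (snd (FArr F m)) v = w"
      by auto
    define t where "t X = restrict (\<lambda>m. fst (snd (FArr F m)) v) (hom C X P)" for X
    have t_in: "t X m \<in> FObj F X" if "m \<in> hom C X P" for X m
      using F_arr[OF that] v that by (auto simp: t_def)
    have "nat_trans (op_cat C) (set_cat UNIV) (presheaf_hom C P) F (\<lambda>X. (hom C X P, t X, FObj F X))"
    proof (rule nat_transI[OF presheaf_functor F])
      fix X
      show "(hom C X P, t X, FObj F X) \<in> hom (set_cat UNIV) (FObj (presheaf_hom C P) X) (FObj F X)"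
        using t_in by (auto simp: set_hom_iff presheaf_obj t_def)
    next
      fix a X Y assume "a \<in> hom (op_cat C) X Y"
      then have a: "a \<in> hom C Y X" by simp
      obtain f where f: "FArr F a = (FObj F X, f, FObj F Y)"
        using F_arr[OF a] by blast
      have "f (t X m) = t Y (m \<cdot> a)" if m: "m \<in> hom C X P" for m
      proof -
        obtain g where g: "FArr F m = (FObj F P, g, FObj F X)"
          using F_arr[OF m] by blast
        have "FArr F (m \<cdot> a) = FArr F a \<cdot>\<^bsub>set_cat UNIV\<^esub> FArr F m"
          using functor_comp[OF F, of m P X a Y] m a by simp
        then show ?thesis
          using v comp_hom[OF a m] m by (simp add: t_def f g compose_eq)
      qed
      then show "FArr F a \<cdot>\<^bsub>set_cat UNIV\<^esub> (hom C X P, t X, FObj F X) =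
          (hom C Y P, t Y, FObj F Y) \<cdot>\<^bsub>set_cat UNIV\<^esub> FArr (presheaf_hom C P) a"
        by (auto simp: f presheaf_arr[OF a] compose_def fun_eq_iff)
    qed
    moreover have "surjective (hom C X P, t X, FObj F X)" if "X \<in> Obj C" for X
      using cover[OF that] t_in by (fastforce simp: surjective_def t_def)
    ultimately show "weakly_representable C F"
      unfolding weakly_representable_def using P by blast
  qed
qed

section \<open>Slice categories and pullback functors\<close>

lemma slice_obj: "Obj (slice C I) = {x \<in> Arr C. Cod C x = I}"
  by (simp add: slice_def)

lemma slice_hom_iff:
  assumes "x \<in> hom C X I" "y \<in> hom C Y I"
  shows "a \<in> hom (slice C I) x y \<longleftrightarrow> (\<exists>h\<in>hom C X Y. y \<cdot> h = x \<and> a = (x, h, y))"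
  using homD[OF assms(1)] homD[OF assms(2)] by (auto simp: slice_def hom_def)

lemma slice_homE:
  assumes "a \<in> hom (slice C I) x y"
  obtains h where "x \<in> hom C (Dom C x) I" "y \<in> hom C (Dom C y) I" "a = (x, h, y)"
    "h \<in> hom C (Dom C x) (Dom C y)" "y \<cdot> h = x"
proof -
  have "Arr (slice C I) = {(x, h, y). x \<in> Arr C \<and> y \<in> Arr C \<and> Cod C x = I \<and> Cod C y = I \<and>
      h \<in> hom C (Dom C x) (Dom C y) \<and> y \<cdot> h = x}"
    "Dom (slice C I) = (\<lambda>(x, h, y). x)" "Cod (slice C I) = (\<lambda>(x, h, y). y)"
    by (simp_all add: slice_def)
  then show ?thesis
    using assms that by (auto simp: hom_def)
qed

lemma slice_comp [simp]: "(y, k, z) \<cdot>\<^bsub>slice C I\<^esub> (x, h, y') = (x, k \<cdot> h, z)"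
  by (simp add: slice_def)

lemma slice_ide: "x \<in> hom C X I \<Longrightarrow> Ide (slice C I) x = (x, Ide C X, x)"
  by (simp add: slice_def homD)

lemma is_category_slice: "is_category (slice C I)"
  unfolding is_category_def
proof (intro conjI ballI impI)
  fix a assume "a \<in> Arr (slice C I)"
  then obtain x h y where a: "a = (x, h, y)" "x \<in> Arr C" "y \<in> Arr C" "Cod C x = I" "Cod C y = I"
    "h \<in> hom C (Dom C x) (Dom C y)" "y \<cdot> h = x"
    by (auto simp: slice_def)
  then show "Dom (slice C I) a \<in> Obj (slice C I)" "Cod (slice C I) a \<in> Obj (slice C I)"
    by (auto simp: slice_def)
  show "a \<cdot>\<^bsub>slice C I\<^esub> Ide (slice C I) (Dom (slice C I) a) = a"
    "Ide (slice C I) (Cod (slice C I) a) \<cdot>\<^bsub>slice C I\<^esub> a = a"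
    using a by (auto simp: slice_def comp_ide[OF a(6)] ide_comp[OF a(6)])
next
  fix x assume "x \<in> Obj (slice C I)"
  then have x: "x \<in> hom C (Dom C x) I"
    by (auto simp: slice_obj hom_def)
  show "Ide (slice C I) x \<in> hom (slice C I) x x"
    unfolding slice_hom_iff[OF x x] slice_ide[OF x] using comp_ide[OF x] ide_hom hom_obj[OF x] by auto
next
  fix a b assume "a \<in> Arr (slice C I)" "b \<in> Arr (slice C I)" "Cod (slice C I) a = Dom (slice C I) b"
  then obtain x h y k z where a: "a \<in> hom (slice C I) x y" "a = (x, h, y)"
    and b: "b \<in> hom (slice C I) y z" "b = (y, k, z)"
    by (auto simp: slice_def hom_def)
  obtain X Y Z where x: "x \<in> hom C X I" and z: "z \<in> hom C Z I"
    and h: "h \<in> hom C X Y" "y \<cdot> h = x" and k: "k \<in> hom C Y Z" "z \<cdot> k = y"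
    using slice_homE[OF a(1)] slice_homE[OF b(1)] a(2) b(2) by (metis prod.inject)
  have "(x, k \<cdot> h, z) \<in> hom (slice C I) x z"
    unfolding slice_hom_iff[OF x z] using assoc[OF h(1) k(1) z] comp_hom[OF h(1) k(1)] h(2) k(2) by auto
  then show "b \<cdot>\<^bsub>slice C I\<^esub> a \<in> hom (slice C I) (Dom (slice C I) a) (Cod (slice C I) b)"
    unfolding homD(2)[OF a(1)] homD(3)[OF b(1)] by (simp add: a(2) b(2))
next
  fix a b c assume "a \<in> Arr (slice C I)" "b \<in> Arr (slice C I)" "c \<in> Arr (slice C I)"
    "Cod (slice C I) a = Dom (slice C I) b \<and> Cod (slice C I) b = Dom (slice C I) c"
  then show "c \<cdot>\<^bsub>slice C I\<^esub> b \<cdot>\<^bsub>slice C I\<^esub> a = c \<cdot>\<^bsub>slice C I\<^esub> (b \<cdot>\<^bsub>slice C I\<^esub> a)"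
    by (auto simp: slice_def intro: assoc)
qed

lemma pullback_functor_exists:
  assumes lim: "has_finite_limits C" and u: "u \<in> hom C J I"
  obtains S \<pi> where "pullback_functor C u S \<pi>"
proof -
  \<comment> \<open>The implication inside the existential makes the choice of pullbacks total in
    \<open>x\<close>, so that it can be Skolemized.\<close>
  have "\<exists>P p q. x \<in> Arr C \<and> Cod C x = I \<longrightarrow>
      p \<in> hom C P J \<and> q \<in> hom C P (Dom C x) \<and> is_pullback C p q u x" for x
  proof (cases "x \<in> Arr C \<and> Cod C x = I")
    case True
    then have "x \<in> hom C (Dom C x) I"
      by (simp add: hom_def)
    then show ?thesis
      using pullback_exists[OF lim u] by metis
  qed blast
  then have "\<forall>x. \<exists>P p q. x \<in> Arr C \<and> Cod C x = I \<longrightarrow>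
      p \<in> hom C P J \<and> q \<in> hom C P (Dom C x) \<and> is_pullback C p q u x"
    by blast
  then obtain Q s \<pi> where *: "\<forall>x. x \<in> Arr C \<and> Cod C x = I \<longrightarrow>
      s x \<in> hom C (Q x) J \<and> \<pi> x \<in> hom C (Q x) (Dom C x) \<and> is_pullback C (s x) (\<pi> x) u x"
    by metis
  have pb: "s x \<in> hom C (Q x) J" "\<pi> x \<in> hom C (Q x) X" "is_pullback C (s x) (\<pi> x) u x"
    if "x \<in> hom C X I" for x X
    using * homD[OF that] by auto
  \<comment> \<open>On arrows the functor is the unique comparison of the chosen squares; identity
    and composition laws follow because both sides solve the same lifting problem.\<close>
  define lift where "lift x h y = (THE k. k \<in> hom C (Q x) (Q y) \<and> s y \<cdot> k = s x \<and> \<pi> y \<cdot> k = h \<cdot> \<pi> x)"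
    for x h y
  have ex1: "\<exists>!k. k \<in> hom C (Q x) (Q y) \<and> s y \<cdot> k = s x \<and> \<pi> y \<cdot> k = h \<cdot> \<pi> x"
    if x: "x \<in> hom C X I" and y: "y \<in> hom C Y I" and h: "h \<in> hom C X Y" "y \<cdot> h = x" for x h y X Y
  proof (rule pullback_ex1[OF pb(3)[OF y] pb(1,2)[OF y] pb(1)[OF x] comp_hom[OF pb(2)[OF x] h(1)]])
    show "u \<cdot> s x = y \<cdot> (h \<cdot> \<pi> x)"
      using pullback_comm[OF pb(3)[OF x]] assoc[OF pb(2)[OF x] h(1) y] h(2) by simp
  qed
  have lift: "lift x h y \<in> hom C (Q x) (Q y)" "s y \<cdot> lift x h y = s x" "\<pi> y \<cdot> lift x h y = h \<cdot> \<pi> x"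
    if "x \<in> hom C X I" "y \<in> hom C Y I" "h \<in> hom C X Y" "y \<cdot> h = x" for x h y X Y
    using theI'[OF ex1[OF that]] unfolding lift_def[symmetric] by auto
  define S where "S = \<lparr>FObj = s, FArr = (\<lambda>(x, h, y). (s x, lift x h y, s y))\<rparr>"
  have S_functor: "is_functor (slice C I) (slice C J) S"
  proof (rule functorI)
    fix x assume "x \<in> Obj (slice C I)"
    then have x: "x \<in> hom C (Dom C x) I"
      by (auto simp: slice_obj hom_def)
    then show "FObj S x \<in> Obj (slice C J)"
      using homD[OF pb(1)[OF x]] by (simp add: S_def slice_obj)
    have X: "Dom C x \<in> Obj C"
      using hom_obj x by blast
    have "lift x (Ide C (Dom C x)) x = Ide C (Q x)"
      using ex1[OF x x ide_hom[OF X] comp_ide[OF x]] lift[OF x x ide_hom[OF X] comp_ide[OF x]]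
        ide_hom[of "Q x"] hom_obj(1)[OF pb(1)[OF x]] comp_ide[OF pb(1)[OF x]] comp_ide[OF pb(2)[OF x]]
        ide_comp[OF pb(2)[OF x]] by metis
    then show "FArr S (Ide (slice C I) x) = Ide (slice C J) (FObj S x)"
      by (simp add: S_def slice_ide[OF x] slice_ide[OF pb(1)[OF x]])
  next
    fix a x y assume "a \<in> hom (slice C I) x y"
    then obtain h where xy: "x \<in> hom C (Dom C x) I" "y \<in> hom C (Dom C y) I" "h \<in> hom C (Dom C x) (Dom C y)"
      "y \<cdot> h = x" and a: "a = (x, h, y)"
      by (rule slice_homE)
    show "FArr S a \<in> hom (slice C J) (FObj S x) (FObj S y)"
      using slice_hom_iff[OF pb(1)[OF xy(1)] pb(1)[OF xy(2)]] lift[OF xy] by (auto simp: S_def a)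
  next
    fix a b x y z assume a': "a \<in> hom (slice C I) x y" and b': "b \<in> hom (slice C I) y z"
    obtain h where x: "x \<in> hom C (Dom C x) I" and y: "y \<in> hom C (Dom C y) I" and a: "a = (x, h, y)"
      and h: "h \<in> hom C (Dom C x) (Dom C y)" "y \<cdot> h = x"
      using a' by (rule slice_homE)
    obtain k where z: "z \<in> hom C (Dom C z) I" and b: "b = (y, k, z)"
      and k: "k \<in> hom C (Dom C y) (Dom C z)" "z \<cdot> k = y"
      using b' by (rule slice_homE)
    note kh = comp_hom[OF h(1) k(1)]
    have kh': "z \<cdot> (k \<cdot> h) = x"
      using assoc[OF h(1) k(1) z] h k by simp
    note l = lift[OF x y h] and l' = lift[OF y z k] and l'' = lift[OF x z kh kh']
    have "s z \<cdot> (lift y k z \<cdot> lift x h y) = s x" "\<pi> z \<cdot> (lift y k z \<cdot> lift x h y) = k \<cdot> h \<cdot> \<pi> x"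
      using assoc[OF l(1) l'(1) pb(1)[OF z]] assoc[OF l(1) l'(1) pb(2)[OF z]] l l'
        assoc[OF l(1) pb(2)[OF y] k(1)] assoc[OF pb(2)[OF x] h(1) k(1)] by simp_all
    then have "lift x (k \<cdot> h) z = lift y k z \<cdot> lift x h y"
      using ex1[OF x z kh kh'] l'' comp_hom[OF l(1) l'(1)] by blast
    then show "FArr S (b \<cdot>\<^bsub>slice C I\<^esub> a) = FArr S b \<cdot>\<^bsub>slice C J\<^esub> FArr S a"
      by (simp add: a b S_def)
  qed (rule is_category_slice)+
  have "pullback_functor C u S \<pi>"
    unfolding pullback_functor_def homD(2,3)[OF u]
  proof (intro conjI ballI S_functor)
    fix x assume "x \<in> Obj (slice C I)"
    then have x: "x \<in> hom C (Dom C x) I"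
      by (auto simp: slice_obj hom_def)
    show "is_pullback C (FObj S x) (\<pi> x) u x"
      using pb(3)[OF x] by (simp add: S_def)
  next
    fix a assume "a \<in> Arr (slice C I)"
    then have "a \<in> hom (slice C I) (Dom (slice C I) a) (Cod (slice C I) a)"
      by (auto simp: hom_def)
    then show "case a of (x, h, y) \<Rightarrow> \<pi> y \<cdot> fst (snd (FArr S (x, h, y))) = h \<cdot> \<pi> x"
      using lift(3) by (elim slice_homE) (auto simp: S_def)
  qed
  then show ?thesis
    by (rule that)
qed

text \<open>Slice-free form of the condition: \<open>p\<close> and \<open>v\<close> form a weakly
  universal element, with \<open>v\<close> evaluating the section indexed by a point of
  \<open>P\<close>. The premise ranges over all pullback squares \<open>Q\<close> and
  \<open>R\<close>, so it can be used with whatever functor \<open>pullback_functor_exists\<close>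
  supplies; \<open>k\<close> stands for the action of that functor on \<open>m\<close>.\<close>

lemma weakly_locally_cartesian_closedI:
  assumes lim: "has_finite_limits C"
    and prod: "\<And>B J I b u. b \<in> hom C B J \<Longrightarrow> u \<in> hom C J I \<Longrightarrow>
      \<exists>P. \<exists>p\<in>hom C P I. \<forall>Q. \<forall>q1\<in>hom C Q J. \<forall>q2\<in>hom C Q P. is_pullback C q1 q2 u p \<longrightarrow>
        (\<exists>v\<in>hom C Q B. b \<cdot> v = q1 \<and> (\<forall>X. \<forall>x\<in>hom C X I. \<forall>R. \<forall>r1\<in>hom C R J. \<forall>r2\<in>hom C R X.
           is_pullback C r1 r2 u x \<longrightarrow> (\<forall>w\<in>hom C R B. b \<cdot> w = r1 \<longrightarrow>
             (\<exists>m\<in>hom C X P. p \<cdot> m = x \<and>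
               (\<forall>k\<in>hom C R Q. q1 \<cdot> k = r1 \<and> q2 \<cdot> k = m \<cdot> r2 \<longrightarrow> v \<cdot> k = w)))))"
  shows "weakly_locally_cartesian_closed C"
  unfolding weakly_locally_cartesian_closed_def
proof (intro conjI ballI impI is_cat lim)
  fix b u assume "b \<in> Arr C" "u \<in> Arr C" "Cod C b = Dom C u"
  then obtain B J I where b: "b \<in> hom C B J" and u: "u \<in> hom C J I"
    by (auto simp: hom_def)
  obtain S \<pi> where S: "pullback_functor C u S \<pi>"
    using lim u by (rule pullback_functor_exists)
  interpret sI: cat "slice C I"
    by unfold_locales (rule is_category_slice)
  interpret sJ: cat "slice C J"
    by unfold_locales (rule is_category_slice)
  have SF: "is_functor (slice C I) (slice C J) S"
    using S unfolding pullback_functor_def homD(2,3)[OF u] by blast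
  have pb: "is_pullback C (FObj S x) (\<pi> x) u x" if "x \<in> hom C X I" for x X
    using S homD[OF that] unfolding pullback_functor_def homD(2,3)[OF u] slice_obj by blast
  have Sx: "FObj S x \<in> hom C (Dom C (FObj S x)) J" "\<pi> x \<in> hom C (Dom C (FObj S x)) X"
    if "x \<in> hom C X I" for x X
    by (rule pullback_hom[OF pb[OF that] u that])+
  let ?F = "presheaf_hom (slice C J) b \<circ>\<^sub>F S"
  have F: "is_functor (op_cat (slice C I)) (set_cat UNIV) ?F"
    by (rule comp_functor[OF op_functor[OF SF] sJ.presheaf_functor])
  have F_obj: "FObj ?F x = hom (slice C J) (FObj S x) b" for x
    by (simp add: comp_functor_def sJ.presheaf_obj)
  obtain P p where p: "p \<in> hom C P I" and weak: "\<And>Q q1 q2. q1 \<in> hom C Q J \<Longrightarrow> q2 \<in> hom C Q P \<Longrightarrow>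
      is_pullback C q1 q2 u p \<Longrightarrow>
        (\<exists>v\<in>hom C Q B. b \<cdot> v = q1 \<and> (\<forall>X. \<forall>x\<in>hom C X I. \<forall>R. \<forall>r1\<in>hom C R J. \<forall>r2\<in>hom C R X.
           is_pullback C r1 r2 u x \<longrightarrow> (\<forall>w\<in>hom C R B. b \<cdot> w = r1 \<longrightarrow>
             (\<exists>m\<in>hom C X P. p \<cdot> m = x \<and>
               (\<forall>k\<in>hom C R Q. q1 \<cdot> k = r1 \<and> q2 \<cdot> k = m \<cdot> r2 \<longrightarrow> v \<cdot> k = w)))))"
    using prod[OF b u] by blast
  from weak[OF Sx[OF p] pb[OF p]] obtain v where v: "v \<in> hom C (Dom C (FObj S p)) B" "b \<cdot> v = FObj S p"
    and cover: "\<And>X x R r1 r2 w. x \<in> hom C X I \<Longrightarrow> r1 \<in> hom C R J \<Longrightarrow> r2 \<in> hom C R X \<Longrightarrow>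
      is_pullback C r1 r2 u x \<Longrightarrow> w \<in> hom C R B \<Longrightarrow> b \<cdot> w = r1 \<Longrightarrow>
        (\<exists>m\<in>hom C X P. p \<cdot> m = x \<and>
          (\<forall>k\<in>hom C R (Dom C (FObj S p)). FObj S p \<cdot> k = r1 \<and> \<pi> p \<cdot> k = m \<cdot> r2 \<longrightarrow> v \<cdot> k = w))"
    by auto
  have "weakly_representable (slice C I) ?F"
    unfolding sI.weakly_representable_iff[OF F]
  proof (rule bexI[of _ p], rule bexI[of _ "(FObj S p, v, b)"], intro ballI)
    show "p \<in> Obj (slice C I)"
      using homD[OF p] by (simp add: slice_obj)
    show v': "(FObj S p, v, b) \<in> FObj ?F p"
      using v by (simp add: F_obj slice_hom_iff[OF Sx(1)[OF p] b])
    fix x w assume "x \<in> Obj (slice C I)" and w': "w \<in> FObj ?F x"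
    then have x: "x \<in> hom C (Dom C x) I"
      by (auto simp: slice_obj hom_def)
    obtain w0 where w: "w = (FObj S x, w0, b)" "w0 \<in> hom C (Dom C (FObj S x)) B" "b \<cdot> w0 = FObj S x"
      using w' by (auto simp: F_obj slice_hom_iff[OF Sx(1)[OF x] b])
    obtain m where m: "m \<in> hom C (Dom C x) P" "p \<cdot> m = x"
      and mk: "\<And>k. k \<in> hom C (Dom C (FObj S x)) (Dom C (FObj S p)) \<Longrightarrow> FObj S p \<cdot> k = FObj S x \<Longrightarrow>
        \<pi> p \<cdot> k = m \<cdot> \<pi> x \<Longrightarrow> v \<cdot> k = w0"
      using cover[OF x Sx[OF x] pb[OF x] w(2,3)] by blast
    have m': "(x, m, p) \<in> hom (slice C I) x p"
      unfolding slice_hom_iff[OF x p] using m by blast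
    obtain k where k: "FArr S (x, m, p) = (FObj S x, k, FObj S p)"
      "k \<in> hom C (Dom C (FObj S x)) (Dom C (FObj S p))" "FObj S p \<cdot> k = FObj S x"
      using functor_hom[OF SF m'] slice_hom_iff[OF Sx(1)[OF x] Sx(1)[OF p]] by blast
    have "\<pi> p \<cdot> k = m \<cdot> \<pi> x"
      using S homD(1)[OF m'] k(1) unfolding pullback_functor_def homD(2,3)[OF u] by force
    then have "v \<cdot> k = w0"
      using mk k by blast
    moreover have "FArr ?F (x, m, p) = FArr (presheaf_hom (slice C J) b) (FObj S x, k, FObj S p)"
      by (simp add: comp_functor_def k(1))
    moreover have "(FObj S x, k, FObj S p) \<in> hom (slice C J) (FObj S x) (FObj S p)"
      using k slice_hom_iff[OF Sx(1)[OF x] Sx(1)[OF p]] by blast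
    ultimately have "fst (snd (FArr ?F (x, m, p))) (FObj S p, v, b) = w"
      using v'[unfolded F_obj] by (simp add: sJ.presheaf_arr w(1))
    then show "\<exists>m\<in>hom (slice C I) x p. fst (snd (FArr ?F m)) (FObj S p, v, b) = w"
      using m' by blast
  qed
  then show "\<exists>S \<pi>. pullback_functor C u S \<pi> \<and>
      weakly_representable (slice C (Cod C u)) (presheaf_hom (slice C (Dom C u)) b \<circ>\<^sub>F S)"
    using S unfolding homD(2,3)[OF u] by blast
qed

text \<open>The same data read off from a given pullback functor. One pullback \<open>R\<close> over
  each \<open>x\<close> is produced instead of all being allowed, because only the squares of that
  functor are at hand.\<close>

lemma weakly_locally_cartesian_closedE:
  assumes C: "weakly_locally_cartesian_closed C" and b: "b \<in> hom C B J" and u: "u \<in> hom C J I"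
  obtains P p Q q1 q2 v where "p \<in> hom C P I" "q1 \<in> hom C Q J" "q2 \<in> hom C Q P" "is_pullback C q1 q2 u p"
    and "v \<in> hom C Q B" "b \<cdot> v = q1"
    and "\<And>X x. x \<in> hom C X I \<Longrightarrow> \<exists>R. \<exists>r1\<in>hom C R J. \<exists>r2\<in>hom C R X. is_pullback C r1 r2 u x \<and>
      (\<forall>w\<in>hom C R B. b \<cdot> w = r1 \<longrightarrow> (\<exists>m\<in>hom C X P. p \<cdot> m = x \<and>
        (\<exists>k\<in>hom C R Q. q1 \<cdot> k = r1 \<and> q2 \<cdot> k = m \<cdot> r2 \<and> v \<cdot> k = w)))"
proof -
  obtain S \<pi> where S: "pullback_functor C u S \<pi>"
    and rep: "weakly_representable (slice C I) (presheaf_hom (slice C J) b \<circ>\<^sub>F S)"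
    using C homD[OF b] homD[OF u] unfolding weakly_locally_cartesian_closed_def by metis
  interpret sI: cat "slice C I"
    by unfold_locales (rule is_category_slice)
  interpret sJ: cat "slice C J"
    by unfold_locales (rule is_category_slice)
  have SF: "is_functor (slice C I) (slice C J) S"
    using S unfolding pullback_functor_def homD(2,3)[OF u] by blast
  have pb: "is_pullback C (FObj S x) (\<pi> x) u x" if "x \<in> hom C X I" for x X
    using S homD[OF that] unfolding pullback_functor_def homD(2,3)[OF u] slice_obj by blast
  have Sx: "FObj S x \<in> hom C (Dom C (FObj S x)) J" "\<pi> x \<in> hom C (Dom C (FObj S x)) X"
    if "x \<in> hom C X I" for x X
    by (rule pullback_hom[OF pb[OF that] u that])+
  let ?F = "presheaf_hom (slice C J) b \<circ>\<^sub>F S"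
  have F: "is_functor (op_cat (slice C I)) (set_cat UNIV) ?F"
    by (rule comp_functor[OF op_functor[OF SF] sJ.presheaf_functor])
  have F_obj: "FObj ?F x = hom (slice C J) (FObj S x) b" for x
    by (simp add: comp_functor_def sJ.presheaf_obj)
  obtain p v' where p': "p \<in> Obj (slice C I)" and v': "v' \<in> FObj ?F p"
    and cover: "\<And>x w. x \<in> Obj (slice C I) \<Longrightarrow> w \<in> FObj ?F x \<Longrightarrow>
      \<exists>m\<in>hom (slice C I) x p. fst (snd (FArr ?F m)) v' = w"
    using rep unfolding sI.weakly_representable_iff[OF F] by blast
  have p: "p \<in> hom C (Dom C p) I"
    using p' by (auto simp: slice_obj hom_def)
  obtain v where v: "v' = (FObj S p, v, b)" "v \<in> hom C (Dom C (FObj S p)) B" "b \<cdot> v = FObj S p"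
    using v' by (auto simp: F_obj slice_hom_iff[OF Sx(1)[OF p] b])
  show ?thesis
  proof (rule that[OF p Sx[OF p] pb[OF p] v(2,3)])
    fix X x assume x: "x \<in> hom C X I"
    have "\<exists>m\<in>hom C X (Dom C p). p \<cdot> m = x \<and> (\<exists>k\<in>hom C (Dom C (FObj S x)) (Dom C (FObj S p)).
        FObj S p \<cdot> k = FObj S x \<and> \<pi> p \<cdot> k = m \<cdot> \<pi> x \<and> v \<cdot> k = w)"
      if w: "w \<in> hom C (Dom C (FObj S x)) B" "b \<cdot> w = FObj S x" for w
    proof -
      have "(FObj S x, w, b) \<in> FObj ?F x"
        using w by (simp add: F_obj slice_hom_iff[OF Sx(1)[OF x] b])
      moreover have "x \<in> Obj (slice C I)"
        using homD[OF x] by (simp add: slice_obj)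
      ultimately obtain m' where m': "m' \<in> hom (slice C I) x p"
        "fst (snd (FArr ?F m')) v' = (FObj S x, w, b)"
        using cover by blast
      obtain m where m: "m \<in> hom C X (Dom C p)" "p \<cdot> m = x" "m' = (x, m, p)"
        using m'(1) unfolding slice_hom_iff[OF x p] by blast
      obtain k where k: "FArr S (x, m, p) = (FObj S x, k, FObj S p)"
        "k \<in> hom C (Dom C (FObj S x)) (Dom C (FObj S p))" "FObj S p \<cdot> k = FObj S x"
        using functor_hom[OF SF m'(1)] slice_hom_iff[OF Sx(1)[OF x] Sx(1)[OF p]] m(3) by blast
      have "\<pi> p \<cdot> k = m \<cdot> \<pi> x"
        using S homD(1)[OF m'(1)] m(3) k(1) unfolding pullback_functor_def homD(2,3)[OF u] by force
      moreover have "v \<cdot> k = w"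
      proof -
        have "(FObj S x, k, FObj S p) \<in> hom (slice C J) (FObj S x) (FObj S p)"
          using k slice_hom_iff[OF Sx(1)[OF x] Sx(1)[OF p]] by blast
        then show ?thesis
          using m'(2) v'[unfolded F_obj] by (simp add: comp_functor_def m(3) k(1) sJ.presheaf_arr v(1))
      qed
      ultimately show ?thesis
        using m k by blast
    qed
    then show "\<exists>R. \<exists>r1\<in>hom C R J. \<exists>r2\<in>hom C R X. is_pullback C r1 r2 u x \<and>
      (\<forall>w\<in>hom C R B. b \<cdot> w = r1 \<longrightarrow> (\<exists>m\<in>hom C X (Dom C p). p \<cdot> m = x \<and>
        (\<exists>k\<in>hom C R (Dom C (FObj S p)). FObj S p \<cdot> k = r1 \<and> \<pi> p \<cdot> k = m \<cdot> r2 \<and> v \<cdot> k = w)))"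
      using Sx[OF x] pb[OF x] by blast
  qed
qed

end

section \<open>Partial combinatory algebras\<close>

lemma app_opt_simps [simp]:
  "app_opt app (Some a) (Some b) = app a b" "app_opt app None t = None" "app_opt app s None = None"
  by (auto simp: app_opt_def split: Option.bind_split)

lemma app_opt_eq_Some:
  "app_opt app s t = Some c \<longleftrightarrow> (\<exists>a b. s = Some a \<and> t = Some b \<and> app a b = Some c)"
  by (cases s; cases t) auto

lemma app_list_Nil [simp]: "app_list app e [] = Some e"
  by (simp add: app_list_def)

lemma app_list_snoc [simp]: "app_list app e (as @ [b]) = app_opt app (app_list app e as) (Some b)"
  by (simp add: app_list_def)

section \<open>Tracked functions over a fixed PCA: combinators, pairing, currying\<close>

locale combinatory_algebra =
  fixes A :: "'u set" and app :: "'u papp"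
  assumes pca: "pca A app"
begin

lemma app_closed: "a \<in> A \<Longrightarrow> b \<in> A \<Longrightarrow> app a b = Some c \<Longrightarrow> c \<in> A"
  using pca unfolding pca_def partial_applicative_structure_def by blast

lemma abstraction:
  assumes "poly_over A (Suc n) t"
  obtains e where "e \<in> A"
    "\<And>as. length as = n \<Longrightarrow> set as \<subseteq> A \<Longrightarrow> app_list app e as \<noteq> None"
    "\<And>as b c. length as = n \<Longrightarrow> set as \<subseteq> A \<Longrightarrow> b \<in> A \<Longrightarrow> poly_eval app (as @ [b]) t = Some c \<Longrightarrow>
      app_opt app (app_list app e as) (Some b) = Some c"
proof -
  have "\<exists>e\<in>A. \<forall>as b. length as = n \<and> set as \<subseteq> A \<and> b \<in> A \<longrightarrow>
      app_list app e as \<noteq> None \<and> poly_eval app (as @ [b]) t \<preceq> app_list app e (as @ [b])"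
    using pca assms unfolding pca_def by blast
  then obtain e where e: "e \<in> A" "\<And>as b. length as = n \<Longrightarrow> set as \<subseteq> A \<Longrightarrow> b \<in> A \<Longrightarrow>
      app_list app e as \<noteq> None \<and> poly_eval app (as @ [b]) t \<preceq> app_list app e (as @ [b])"
    by blast
  show ?thesis
  proof (rule that[OF e(1)])
    fix as assume "length as = n" "set as \<subseteq> A"
    then show "app_list app e as \<noteq> None"
      using e by blast
  next
    fix as b c assume "length as = n" "set as \<subseteq> A" "b \<in> A" "poly_eval app (as @ [b]) t = Some c"
    then show "app_opt app (app_list app e as) (Some b) = Some c"
      using e(2)[of as b] by (auto simp: partial_le_def)
  qed
qed

lemma abstraction1:
  assumes "poly_over A 1 t"
  obtains e where "e \<in> A" "\<And>a c. a \<in> A \<Longrightarrow> poly_eval app [a] t = Some c \<Longrightarrow> app e a = Some c"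
proof -
  obtain e where "e \<in> A" "\<And>as b c. length as = 0 \<Longrightarrow> set as \<subseteq> A \<Longrightarrow> b \<in> A \<Longrightarrow>
      poly_eval app (as @ [b]) t = Some c \<Longrightarrow> app_opt app (app_list app e as) (Some b) = Some c"
    using assms by (auto intro: abstraction[of 0 t])
  then show ?thesis
    using that[of e] by force
qed

text \<open>\<open>k\<close> exists for every \<open>a\<close>, even if the polynomial is undefined
  at all pairs \<open>[a, b]\<close>: this is the clause of a PCA that applying \<open>e\<close> to
  all but the last argument is defined.\<close>

lemma abstraction2:
  assumes "poly_over A 2 t"
  obtains e where "e \<in> A" "\<And>a. a \<in> A \<Longrightarrow> \<exists>k\<in>A. app e a = Some k \<and>
    (\<forall>b\<in>A. \<forall>c. poly_eval app [a, b] t = Some c \<longrightarrow> app k b = Some c)"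
proof -
  obtain e where e: "e \<in> A" "\<And>as. length as = 1 \<Longrightarrow> set as \<subseteq> A \<Longrightarrow> app_list app e as \<noteq> None"
    "\<And>as b c. length as = 1 \<Longrightarrow> set as \<subseteq> A \<Longrightarrow> b \<in> A \<Longrightarrow> poly_eval app (as @ [b]) t = Some c \<Longrightarrow>
      app_opt app (app_list app e as) (Some b) = Some c"
    using assms abstraction[of 1 t] by (metis Suc_1)
  show ?thesis
  proof (rule that[OF e(1)])
    fix a assume a: "a \<in> A"
    have "app e a \<noteq> None"
      using e(2)[of "[a]"] app_list_snoc[of app e "[]" a] a by simp
    then obtain k where k: "app e a = Some k"
      by blast
    then have "app k b = Some c" if "b \<in> A" "poly_eval app [a, b] t = Some c" for b c
      using e(3)[of "[a]" b c] app_list_snoc[of app e "[]" a] a that by simp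
    then show "\<exists>k\<in>A. app e a = Some k \<and>
        (\<forall>b\<in>A. \<forall>c. poly_eval app [a, b] t = Some c \<longrightarrow> app k b = Some c)"
      using k app_closed[OF e(1) a k] by blast
  qed
qed

text \<open>With \<open>f w\<close> the code of the input and \<open>g w\<close> that of the output,
  this is the morphism condition of partitioned assemblies. The index set has any type, so that
  families over pairs and triples are covered without being coded first.\<close>

definition tracked :: "'w set \<Rightarrow> ('w \<Rightarrow> 'u) \<Rightarrow> ('w \<Rightarrow> 'u) \<Rightarrow> bool" where
  "tracked W f g \<longleftrightarrow> (\<exists>e\<in>A. \<forall>w\<in>W. app e (f w) = Some (g w))"

lemma trackedI: "e \<in> A \<Longrightarrow> (\<And>w. w \<in> W \<Longrightarrow> app e (f w) = Some (g w)) \<Longrightarrow> tracked W f g"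
  unfolding tracked_def by blast

lemma tracked_in: "tracked W f g \<Longrightarrow> (\<And>w. w \<in> W \<Longrightarrow> f w \<in> A) \<Longrightarrow> w \<in> W \<Longrightarrow> g w \<in> A"
  unfolding tracked_def using app_closed by blast

lemma tracked_reindex: "tracked W f g \<Longrightarrow> (\<And>v. v \<in> V \<Longrightarrow> h v \<in> W) \<Longrightarrow> tracked V (\<lambda>v. f (h v)) (\<lambda>v. g (h v))"
  unfolding tracked_def by blast

lemma tracked_cong:
  "tracked W f g \<Longrightarrow> (\<And>w. w \<in> W \<Longrightarrow> f w = f' w) \<Longrightarrow> (\<And>w. w \<in> W \<Longrightarrow> g w = g' w) \<Longrightarrow> tracked W f' g'"
  unfolding tracked_def by auto

lemma tracked_refl:
  assumes "\<And>w. w \<in> W \<Longrightarrow> f w \<in> A"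
  shows "tracked W f f"
proof -
  obtain e where "e \<in> A" "\<And>a c. a \<in> A \<Longrightarrow> poly_eval app [a] (Var 0) = Some c \<Longrightarrow> app e a = Some c"
    by (rule abstraction1[of "Var 0"]) auto
  then show ?thesis
    using assms by (intro trackedI) auto
qed

lemma tracked_const:
  assumes "\<And>w. w \<in> W \<Longrightarrow> f w \<in> A" "a \<in> A"
  shows "tracked W f (\<lambda>_. a)"
proof -
  obtain e where "e \<in> A" "\<And>x c. x \<in> A \<Longrightarrow> poly_eval app [x] (Const a) = Some c \<Longrightarrow> app e x = Some c"
    using assms(2) by (auto intro: abstraction1[of "Const a"])
  then show ?thesis
    using assms by (intro trackedI) auto
qed

lemma tracked_app:
  assumes f: "\<And>w. w \<in> W \<Longrightarrow> f w \<in> A" and "tracked W f g" "tracked W f h"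
    and "\<And>w. w \<in> W \<Longrightarrow> app (g w) (h w) = Some (k w)"
  shows "tracked W f k"
proof -
  obtain d d' where d: "d \<in> A" "d' \<in> A" "\<And>w. w \<in> W \<Longrightarrow> app d (f w) = Some (g w)"
    "\<And>w. w \<in> W \<Longrightarrow> app d' (f w) = Some (h w)"
    using assms(2,3) unfolding tracked_def by blast
  \<comment> \<open>The S combinator applied to \<open>d\<close> and \<open>d'\<close>, written as a
    polynomial.\<close>
  let ?t = "App (App (Const d) (Var 0)) (App (Const d') (Var 0))"
  obtain e where "e \<in> A" "\<And>x c. x \<in> A \<Longrightarrow> poly_eval app [x] ?t = Some c \<Longrightarrow> app e x = Some c"
    using d(1,2) by (auto intro: abstraction1[of ?t])
  then show ?thesis
    using d f assms(4) by (intro trackedI) auto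
qed

text \<open>Composition is application of a constant: the element tracking \<open>h\<close> from
  \<open>g\<close> is itself a tracked constant.\<close>

lemma tracked_trans:
  assumes f: "\<And>w. w \<in> W \<Longrightarrow> f w \<in> A" and fg: "tracked W f g" and gh: "tracked W g h"
  shows "tracked W f h"
proof -
  obtain e where e: "e \<in> A" "\<And>w. w \<in> W \<Longrightarrow> app e (g w) = Some (h w)"
    using gh unfolding tracked_def by blast
  show ?thesis
    by (rule tracked_app[OF f tracked_const[OF f e(1)] fg]) (use e in auto)
qed

text \<open>\<open>e\<close> behaves like the Church pairing that takes \<open>a\<close>,
  \<open>b\<close>, \<open>z\<close> to \<open>z a b\<close>, with the pair \<open>p\<close> being
  \<open>e a b\<close>. Only values of \<open>z a b\<close> that exist are prescribed.\<close>

definition is_pair_comb :: "'u \<Rightarrow> bool" where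
  "is_pair_comb e \<longleftrightarrow> e \<in> A \<and> (\<forall>a\<in>A. \<forall>b\<in>A. \<exists>k\<in>A. \<exists>p\<in>A. app e a = Some k \<and> app k b = Some p \<and>
     (\<forall>z\<in>A. \<forall>c. app_opt app (app z a) (Some b) = Some c \<longrightarrow> app p z = Some c))"

definition pair_comb :: 'u where
  "pair_comb = (SOME e. is_pair_comb e)"

definition pr :: "'u \<Rightarrow> 'u \<Rightarrow> 'u" where
  "pr a b = the (app_list app pair_comb [a, b])"

lemma pair_comb: "is_pair_comb pair_comb"
proof -
  \<comment> \<open>The projector is the last variable, so that the pair of \<open>a\<close> and
    \<open>b\<close> is defined before a projector is supplied.\<close>
  let ?t = "App (App (Var 2) (Var 0)) (Var 1)"
  have "poly_over A (Suc 2) ?t"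
    by simp
  then obtain e where e: "e \<in> A"
    "\<And>as. length as = 2 \<Longrightarrow> set as \<subseteq> A \<Longrightarrow> app_list app e as \<noteq> None"
    "\<And>as b c. length as = 2 \<Longrightarrow> set as \<subseteq> A \<Longrightarrow> b \<in> A \<Longrightarrow> poly_eval app (as @ [b]) ?t = Some c \<Longrightarrow>
      app_opt app (app_list app e as) (Some b) = Some c"
    by (rule abstraction) blast
  have list: "app_list app e [a, b] = app_opt app (app e a) (Some b)" for a b
    using app_list_snoc[of app e "[a]" b] app_list_snoc[of app e "[]" a] by simp
  have "\<exists>k\<in>A. \<exists>p\<in>A. app e a = Some k \<and> app k b = Some p \<and>
     (\<forall>z\<in>A. \<forall>c. app_opt app (app z a) (Some b) = Some c \<longrightarrow> app p z = Some c)"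
    if ab: "a \<in> A" "b \<in> A" for a b
  proof -
    obtain k p where kp: "app e a = Some k" "app k b = Some p"
      using e(2)[of "[a, b]"] ab by (auto simp: list app_opt_eq_Some)
    have "app p z = Some c" if "z \<in> A" "app_opt app (app z a) (Some b) = Some c" for z c
      using e(3)[of "[a, b]" z c] that ab by (simp add: list kp)
    then show ?thesis
      using kp app_closed e(1) ab by blast
  qed
  then have "is_pair_comb e"
    unfolding is_pair_comb_def using e(1) by blast
  then show ?thesis
    unfolding pair_comb_def by (rule someI)
qed

lemma pr:
  assumes "a \<in> A" "b \<in> A"
  obtains k where "k \<in> A" "app pair_comb a = Some k" "app k b = Some (pr a b)"
proof -
  obtain k p where k: "k \<in> A" "app pair_comb a = Some k" "app k b = Some p"
    using pair_comb assms unfolding is_pair_comb_def by blast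
  moreover have "pr a b = p"
    using app_list_snoc[of app pair_comb "[a]" b] app_list_snoc[of app pair_comb "[]" a] k
    by (simp add: pr_def)
  ultimately show ?thesis
    using that by blast
qed

lemma pr_in: "a \<in> A \<Longrightarrow> b \<in> A \<Longrightarrow> pr a b \<in> A"
  by (metis pr app_closed)

lemma pr_app:
  assumes "a \<in> A" "b \<in> A" "z \<in> A" "app z a = Some k" "app k b = Some c"
  shows "app (pr a b) z = Some c"
proof -
  obtain k' p where "app pair_comb a = Some k'" "app k' b = Some p"
    "\<forall>z\<in>A. \<forall>c. app_opt app (app z a) (Some b) = Some c \<longrightarrow> app p z = Some c"
    using pair_comb assms(1,2) unfolding is_pair_comb_def by blast
  moreover have "p = pr a b"
    using calculation pr[OF assms(1,2)] by (metis option.inject)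
  ultimately show ?thesis
    using assms(3-5) by simp
qed

lemma tracked_pr:
  assumes f: "\<And>w. w \<in> W \<Longrightarrow> f w \<in> A" and g: "tracked W f g" and h: "tracked W f h"
  shows "tracked W f (\<lambda>w. pr (g w) (h w))"
proof -
  have gh: "g w \<in> A" "h w \<in> A" if "w \<in> W" for w
    using tracked_in[OF g f that] tracked_in[OF h f that] by auto
  have comb: "pair_comb \<in> A"
    using pair_comb unfolding is_pair_comb_def by blast
  have "tracked W f (\<lambda>w. the (app pair_comb (g w)))"
  proof (rule tracked_app[OF f tracked_const[OF f comb] g])
    show "app pair_comb (g w) = Some (the (app pair_comb (g w)))" if "w \<in> W" for w
      using pr[OF gh[OF that]] by (metis option.sel)
  qed
  from f this h show ?thesis
  proof (rule tracked_app)
    show "app (the (app pair_comb (g w))) (h w) = Some (pr (g w) (h w))" if "w \<in> W" for w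
      using pr[OF gh[OF that]] by (metis option.sel)
  qed
qed

text \<open>A Church pair is projected by applying it to the combinator that selects one of two
  arguments; the list indexing treats both projections at once.\<close>

lemma tracked_projection:
  assumes "\<And>w. w \<in> W \<Longrightarrow> f w \<in> A" "\<And>w. w \<in> W \<Longrightarrow> g w \<in> A" "i < 2"
  shows "tracked W (\<lambda>w. pr (f w) (g w)) (\<lambda>w. [f w, g w] ! i)"
proof -
  obtain e where e: "e \<in> A" "\<And>a. a \<in> A \<Longrightarrow> \<exists>k\<in>A. app e a = Some k \<and>
      (\<forall>b\<in>A. \<forall>c. poly_eval app [a, b] (Var i) = Some c \<longrightarrow> app k b = Some c)"
    using assms(3) by (auto intro: abstraction2[of "Var i"])
  have pr: "pr (f w) (g w) \<in> A" if "w \<in> W" for w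
    using assms(1,2) that by (intro pr_in)
  show ?thesis
  proof (rule tracked_app[OF _ tracked_refl tracked_const])
    show "app (pr (f w) (g w)) e = Some ([f w, g w] ! i)" if w: "w \<in> W" for w
      using e(2)[OF assms(1)[OF w]] assms(2)[OF w] by (auto intro: pr_app[OF assms(1,2)[OF w] e(1)])
  qed (use pr e in auto)
qed

lemma tracked_fst: "(\<And>w. w \<in> W \<Longrightarrow> f w \<in> A) \<Longrightarrow> (\<And>w. w \<in> W \<Longrightarrow> g w \<in> A) \<Longrightarrow>
    tracked W (\<lambda>w. pr (f w) (g w)) f"
  using tracked_projection[of W f g 0] by simp

lemma tracked_snd: "(\<And>w. w \<in> W \<Longrightarrow> f w \<in> A) \<Longrightarrow> (\<And>w. w \<in> W \<Longrightarrow> g w \<in> A) \<Longrightarrow>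
    tracked W (\<lambda>w. pr (f w) (g w)) g"
  using tracked_projection[of W f g 1] by simp

text \<open>\<open>V\<close> need not contain a pair for every \<open>w\<close>, nor all
  \<open>y\<close> for a given \<open>w\<close>. The index \<open>k w\<close> nevertheless exists
  for each \<open>w\<close>, and its values are controlled on \<open>V\<close>; this is what weak
  dependent products require.\<close>

lemma tracked_curry:
  assumes h: "tracked V (\<lambda>(w, y). pr (f w) (g y)) h"
    and V: "\<And>w y. (w, y) \<in> V \<Longrightarrow> w \<in> W \<and> g y \<in> A" and f: "\<And>w. w \<in> W \<Longrightarrow> f w \<in> A"
  obtains k where "tracked W f k" "\<And>w y. (w, y) \<in> V \<Longrightarrow> app (k w) (g y) = Some (h (w, y))"
proof -
  obtain d where d: "d \<in> A" "\<And>w y. (w, y) \<in> V \<Longrightarrow> app d (pr (f w) (g y)) = Some (h (w, y))"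
    using h unfolding tracked_def by force
  let ?t = "App (Const d) (App (App (Const pair_comb) (Var 0)) (Var 1))"
  have "pair_comb \<in> A"
    using pair_comb unfolding is_pair_comb_def by blast
  then have "poly_over A 2 ?t"
    using d(1) by simp
  then obtain e where e: "e \<in> A" "\<And>a. a \<in> A \<Longrightarrow> \<exists>k\<in>A. app e a = Some k \<and>
      (\<forall>b\<in>A. \<forall>c. poly_eval app [a, b] ?t = Some c \<longrightarrow> app k b = Some c)"
    by (rule abstraction2) blast
  define k where "k w = the (app e (f w))" for w
  have k: "app e (f w) = Some (k w)" "b \<in> A \<Longrightarrow> poly_eval app [f w, b] ?t = Some c \<Longrightarrow> app (k w) b = Some c"
    if "w \<in> W" for w b c
    using e(2)[OF f[OF that]] unfolding k_def by auto
  show ?thesis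
  proof (rule that)
    show "tracked W f k"
      using e(1) k(1) by (rule trackedI)
    fix w y assume wy: "(w, y) \<in> V"
    then have "w \<in> W" "g y \<in> A" "f w \<in> A"
      using V f by blast+
    moreover obtain k' where "app pair_comb (f w) = Some k'" "app k' (g y) = Some (pr (f w) (g y))"
      using pr[OF \<open>f w \<in> A\<close> \<open>g y \<in> A\<close>] by metis
    ultimately show "app (k w) (g y) = Some (h (w, y))"
      using d(2)[OF wy] by (intro k(2)) auto
  qed
qed

end

section \<open>The category of partitioned assemblies\<close>

lemma pasm_hom_iff:
  "a \<in> hom (PAsm U A app) X Y \<longleftrightarrow> X \<in> Obj (PAsm U A app) \<and> Y \<in> Obj (PAsm U A app) \<and>
    (\<exists>f\<in>fst X \<rightarrow>\<^sub>E fst Y. a = (X, f, Y) \<and> (\<exists>e\<in>A. \<forall>i\<in>fst X. app e (snd X i) = Some (snd Y (f i))))"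
  by (cases X; cases Y) (auto simp: hom_def PAsm_def)

lemma pasm_simps [simp]:
  "Obj (PAsm U A app) = {(I, \<phi>). I \<in> U \<and> \<phi> \<in> I \<rightarrow>\<^sub>E A}"
  "Ide (PAsm U A app) X = (X, restrict (\<lambda>i. i) (fst X), X)"
  "(Y', g, Z) \<cdot>\<^bsub>PAsm U A app\<^esub> (X, f, Y) = (X, compose (fst X) g f, Z)"
  by (simp_all add: PAsm_def)

lemma (in combinatory_algebra) is_category_PAsm: "is_category (PAsm U A app)"
proof -
  let ?P = "PAsm U A app"
  have arr: "a \<in> hom ?P (Dom ?P a) (Cod ?P a)" if "a \<in> Arr ?P" for a
    using that by (simp add: hom_def)
  have fn_eq: "compose I f (restrict (\<lambda>i. i) I) = f" "compose I (restrict (\<lambda>j. j) J) f = f"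
    if "f \<in> I \<rightarrow>\<^sub>E J" for f :: "'u \<Rightarrow> 'u" and I J
    using that by (auto simp: compose_def fun_eq_iff PiE_iff extensional_def)
  show ?thesis
    unfolding is_category_def
  proof (intro conjI ballI impI)
    fix a assume "a \<in> Arr ?P"
    note a = arr[OF this, unfolded pasm_hom_iff]
    then show "Dom ?P a \<in> Obj ?P" "Cod ?P a \<in> Obj ?P"
      by blast+
    obtain f where "f \<in> fst (Dom ?P a) \<rightarrow>\<^sub>E fst (Cod ?P a)" "a = (Dom ?P a, f, Cod ?P a)"
      using a by blast
    then show "a \<cdot>\<^bsub>?P\<^esub> Ide ?P (Dom ?P a) = a" "Ide ?P (Cod ?P a) \<cdot>\<^bsub>?P\<^esub> a = a"
      by (metis pasm_simps(2,3) fn_eq)+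
  next
    fix X assume "X \<in> Obj ?P"
    then have "tracked (fst X) (snd X) (snd X)"
      by (intro tracked_refl) auto
    with \<open>X \<in> Obj ?P\<close> show "Ide ?P X \<in> hom ?P X X"
      unfolding pasm_hom_iff tracked_def
      by (intro conjI bexI[of _ "restrict (\<lambda>i. i) (fst X)"]) auto
  next
    fix a b assume a: "a \<in> Arr ?P" and b: "b \<in> Arr ?P" and eq: "Cod ?P a = Dom ?P b"
    obtain f where f: "f \<in> fst (Dom ?P a) \<rightarrow>\<^sub>E fst (Dom ?P b)" "a = (Dom ?P a, f, Dom ?P b)"
      "tracked (fst (Dom ?P a)) (snd (Dom ?P a)) (\<lambda>i. snd (Dom ?P b) (f i))"
      and X: "Dom ?P a \<in> Obj ?P"
      using arr[OF a] eq unfolding pasm_hom_iff tracked_def by auto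
    obtain g where g: "g \<in> fst (Dom ?P b) \<rightarrow>\<^sub>E fst (Cod ?P b)" "b = (Dom ?P b, g, Cod ?P b)"
      "tracked (fst (Dom ?P b)) (snd (Dom ?P b)) (\<lambda>i. snd (Cod ?P b) (g i))"
      and Z: "Cod ?P b \<in> Obj ?P"
      using arr[OF b] unfolding pasm_hom_iff tracked_def by auto
    have "tracked (fst (Dom ?P a)) (snd (Dom ?P a)) (\<lambda>i. snd (Cod ?P b) (g (f i)))"
      by (rule tracked_trans[OF _ f(3) tracked_reindex[OF g(3)]]) (use X f(1) in auto)
    then have "\<exists>e\<in>A. \<forall>i\<in>fst (Dom ?P a). app e (snd (Dom ?P a) i) =
        Some (snd (Cod ?P b) (compose (fst (Dom ?P a)) g f i))"
      unfolding tracked_def by (simp add: compose_eq)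
    moreover have "compose (fst (Dom ?P a)) g f \<in> fst (Dom ?P a) \<rightarrow>\<^sub>E fst (Cod ?P b)"
      using f(1) g(1) by (auto simp: compose_def)
    moreover have "b \<cdot>\<^bsub>?P\<^esub> a = (Dom ?P a, compose (fst (Dom ?P a)) g f, Cod ?P b)"
      using f(2) g(2) by (metis pasm_simps(3))
    ultimately show "b \<cdot>\<^bsub>?P\<^esub> a \<in> hom ?P (Dom ?P a) (Cod ?P b)"
      using X Z unfolding pasm_hom_iff by blast
  next
    fix a b c assume "a \<in> Arr ?P" "b \<in> Arr ?P" "c \<in> Arr ?P"
      "Cod ?P a = Dom ?P b \<and> Cod ?P b = Dom ?P c"
    then show "c \<cdot>\<^bsub>?P\<^esub> b \<cdot>\<^bsub>?P\<^esub> a = c \<cdot>\<^bsub>?P\<^esub> (b \<cdot>\<^bsub>?P\<^esub> a)"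
      by (auto simp: PAsm_def compose_def fun_eq_iff)
  qed
qed

text \<open>
  A PCA can be recognised by its realizable partial functions: \<open>R M f\<close> says that \<open>f\<close> is
  realizable on \<open>M \<subseteq> A\<close>.
\<close>

locale partial_function_algebra =
  fixes A :: "'u set" and R :: "'u set \<Rightarrow> ('u \<Rightarrow> 'u) \<Rightarrow> bool" and pr :: "'u \<Rightarrow> 'u \<Rightarrow> 'u" and app :: "'u papp"
  assumes nonempty: "A \<noteq> {}"
    and R_in: "R M f \<Longrightarrow> M \<subseteq> A \<Longrightarrow> x \<in> M \<Longrightarrow> f x \<in> A"
    and R_id: "R M (\<lambda>x. x)"
    and R_const: "a \<in> A \<Longrightarrow> R M (\<lambda>_. a)"
    and R_comp: "R M f \<Longrightarrow> R M' g \<Longrightarrow> (\<And>x. x \<in> M \<Longrightarrow> f x \<in> M') \<Longrightarrow> R M (\<lambda>x. g (f x))"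
    and R_cong: "R M f \<Longrightarrow> (\<And>x. x \<in> M \<Longrightarrow> f x = g x) \<Longrightarrow> R M g"
    and pr_in: "a \<in> A \<Longrightarrow> b \<in> A \<Longrightarrow> pr a b \<in> A"
    and R_pr: "R M f \<Longrightarrow> R M g \<Longrightarrow> R M (\<lambda>x. pr (f x) (g x))"
    and R_fst: "\<exists>f. R {pr a b |a b. a \<in> A \<and> b \<in> A} f \<and> (\<forall>a\<in>A. \<forall>b\<in>A. f (pr a b) = a)"
    and R_snd: "\<exists>f. R {pr a b |a b. a \<in> A \<and> b \<in> A} f \<and> (\<forall>a\<in>A. \<forall>b\<in>A. f (pr a b) = b)"
    and R_app: "\<exists>f. R {pr a b |a b. a \<in> A \<and> b \<in> A \<and> app a b \<noteq> None} f \<and>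
      (\<forall>a\<in>A. \<forall>b\<in>A. \<forall>c. app a b = Some c \<longrightarrow> f (pr a b) = c)"
    and R_curry: "R M h \<Longrightarrow> M \<subseteq> A \<Longrightarrow>
      \<exists>k. R A k \<and> (\<forall>a\<in>A. \<forall>b\<in>A. pr a b \<in> M \<longrightarrow> app (k a) b = Some (h (pr a b)))"
begin

lemma R_subset: "R M f \<Longrightarrow> M' \<subseteq> M \<Longrightarrow> R M' f"
  using R_comp[OF R_id, of M f M'] by blast

lemma app_in:
  assumes "a \<in> A" "b \<in> A" "app a b = Some c"
  shows "c \<in> A"
proof -
  obtain f where f: "R {pr a b |a b. a \<in> A \<and> b \<in> A \<and> app a b \<noteq> None} f" "f (pr a b) = c"
    using R_app assms by blast
  have "f (pr a b) \<in> A"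
    by (rule R_in[OF f(1)]) (use assms pr_in in auto)
  then show ?thesis
    using f(2) by simp
qed

text \<open>Pairs nested to the left over an arbitrary starting element, so that appending an
  argument is one \<open>pr\<close>. This matches the order in which \<open>app_list\<close>
  consumes arguments, and the empty tuple still is an element of \<open>A\<close>.\<close>

definition tuple :: "'u list \<Rightarrow> 'u" where
  "tuple as = foldl pr (SOME a. a \<in> A) as"

lemma tuple_snoc [simp]: "tuple (as @ [b]) = pr (tuple as) b"
  by (simp add: tuple_def)

lemma tuple_in: "set as \<subseteq> A \<Longrightarrow> tuple as \<in> A"
proof (induction as rule: rev_induct)
  case Nil
  then show ?case
    using nonempty by (auto simp: tuple_def intro: some_in_eq[THEN iffD2])
qed (simp add: pr_in)

definition tuples :: "nat \<Rightarrow> 'u set" where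
  "tuples n = {tuple as |as. length as = n \<and> set as \<subseteq> A}"

lemma tuples_subset: "tuples n \<subseteq> A"
  using tuple_in by (auto simp: tuples_def)

lemma length_SucE:
  assumes "length as = Suc n" "set as \<subseteq> A"
  obtains bs b where "as = bs @ [b]" "length bs = n" "set bs \<subseteq> A" "b \<in> A"
  using assms by (cases as rule: rev_cases) auto

text \<open>Induction peels off the last entry: it is the second projection, and all earlier entries
  are entries of the first projection.\<close>

lemma R_nth: "i < n \<Longrightarrow> \<exists>f. R (tuples n) f \<and> (\<forall>as. length as = n \<and> set as \<subseteq> A \<longrightarrow> f (tuple as) = as ! i)"
proof (induction n)
  case (Suc n)
  let ?P = "{pr a b |a b. a \<in> A \<and> b \<in> A}"
  have sub: "tuples (Suc n) \<subseteq> ?P"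
    unfolding tuples_def by (auto elim!: length_SucE) (metis tuple_in)
  show ?case
  proof (cases "i = n")
    case True
    obtain f where f: "R ?P f" "\<forall>a\<in>A. \<forall>b\<in>A. f (pr a b) = b"
      using R_snd by blast
    have "f (tuple as) = as ! i" if "length as = Suc n" "set as \<subseteq> A" for as
      using that f(2) by (elim length_SucE) (auto simp: True nth_append tuple_in)
    then show ?thesis
      using R_subset[OF f(1) sub] by blast
  next
    case False
    then obtain g where g: "R (tuples n) g" "\<And>as. length as = n \<Longrightarrow> set as \<subseteq> A \<Longrightarrow> g (tuple as) = as ! i"
      using Suc by auto
    obtain f where f: "R ?P f" "\<forall>a\<in>A. \<forall>b\<in>A. f (pr a b) = a"
      using R_fst by blast
    have "R (tuples (Suc n)) (\<lambda>x. g (f x))"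
    proof (rule R_comp[OF R_subset[OF f(1) sub] g(1)])
      fix x assume "x \<in> tuples (Suc n)"
      then show "f x \<in> tuples n"
        unfolding tuples_def using f(2) by (auto elim!: length_SucE simp: tuple_in)
    qed
    moreover have "g (f (tuple as)) = as ! i" if "length as = Suc n" "set as \<subseteq> A" for as
      using that f(2) g(2) False Suc.prems by (elim length_SucE) (auto simp: nth_append tuple_in)
    ultimately show ?thesis
      by (intro exI[of _ "\<lambda>x. g (f x)"]) auto
  qed
qed simp

text \<open>Where \<open>t\<close> is a function of the coded argument list. Its realizers only have
  to be correct there, in line with \<open>\<preceq>\<close> in the definition of a PCA.\<close>

definition domain :: "nat \<Rightarrow> 'u polynomial \<Rightarrow> 'u set" where
  "domain n t = {tuple as |as. length as = n \<and> set as \<subseteq> A \<and> poly_eval app as t \<noteq> None}"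

text \<open>For an application both parts must be defined where the whole is, so the domain of the
  whole lies in the domains of the parts, and the pair of their values lies where \<open>app\<close>
  is defined.\<close>

lemma R_poly:
  "poly_over A n t \<Longrightarrow> \<exists>f. R (domain n t) f \<and>
    (\<forall>as c. length as = n \<and> set as \<subseteq> A \<and> poly_eval app as t = Some c \<longrightarrow> f (tuple as) = c)"
proof (induction t)
  case (Var i)
  have "domain n (Var i) \<subseteq> tuples n"
    by (auto simp: domain_def tuples_def)
  then show ?case
    using R_nth[of i n] Var R_subset by (metis option.inject poly_eval.simps(1) poly_over.simps(1))
next
  case (Const a)
  then show ?case
    by (intro exI[of _ "\<lambda>_. a"]) (auto intro: R_const)
next
  case (App s t)
  obtain f where f: "R (domain n s) f"
    "\<And>as c. length as = n \<Longrightarrow> set as \<subseteq> A \<Longrightarrow> poly_eval app as s = Some c \<Longrightarrow> f (tuple as) = c"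
    using App by auto
  obtain g where g: "R (domain n t) g"
    "\<And>as c. length as = n \<Longrightarrow> set as \<subseteq> A \<Longrightarrow> poly_eval app as t = Some c \<Longrightarrow> g (tuple as) = c"
    using App by auto
  let ?D = "{pr a b |a b. a \<in> A \<and> b \<in> A \<and> app a b \<noteq> None}"
  obtain h where h: "R ?D h" "\<And>a b c. a \<in> A \<Longrightarrow> b \<in> A \<Longrightarrow> app a b = Some c \<Longrightarrow> h (pr a b) = c"
    using R_app by blast
  let ?M = "domain n (App s t)"
  have fM: "R ?M f"
    by (rule R_subset[OF f(1)]) (fastforce simp: domain_def app_opt_eq_Some)
  have gM: "R ?M g"
    by (rule R_subset[OF g(1)]) (fastforce simp: domain_def app_opt_eq_Some)
  have sub: "?M \<subseteq> A"
    using tuple_in by (auto simp: domain_def)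
  have val: "f (tuple as) \<in> A \<and> g (tuple as) \<in> A \<and> app (f (tuple as)) (g (tuple as)) = Some c"
    if as: "length as = n" "set as \<subseteq> A" and c: "poly_eval app as (App s t) = Some c" for as c
  proof -
    have "tuple as \<in> ?M"
      using that by (auto simp: domain_def)
    then have "f (tuple as) \<in> A" "g (tuple as) \<in> A"
      using R_in[OF fM sub] R_in[OF gM sub] by auto
    then show ?thesis
      using c f(2)[OF as] g(2)[OF as] by (auto simp: app_opt_eq_Some)
  qed
  have "R ?M (\<lambda>x. h (pr (f x) (g x)))"
  proof (rule R_comp[OF R_pr[OF fM gM] h(1)])
    fix x assume "x \<in> ?M"
    then obtain as c where "x = tuple as" "length as = n" "set as \<subseteq> A" "poly_eval app as (App s t) = Some c"
      by (auto simp: domain_def)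
    then show "pr (f x) (g x) \<in> ?D"
      using val by blast
  qed
  moreover have "h (pr (f (tuple as)) (g (tuple as))) = c"
    if "length as = n" "set as \<subseteq> A" "poly_eval app as (App s t) = Some c" for as c
    using val[OF that] h(2) by blast
  ultimately show ?case
    by (intro exI[of _ "\<lambda>x. h (pr (f x) (g x))"]) blast
qed

text \<open>The last argument is curried first, and \<open>R_curry\<close> returns a function on all
  of \<open>A\<close>; hence every partial application along the way is defined, not just the final
  value.\<close>

lemma R_curry_list:
  "R (tuples n) k \<Longrightarrow>
    \<exists>e\<in>A. \<forall>as. length as = n \<and> set as \<subseteq> A \<longrightarrow> app_list app e as = Some (k (tuple as))"
proof (induction n arbitrary: k)
  case 0
  have "tuple [] \<in> tuples 0"
    by (auto simp: tuples_def)
  then have "k (tuple []) \<in> A"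
    using R_in[OF 0 tuples_subset] by blast
  then show ?case
    by (intro bexI[of _ "k (tuple [])"]) auto
next
  case (Suc n)
  obtain k' where k': "R A k'" "\<And>a b. a \<in> A \<Longrightarrow> b \<in> A \<Longrightarrow> pr a b \<in> tuples (Suc n) \<Longrightarrow> app (k' a) b = Some (k (pr a b))"
    using R_curry[OF Suc.prems tuples_subset] by blast
  obtain e where e: "e \<in> A" "\<And>as. length as = n \<Longrightarrow> set as \<subseteq> A \<Longrightarrow> app_list app e as = Some (k' (tuple as))"
    using Suc.IH[OF R_subset[OF k'(1) tuples_subset]] by blast
  have "app_list app e as = Some (k (tuple as))" if as: "length as = Suc n" "set as \<subseteq> A" for as
  proof -
    have "tuple as \<in> tuples (Suc n)"
      using as by (auto simp: tuples_def)
    then show ?thesis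
      using as e(2) k'(2) by (elim length_SucE) (auto simp: tuple_in)
  qed
  then show ?case
    using e(1) by blast
qed

lemma pca: "pca A app"
  unfolding pca_def
proof (intro conjI allI impI)
  show "partial_applicative_structure A app"
    unfolding partial_applicative_structure_def using app_in by blast
next
  fix n t assume "poly_over A (Suc n) t"
  from R_poly[OF this] obtain f where f: "R (domain (Suc n) t) f"
    "\<And>as c. length as = Suc n \<Longrightarrow> set as \<subseteq> A \<Longrightarrow> poly_eval app as t = Some c \<Longrightarrow> f (tuple as) = c"
    by blast
  have "domain (Suc n) t \<subseteq> A"
    using tuple_in by (auto simp: domain_def)
  \<comment> \<open>The last argument is split off on the partial domain of \<open>t\<close>; what
    remains is total, so \<open>R_curry_list\<close> handles the other \<open>n\<close> arguments
    and gives the required definedness.\<close>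
  from R_curry[OF f(1) this] obtain k where k: "R A k"
    "\<And>a b. a \<in> A \<Longrightarrow> b \<in> A \<Longrightarrow> pr a b \<in> domain (Suc n) t \<Longrightarrow> app (k a) b = Some (f (pr a b))"
    by blast
  from R_curry_list[OF R_subset[OF k(1) tuples_subset], of n]
  obtain e where e: "e \<in> A" "\<And>as. length as = n \<Longrightarrow> set as \<subseteq> A \<Longrightarrow> app_list app e as = Some (k (tuple as))"
    by blast
  have "poly_eval app (as @ [b]) t \<preceq> app_list app e (as @ [b])"
    if as: "length as = n" "set as \<subseteq> A" and b: "b \<in> A" for as b
    unfolding partial_le_def
  proof
    assume "poly_eval app (as @ [b]) t \<noteq> None"
    then obtain c where c: "poly_eval app (as @ [b]) t = Some c"
      by blast
    have "tuple (as @ [b]) \<in> domain (Suc n) t"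
      using as b c unfolding domain_def by (intro CollectI exI[of _ "as @ [b]"]) simp
    then have "app_list app e (as @ [b]) = Some c"
      using k(2)[OF tuple_in[OF as(2)] b] f(2)[of "as @ [b]" c] as b c e(2)[OF as] by simp
    then show "app_list app e (as @ [b]) \<noteq> None \<and> poly_eval app (as @ [b]) t = app_list app e (as @ [b])"
      using c by simp
  qed
  then show "\<exists>e\<in>A. \<forall>as b. length as = n \<and> set as \<subseteq> A \<and> b \<in> A \<longrightarrow>
      app_list app e as \<noteq> None \<and> poly_eval app (as @ [b]) t \<preceq> app_list app e (as @ [b])"
    by (intro bexI[OF _ e(1)] allI impI conjI) (simp_all add: e(2) del: app_list_snoc)
qed

text \<open>Currying produces a function into indices rather than one index. Precomposing with the
  second projection makes the first argument a dummy, and the curried function at \<open>a0\<close>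
  is the index. Conversely, \<open>x\<close> is paired with the fixed index \<open>e\<close>, and
  application is realizable.\<close>

lemma R_iff_app:
  assumes M: "M \<subseteq> A"
  shows "R M f \<longleftrightarrow> (\<exists>e\<in>A. \<forall>a\<in>M. app e a = Some (f a))"
proof
  assume f: "R M f"
  obtain a0 where a0: "a0 \<in> A"
    using nonempty by blast
  obtain snd where snd: "R {pr a b |a b. a \<in> A \<and> b \<in> A} snd" "\<And>a b. a \<in> A \<Longrightarrow> b \<in> A \<Longrightarrow> snd (pr a b) = b"
    using R_snd by blast
  let ?M = "{pr a0 b |b. b \<in> M}"
  have "R ?M (\<lambda>x. f (snd x))"
    by (rule R_comp[OF R_subset[OF snd(1)] f]) (use M a0 snd(2) in auto)
  moreover have "?M \<subseteq> A"
    using M a0 pr_in by auto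
  ultimately have "\<exists>k. R A k \<and> (\<forall>a\<in>A. \<forall>b\<in>A. pr a b \<in> ?M \<longrightarrow> app (k a) b = Some (f (snd (pr a b))))"
    by (rule R_curry)
  then obtain k where k: "R A k"
    "\<And>a b. a \<in> A \<Longrightarrow> b \<in> A \<Longrightarrow> pr a b \<in> ?M \<Longrightarrow> app (k a) b = Some (f (snd (pr a b)))"
    by blast
  have "app (k a0) b = Some (f b)" if "b \<in> M" for b
    using k(2)[OF a0, of b] snd(2)[OF a0, of b] that M by auto
  then show "\<exists>e\<in>A. \<forall>a\<in>M. app e a = Some (f a)"
    using R_in[OF k(1) subset_refl a0] by blast
next
  assume "\<exists>e\<in>A. \<forall>a\<in>M. app e a = Some (f a)"
  then obtain e where e: "e \<in> A" "\<And>a. a \<in> M \<Longrightarrow> app e a = Some (f a)"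
    by blast
  obtain g where g: "R {pr a b |a b. a \<in> A \<and> b \<in> A \<and> app a b \<noteq> None} g"
    "\<And>a b c. a \<in> A \<Longrightarrow> b \<in> A \<Longrightarrow> app a b = Some c \<Longrightarrow> g (pr a b) = c"
    using R_app by blast
  have "R M (\<lambda>x. g (pr e x))"
    by (rule R_comp[OF R_pr[OF R_const[OF e(1)] R_id] g(1)]) (use e M in force)
  then show "R M f"
  proof (rule R_cong)
    show "g (pr e x) = f x" if "x \<in> M" for x
      using g(2)[OF e(1) _ e(2)] that M by blast
  qed
qed

end

section \<open>The algebra of points of a discrete generic object\<close>

context well_pointed_cat
begin

text \<open>Well-pointedness makes the arrow behind \<open>h\<close> unique, so \<open>h\<close> may
  stand for it. Values of \<open>h\<close> off the points of \<open>X\<close> are unconstrained,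
  which lets \<open>h\<close> be any expression that is meaningful on points.\<close>

definition is_arrow :: "'o \<Rightarrow> 'o \<Rightarrow> ('u \<Rightarrow> 'u) \<Rightarrow> bool" where
  "is_arrow X Y h \<longleftrightarrow> (\<exists>f\<in>hom C X Y. \<forall>x\<in>hom C T X. f \<cdot> x = h x)"

lemma is_arrowI: "f \<in> hom C X Y \<Longrightarrow> (\<And>x. x \<in> hom C T X \<Longrightarrow> f \<cdot> x = h x) \<Longrightarrow> is_arrow X Y h"
  unfolding is_arrow_def by blast

lemma is_arrowE:
  assumes "is_arrow X Y h"
  obtains f where "f \<in> hom C X Y" "\<And>x. x \<in> hom C T X \<Longrightarrow> f \<cdot> x = h x"
  using assms unfolding is_arrow_def by blast

lemma is_arrow_hom: "f \<in> hom C X Y \<Longrightarrow> is_arrow X Y (\<lambda>x. f \<cdot> x)"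
  unfolding is_arrow_def by blast

lemma is_arrow_cong: "is_arrow X Y h \<Longrightarrow> (\<And>x. x \<in> hom C T X \<Longrightarrow> h x = h' x) \<Longrightarrow> is_arrow X Y h'"
  unfolding is_arrow_def by auto

lemma is_arrow_point: "is_arrow X Y h \<Longrightarrow> x \<in> hom C T X \<Longrightarrow> h x \<in> hom C T Y"
  unfolding is_arrow_def using comp_hom by metis

lemma is_arrow_comp:
  assumes "is_arrow X Y h" "is_arrow Y Z k"
  shows "is_arrow X Z (\<lambda>x. k (h x))"
proof -
  obtain f g where f: "f \<in> hom C X Y" "\<And>x. x \<in> hom C T X \<Longrightarrow> f \<cdot> x = h x"
    and g: "g \<in> hom C Y Z" "\<And>x. x \<in> hom C T Y \<Longrightarrow> g \<cdot> x = k x"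
    using assms unfolding is_arrow_def by blast
  show ?thesis
  proof (rule is_arrowI[OF comp_hom[OF f(1) g(1)]])
    fix x assume x: "x \<in> hom C T X"
    show "g \<cdot> f \<cdot> x = k (h x)"
      using g(2)[OF comp_hom[OF x f(1)]] by (simp add: assoc[OF x f(1) g(1)] f(2)[OF x])
  qed
qed

lemma is_arrow_const:
  assumes X: "X \<in> Obj C" and y: "y \<in> hom C T Y"
  shows "is_arrow X Y (\<lambda>_. y)"
proof -
  obtain t where t: "t \<in> hom C X T"
    using to_T_ex[OF X] by blast
  show ?thesis
  proof (rule is_arrowI[OF comp_hom[OF t y]])
    fix x assume x: "x \<in> hom C T X"
    have "t \<cdot> x = Ide C T"
      using to_T_eq[OF comp_hom[OF x t] ide_hom[OF T_obj]] .
    then show "y \<cdot> t \<cdot> x = y"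
      by (simp add: assoc[OF x t y] comp_ide[OF y])
  qed
qed

lemma is_arrow_closed:
  assumes "closed f" and f: "f \<in> hom C X Y" and "is_arrow Z Y (\<lambda>z. f \<cdot> b z)"
    and "\<And>z. z \<in> hom C T Z \<Longrightarrow> b z \<in> hom C T X"
  shows "is_arrow Z X b"
proof -
  obtain a where a: "a \<in> hom C Z Y" "\<And>z. z \<in> hom C T Z \<Longrightarrow> a \<cdot> z = f \<cdot> b z"
    using assms(3) by (rule is_arrowE) blast
  show ?thesis
  proof (rule closed_lift[OF assms(1) f a(1) assms(4)])
    show "f \<cdot> b z = a \<cdot> z" if "z \<in> hom C T Z" for z
      using a(2)[OF that] by simp
  qed (auto intro: is_arrowI)
qed

lemma closed_arrowI:
  assumes f: "f \<in> hom C X Y"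
    and "\<And>Z b. Z \<in> Obj C \<Longrightarrow> is_arrow Z Y (\<lambda>z. f \<cdot> b z) \<Longrightarrow>
      (\<And>z. z \<in> hom C T Z \<Longrightarrow> b z \<in> hom C T X) \<Longrightarrow> is_arrow Z X b"
  shows "closed f"
proof (rule closedI[OF f])
  fix Z a b assume a: "a \<in> hom C Z Y" and b: "\<And>z. z \<in> hom C T Z \<Longrightarrow> b z \<in> hom C T X"
    and eq: "\<And>z. z \<in> hom C T Z \<Longrightarrow> f \<cdot> b z = a \<cdot> z"
  have "is_arrow Z Y (\<lambda>z. f \<cdot> b z)"
    by (rule is_arrowI[OF a]) (simp add: eq)
  then show "\<exists>h\<in>hom C Z X. \<forall>z\<in>hom C T Z. h \<cdot> z = b z"
    using assms(2)[of Z b] hom_obj(1)[OF a] b unfolding is_arrow_def by blast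
qed

lemma pullback_point:
  assumes pb: "is_pullback C p q f g" and p: "p \<in> hom C P X" and q: "q \<in> hom C P Y"
    and f: "f \<in> hom C X Z" and g: "g \<in> hom C Y Z"
  shows "x \<in> hom C T P \<Longrightarrow> f \<cdot> (p \<cdot> x) = g \<cdot> (q \<cdot> x)"
    and "x \<in> hom C T X \<Longrightarrow> y \<in> hom C T Y \<Longrightarrow> f \<cdot> x = g \<cdot> y \<Longrightarrow> \<exists>z\<in>hom C T P. p \<cdot> z = x \<and> q \<cdot> z = y"
    and "x \<in> hom C T P \<Longrightarrow> y \<in> hom C T P \<Longrightarrow> p \<cdot> x = p \<cdot> y \<Longrightarrow> q \<cdot> x = q \<cdot> y \<Longrightarrow> x = y"
    and "is_arrow W X h \<Longrightarrow> is_arrow W Y k \<Longrightarrow> (\<And>w. w \<in> hom C T W \<Longrightarrow> f \<cdot> h w = g \<cdot> k w) \<Longrightarrow>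
      \<exists>m\<in>hom C W P. \<forall>w\<in>hom C T W. p \<cdot> (m \<cdot> w) = h w \<and> q \<cdot> (m \<cdot> w) = k w"
proof -
  show 1: "f \<cdot> (p \<cdot> x) = g \<cdot> (q \<cdot> x)" if "x \<in> hom C T P" for x
    using assoc[OF that p f] assoc[OF that q g] pullback_comm[OF pb] by simp
  show "\<exists>z\<in>hom C T P. p \<cdot> z = x \<and> q \<cdot> z = y" if "x \<in> hom C T X" "y \<in> hom C T Y" "f \<cdot> x = g \<cdot> y"
    using pullback_ex1[OF pb p q that] by blast
  show "x = y" if x: "x \<in> hom C T P" and "y \<in> hom C T P" "p \<cdot> x = p \<cdot> y" "q \<cdot> x = q \<cdot> y"
    using pullback_ex1[OF pb p q comp_hom[OF x p] comp_hom[OF x q] 1[OF x]] that by metis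
  show "\<exists>m\<in>hom C W P. \<forall>w\<in>hom C T W. p \<cdot> (m \<cdot> w) = h w \<and> q \<cdot> (m \<cdot> w) = k w"
    if h: "is_arrow W X h" and k: "is_arrow W Y k" and eq: "\<And>w. w \<in> hom C T W \<Longrightarrow> f \<cdot> h w = g \<cdot> k w"
  proof -
    obtain a where a: "a \<in> hom C W X" "\<And>w. w \<in> hom C T W \<Longrightarrow> a \<cdot> w = h w"
      using h by (rule is_arrowE) blast
    obtain b where b: "b \<in> hom C W Y" "\<And>w. w \<in> hom C T W \<Longrightarrow> b \<cdot> w = k w"
      using k by (rule is_arrowE) blast
    have "f \<cdot> a = g \<cdot> b"
      by (rule points_eqI[OF comp_hom[OF a(1) f] comp_hom[OF b(1) g]])
        (simp add: assoc[OF _ a(1) f] assoc[OF _ b(1) g] a(2) b(2) eq)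
    from pullback_ex1[OF pb p q a(1) b(1) this]
    obtain m where m: "m \<in> hom C W P" "p \<cdot> m = a" "q \<cdot> m = b"
      by blast
    then show ?thesis
      using assoc[OF _ m(1) p] assoc[OF _ m(1) q] a(2) b(2) by (intro bexI[OF _ m(1)]) metis
  qed
qed

text \<open>A product is a pullback over the terminal object, where commutativity is
  automatic.\<close>

lemma product_exists:
  assumes lim: "has_finite_limits C" and X: "X \<in> Obj C" and Y: "Y \<in> Obj C"
  obtains P p q where "p \<in> hom C P X" "q \<in> hom C P Y"
    "\<And>x y. x \<in> hom C T P \<Longrightarrow> y \<in> hom C T P \<Longrightarrow> p \<cdot> x = p \<cdot> y \<Longrightarrow> q \<cdot> x = q \<cdot> y \<Longrightarrow> x = y"
    "\<And>W h k. is_arrow W X h \<Longrightarrow> is_arrow W Y k \<Longrightarrow>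
      \<exists>m\<in>hom C W P. \<forall>w\<in>hom C T W. p \<cdot> (m \<cdot> w) = h w \<and> q \<cdot> (m \<cdot> w) = k w"
proof -
  obtain s t where s: "s \<in> hom C X T" and t: "t \<in> hom C Y T"
    using to_T_ex X Y by blast
  obtain P p q where p: "p \<in> hom C P X" and q: "q \<in> hom C P Y" and pb: "is_pullback C p q s t"
    using lim s t by (rule pullback_exists)
  note pts = pullback_point[OF pb p q s t]
  show ?thesis
  proof (rule that[OF p q pts(3)])
    fix W h k assume h: "is_arrow W X h" and k: "is_arrow W Y k"
    have "s \<cdot> h w = t \<cdot> k w" if "w \<in> hom C T W" for w
      by (rule to_T_eq[OF comp_hom[OF is_arrow_point[OF h that] s] comp_hom[OF is_arrow_point[OF k that] t]])
    then show "\<exists>m\<in>hom C W P. \<forall>w\<in>hom C T W. p \<cdot> (m \<cdot> w) = h w \<and> q \<cdot> (m \<cdot> w) = k w"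
      by (rule pts(4)[OF h k])
  qed
qed

end

section \<open>Objects as coded sets, given a discrete generic object\<close>

locale generic_cat = well_pointed_cat C U T N \<eta> \<epsilon> + grothendieck_universe U
  for C :: "('o, 'u) category" (structure) and U T N \<eta> \<epsilon> +
  fixes G :: 'o
  assumes wlcc: "weakly_locally_cartesian_closed C"
    and generic: "generic_object C T N \<eta> G" and discrete: "discrete_object C T N \<eta> G"
begin

abbreviation A :: "'u set" where
  "A \<equiv> hom C T G"

lemma finite_limits: "has_finite_limits C"
  using wlcc unfolding weakly_locally_cartesian_closed_def by blast

lemma G_obj: "G \<in> Obj C"
  using generic unfolding generic_object_def by blast

lemma A_in_U: "A \<in> U"
  by (rule points_in_U[OF G_obj])

text \<open>One closed map per object, kept as the code of its points. By closedness it determines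
  which functions on points into \<open>X\<close> are arrows, so the points of \<open>X\<close> with
  \<open>code X\<close> form the partitioned assembly that will represent \<open>X\<close>.\<close>

definition code :: "'o \<Rightarrow> 'u" where
  "code X = (SOME f. f \<in> hom C X G \<and> closed f)"

lemma code: "code X \<in> hom C X G" "closed (code X)" if "X \<in> Obj C"
proof -
  have "\<exists>f. f \<in> hom C X G \<and> closed f"
    using generic that unfolding generic_object_def by blast
  from someI_ex[OF this] show "code X \<in> hom C X G" "closed (code X)"
    unfolding code_def by auto
qed

text \<open>The pullback of \<open>\<nabla>\<phi> : \<nabla>S \<rightarrow> \<nabla>\<Gamma>G\<close> along the unit at \<open>G\<close>, with its closed projection to \<open>G\<close>.\<close>

lemma assembly_in_U_exists:
  assumes S: "S \<in> U" and \<phi>: "\<phi> \<in> S \<rightarrow> A"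
  obtains X k j where "X \<in> Obj C" "k \<in> hom C X G" "closed k" "bij_betw j (hom C T X) S"
    "\<And>x. x \<in> hom C T X \<Longrightarrow> k \<cdot> x = \<phi> (j x)"
proof -
  have \<phi>': "restrict \<phi> S \<in> S \<rightarrow>\<^sub>E A"
    using \<phi> by auto
  define g where "g = FArr N (S, restrict \<phi> S, A)"
  have g: "g \<in> hom C (nabla S) (nabla A)"
    unfolding g_def by (rule nabla_arr[OF S A_in_U \<phi>'])
  have counit_g: "counit A (g \<cdot> y) = \<phi> (counit S y)" if "y \<in> hom C T (nabla S)" for y
    using counit_nabla[OF S A_in_U \<phi>' that] counit_in[OF S that] by (simp add: g_def)
  obtain X p k where p: "p \<in> hom C X (nabla S)" and k: "k \<in> hom C X G" and pb: "is_pullback C p k g (\<eta> G)"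
    using finite_limits g \<eta>_hom[OF G_obj] by (rule pullback_exists)
  note pts = pullback_point[OF pb p k g \<eta>_hom[OF G_obj]]
  define j where "j x = counit S (p \<cdot> x)" for x
  have kj: "k \<cdot> x = \<phi> (j x)" if x: "x \<in> hom C T X" for x
    using pts(1)[OF x] counit_g[OF comp_hom[OF x p]] counit_\<eta>[OF G_obj comp_hom[OF x k]]
    by (simp add: j_def)
  \<comment> \<open>Points of the pullback are thus pairs of an element of \<open>S\<close> and its
    value under \<phi>, that is, elements of \<open>S\<close>.\<close>
  have sq_iff: "g \<cdot> y = \<eta> G \<cdot> a \<longleftrightarrow> \<phi> (counit S y) = a" if y: "y \<in> hom C T (nabla S)" and a: "a \<in> A" for y a
    using counit_g[OF y] counit_\<eta>[OF G_obj a]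
      counit_inj[OF A_in_U comp_hom[OF y g] comp_hom[OF a \<eta>_hom[OF G_obj]]] by auto
  have bij: "bij_betw j (hom C T X) S"
  proof (rule bij_betwI')
    fix x y assume x: "x \<in> hom C T X" and y: "y \<in> hom C T X"
    show "j x = j y \<longleftrightarrow> x = y"
      using counit_inj[OF S comp_hom[OF x p] comp_hom[OF y p]] kj[OF x] kj[OF y] pts(3)[OF x y]
      unfolding j_def by auto
  next
    fix x assume "x \<in> hom C T X"
    then show "j x \<in> S"
      unfolding j_def using counit_in[OF S comp_hom[OF _ p]] by blast
  next
    fix s assume s: "s \<in> S"
    obtain y where y: "y \<in> hom C T (nabla S)" "counit S y = s"
      using S s by (rule counit_surj)
    have "\<phi> s \<in> A"
      using \<phi> s by blast
    then show "\<exists>x\<in>hom C T X. s = j x"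
      using pts(2)[OF y(1)] sq_iff[OF y(1)] y(2) unfolding j_def by metis
  qed
  have "closed k"
  proof (rule closed_arrowI[OF k])
    fix Z b assume Z: "Z \<in> Obj C" and kb: "is_arrow Z G (\<lambda>z. k \<cdot> b z)"
      and b: "\<And>z. z \<in> hom C T Z \<Longrightarrow> b z \<in> hom C T X"
    \<comment> \<open>The component in \<open>nabla S\<close> is never an obstruction, since every
      function on points into it is an arrow; being an arrow into \<open>X\<close> is decided by
      \<open>k\<close> alone.\<close>
    have "is_arrow Z (nabla S) (\<lambda>z. p \<cdot> b z)"
    proof -
      have "(\<lambda>z. j (b z)) \<in> hom C T Z \<rightarrow> S"
        using b bij_betwE[OF bij] by blast
      then obtain h where h: "h \<in> hom C Z (nabla S)" "\<And>z. z \<in> hom C T Z \<Longrightarrow> counit S (h \<cdot> z) = j (b z)"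
        by (rule nabla_lift[OF S Z]) blast
      then show ?thesis
        using counit_inj[OF S comp_hom[OF _ h(1)] comp_hom[OF b p]]
        by (intro is_arrowI[OF h(1)]) (simp add: j_def)
    qed
    from pts(4)[OF this kb] obtain m where m: "m \<in> hom C Z X"
      "\<And>z. z \<in> hom C T Z \<Longrightarrow> p \<cdot> (m \<cdot> z) = p \<cdot> b z" "\<And>z. z \<in> hom C T Z \<Longrightarrow> k \<cdot> (m \<cdot> z) = k \<cdot> b z"
      using pts(1)[OF b] by blast
    show "is_arrow Z X b"
      by (rule is_arrowI[OF m(1)]) (use m pts(3)[OF comp_hom[OF _ m(1)] b] in blast)
  qed
  then show ?thesis
    using that hom_obj(1)[OF k] k bij kj by blast
qed

lemma assembly_exists:
  assumes "small W" and \<phi>: "\<And>w. w \<in> W \<Longrightarrow> \<phi> w \<in> A"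
  obtains X k j where "X \<in> Obj C" "k \<in> hom C X G" "closed k" "bij_betw j (hom C T X) W"
    "\<And>x. x \<in> hom C T X \<Longrightarrow> k \<cdot> x = \<phi> (j x)"
proof -
  obtain S c where S: "S \<in> U" and c: "bij_betw c S W"
    using assms(1) by (rule small_code)
  have "(\<lambda>s. \<phi> (c s)) \<in> S \<rightarrow> A"
    using \<phi> bij_betwE[OF c] by blast
  with S obtain X k j where X: "X \<in> Obj C" "k \<in> hom C X G" "closed k" and j: "bij_betw j (hom C T X) S"
    and kj: "\<And>x. x \<in> hom C T X \<Longrightarrow> k \<cdot> x = \<phi> (c (j x))"
    by (rule assembly_in_U_exists) blast
  show ?thesis
    using bij_betw_trans[OF j c] kj by (intro that[OF X, of "c \<circ> j"]) auto
qed

text \<open>\<open>M\<close> is a mere set of points, not an object, so \<open>r\<close> is tested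
  on all arrows into \<open>G\<close> with values in \<open>M\<close>. For \<open>M\<close>
  contained in \<open>A\<close> this agrees with \<open>r\<close> being an arrow out of the object
  that \<open>assembly_exists\<close> attaches to \<open>M\<close> and its inclusion, without
  choosing that object.\<close>

definition realizable :: "'u set \<Rightarrow> ('u \<Rightarrow> 'u) \<Rightarrow> bool" where
  "realizable M r \<longleftrightarrow> (\<forall>X h. is_arrow X G h \<longrightarrow> X \<in> Obj C \<longrightarrow> (\<forall>x\<in>hom C T X. h x \<in> M) \<longrightarrow>
     is_arrow X G (\<lambda>x. r (h x)))"

lemma realizableD:
  "realizable M r \<Longrightarrow> X \<in> Obj C \<Longrightarrow> is_arrow X G h \<Longrightarrow> (\<And>x. x \<in> hom C T X \<Longrightarrow> h x \<in> M) \<Longrightarrow>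
    is_arrow X G (\<lambda>x. r (h x))"
  unfolding realizable_def by blast

text \<open>
  Corestricting a closed arrow to its image gives a closed arrow that is surjective on points, along
  which arrows to \<open>G\<close> extend by discreteness.
\<close>

lemma factor_closed:
  assumes k: "k \<in> hom C X G" "closed k" and f: "is_arrow X G f"
  obtains r where "realizable ((\<lambda>x. k \<cdot> x) ` hom C T X) r" "\<And>x. x \<in> hom C T X \<Longrightarrow> f x = r (k \<cdot> x)"
proof -
  let ?M = "(\<lambda>x. k \<cdot> x) ` hom C T X"
  have X: "X \<in> Obj C"
    using hom_obj k by blast
  have M: "?M \<subseteq> A"
    using comp_hom[OF _ k(1)] by blast
  \<comment> \<open>\<open>Y\<close> is the image: its points are the elements of \<open>?M\<close>,
    each coded by itself.\<close>
  obtain Y \<mu> j where Y: "Y \<in> Obj C" and \<mu>: "\<mu> \<in> hom C Y G" "closed \<mu>" and j: "bij_betw j (hom C T Y) ?M"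
    and \<mu>j: "\<And>y. y \<in> hom C T Y \<Longrightarrow> \<mu> \<cdot> y = j y"
    by (rule assembly_exists[OF small_subset[OF small_member[OF A_in_U] M], of "\<lambda>a. a"]) (use M in auto)
  define i where "i = inv_into (hom C T Y) j"
  have i: "i a \<in> hom C T Y" "j (i a) = a" if "a \<in> ?M" for a
    using that j unfolding i_def by (auto simp: bij_betw_def inv_into_into f_inv_into_f)
  have ij: "i (j y) = y" if "y \<in> hom C T Y" for y
    using that j unfolding i_def by (simp add: bij_betw_def)
  have "is_arrow X Y (\<lambda>x. i (k \<cdot> x))"
  proof (rule is_arrow_closed[OF \<mu>(2,1)])
    show "is_arrow X G (\<lambda>x. \<mu> \<cdot> i (k \<cdot> x))"
      using i \<mu>j by (intro is_arrowI[OF k(1)]) simp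
  qed (use i in blast)
  then obtain e where e: "e \<in> hom C X Y" "\<And>x. x \<in> hom C T X \<Longrightarrow> e \<cdot> x = i (k \<cdot> x)"
    by (rule is_arrowE) blast
  \<comment> \<open>Cancellation: \<open>k\<close> is \<mu> after \<open>e\<close>, so whatever is
    an arrow after \<open>e\<close> is one after \<open>k\<close> and lifts through the closed
    \<open>k\<close>.\<close>
  have "closed e"
  proof (rule closed_arrowI[OF e(1)])
    fix Z b assume Z: "Z \<in> Obj C" and eb: "is_arrow Z Y (\<lambda>z. e \<cdot> b z)"
      and b: "\<And>z. z \<in> hom C T Z \<Longrightarrow> b z \<in> hom C T X"
    have "is_arrow Z G (\<lambda>z. k \<cdot> b z)"
    proof (rule is_arrow_cong[OF is_arrow_comp[OF eb is_arrow_hom[OF \<mu>(1)]]])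
      fix z assume "z \<in> hom C T Z"
      then show "\<mu> \<cdot> (e \<cdot> b z) = k \<cdot> b z"
        using b e(2) \<mu>j i by simp
    qed
    then show "is_arrow Z X b"
      using b by (rule is_arrow_closed[OF k(2,1)])
  qed
  moreover have "surjective (FArr (global_sections C T) e)"
    unfolding surjective_def sections_arr[OF e(1)]
  proof (clarsimp, intro equalityI subsetI)
    fix y assume y: "y \<in> hom C T Y"
    then obtain x where "x \<in> hom C T X" "j y = k \<cdot> x"
      using bij_betwE[OF j] by blast
    then show "y \<in> (\<lambda>x. e \<cdot> x) ` hom C T X"
      using e(2) ij[OF y] by (metis image_eqI)
  qed (use comp_hom[OF _ e(1)] in blast)
  moreover obtain f0 where f0: "f0 \<in> hom C X G" "\<And>x. x \<in> hom C T X \<Longrightarrow> f0 \<cdot> x = f x"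
    using f by (rule is_arrowE) blast
  ultimately obtain g where g: "g \<in> hom C Y G" "g \<cdot> e = f0"
    using discrete e(1) X Y unfolding discrete_object_def by blast
  show ?thesis
  proof (rule that)
    fix x assume x: "x \<in> hom C T X"
    show "f x = g \<cdot> i (k \<cdot> x)"
      using assoc[OF x e(1) g(1)] e(2)[OF x] f0(2)[OF x] g(2) by simp
  next
    \<comment> \<open>An arrow with values in \<open>?M\<close> lifts through the closed \<mu> to an
      arrow into \<open>Y\<close>, to which \<open>g\<close> is then applied.\<close>
    show "realizable ?M (\<lambda>a. g \<cdot> i a)"
      unfolding realizable_def
    proof (intro allI impI)
      fix Z h assume h: "is_arrow Z G h" and hM: "\<forall>z\<in>hom C T Z. h z \<in> ?M"
      have "is_arrow Z Y (\<lambda>z. i (h z))"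
      proof (rule is_arrow_closed[OF \<mu>(2,1)])
        show "is_arrow Z G (\<lambda>z. \<mu> \<cdot> i (h z))"
          by (rule is_arrow_cong[OF h]) (use hM i \<mu>j in auto)
      qed (use hM i in blast)
      then show "is_arrow Z G (\<lambda>z. g \<cdot> i (h z))"
        using is_arrow_hom[OF g(1)] by (rule is_arrow_comp)
    qed
  qed
qed

section \<open>Pairing and application on the points of the generic object\<close>

definition is_pairing :: "('u \<Rightarrow> 'u \<Rightarrow> 'u) \<Rightarrow> bool" where
  "is_pairing pr \<longleftrightarrow>
     (\<forall>X f g. is_arrow X G f \<longrightarrow> is_arrow X G g \<longrightarrow> is_arrow X G (\<lambda>x. pr (f x) (g x))) \<and>
     (\<exists>f. realizable {pr a b |a b. a \<in> A \<and> b \<in> A} f \<and> (\<forall>a\<in>A. \<forall>b\<in>A. f (pr a b) = a)) \<and>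
     (\<exists>f. realizable {pr a b |a b. a \<in> A \<and> b \<in> A} f \<and> (\<forall>a\<in>A. \<forall>b\<in>A. f (pr a b) = b))"

lemma pairing_exists: "\<exists>pr. is_pairing pr"
proof -
  obtain P p q where p: "p \<in> hom C P G" and q: "q \<in> hom C P G"
    and inj: "\<And>x y. x \<in> hom C T P \<Longrightarrow> y \<in> hom C T P \<Longrightarrow> p \<cdot> x = p \<cdot> y \<Longrightarrow> q \<cdot> x = q \<cdot> y \<Longrightarrow> x = y"
    and ex: "\<And>W h k. is_arrow W G h \<Longrightarrow> is_arrow W G k \<Longrightarrow>
      \<exists>m\<in>hom C W P. \<forall>w\<in>hom C T W. p \<cdot> (m \<cdot> w) = h w \<and> q \<cdot> (m \<cdot> w) = k w"
    using product_exists[OF finite_limits G_obj G_obj] by metis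
  have P: "P \<in> Obj C"
    using hom_obj p by blast
  define pt where "pt a b = (THE x. x \<in> hom C T P \<and> p \<cdot> x = a \<and> q \<cdot> x = b)" for a b
  have pt_eq: "pt (p \<cdot> x) (q \<cdot> x) = x" if "x \<in> hom C T P" for x
    unfolding pt_def using that inj by (intro the_equality) auto
  have pt: "pt a b \<in> hom C T P" "p \<cdot> pt a b = a" "q \<cdot> pt a b = b" if ab: "a \<in> A" "b \<in> A" for a b
  proof -
    obtain m where m: "m \<in> hom C T P" "p \<cdot> (m \<cdot> Ide C T) = a" "q \<cdot> (m \<cdot> Ide C T) = b"
      using ex[OF is_arrow_const[OF T_obj ab(1)] is_arrow_const[OF T_obj ab(2)]] points_T by blast
    then show "pt a b \<in> hom C T P" "p \<cdot> pt a b = a" "q \<cdot> pt a b = b"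
      using pt_eq[OF m(1)] by (auto simp: comp_ide[OF m(1)])
  qed
  define pr where "pr a b = code P \<cdot> pt a b" for a b
  have pr_image: "{pr a b |a b. a \<in> A \<and> b \<in> A} = (\<lambda>x. code P \<cdot> x) ` hom C T P"
  proof (intro equalityI subsetI)
    fix c assume "c \<in> (\<lambda>x. code P \<cdot> x) ` hom C T P"
    then obtain x where x: "x \<in> hom C T P" "c = pr (p \<cdot> x) (q \<cdot> x)"
      unfolding pr_def using pt_eq by auto
    then show "c \<in> {pr a b |a b. a \<in> A \<and> b \<in> A}"
      using comp_hom[OF x(1) p] comp_hom[OF x(1) q] by blast
  qed (use pt(1) pr_def in auto)
  \<comment> \<open>The projections are arrows out of \<open>P\<close>, and
    \<open>factor_closed\<close> turns them into functions of the code.\<close>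
  obtain f where f: "realizable ((\<lambda>x. code P \<cdot> x) ` hom C T P) f"
    "\<And>x. x \<in> hom C T P \<Longrightarrow> p \<cdot> x = f (code P \<cdot> x)"
    using code[OF P] is_arrow_hom[OF p] by (rule factor_closed) blast
  obtain g where g: "realizable ((\<lambda>x. code P \<cdot> x) ` hom C T P) g"
    "\<And>x. x \<in> hom C T P \<Longrightarrow> q \<cdot> x = g (code P \<cdot> x)"
    using code[OF P] is_arrow_hom[OF q] by (rule factor_closed) blast
  have "is_arrow X G (\<lambda>x. pr (h x) (k x))" if h: "is_arrow X G h" and k: "is_arrow X G k" for X h k
  proof -
    obtain m where m: "m \<in> hom C X P" "\<And>x. x \<in> hom C T X \<Longrightarrow> p \<cdot> (m \<cdot> x) = h x"
      "\<And>x. x \<in> hom C T X \<Longrightarrow> q \<cdot> (m \<cdot> x) = k x"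
      using ex[OF h k] by blast
    show ?thesis
    proof (rule is_arrow_cong[OF is_arrow_comp[OF is_arrow_hom[OF m(1)] is_arrow_hom[OF code(1)[OF P]]]])
      show "code P \<cdot> (m \<cdot> x) = pr (h x) (k x)" if "x \<in> hom C T X" for x
        using pt_eq[OF comp_hom[OF that m(1)]] m(2,3)[OF that] by (simp add: pr_def)
    qed
  qed
  moreover have "\<forall>a\<in>A. \<forall>b\<in>A. f (pr a b) = a" "\<forall>a\<in>A. \<forall>b\<in>A. g (pr a b) = b"
    using f(2) g(2) pt unfolding pr_def by metis+
  ultimately have "is_pairing pr"
    unfolding is_pairing_def pr_image using f(1) g(1) by blast
  then show ?thesis
    by blast
qed

lemma realizable_mono: "realizable M r \<Longrightarrow> M' \<subseteq> M \<Longrightarrow> realizable M' r"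
  unfolding realizable_def by blast

lemma realizable_cong:
  assumes "realizable M r" "\<And>x. x \<in> M \<Longrightarrow> r x = r' x"
  shows "realizable M r'"
  unfolding realizable_def
proof (intro allI impI)
  fix X h assume h: "is_arrow X G h" "X \<in> Obj C" "\<forall>x\<in>hom C T X. h x \<in> M"
  then have "is_arrow X G (\<lambda>x. r (h x))"
    using realizableD[OF assms(1)] by blast
  then show "is_arrow X G (\<lambda>x. r' (h x))"
    by (rule is_arrow_cong) (use h(3) assms(2) in blast)
qed

text \<open>
  Application comes from weak local cartesian closure at \<open>u : J \<rightarrow> \<nabla>(Pow A)\<close> and
  \<open>b : J \<times> G \<rightarrow> J\<close>, where the points of \<open>J\<close> are the pairs \<open>(M, a)\<close> with \<open>a \<in> M\<close>,
  coded by \<open>a\<close>: a point of the weak dependent product \<open>P\<close> over \<open>M\<close> is an index of a partial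
  function with domain \<open>M\<close>, and \<open>e \<cdot> a\<close> evaluates an index with code \<open>e\<close> at \<open>a\<close>.
\<close>

lemma application_exists:
  assumes pr: "is_pairing pr"
  obtains app where
    "\<exists>f. realizable {pr a b |a b. a \<in> A \<and> b \<in> A \<and> app a b \<noteq> None} f \<and>
      (\<forall>a\<in>A. \<forall>b\<in>A. \<forall>c. app a b = Some c \<longrightarrow> f (pr a b) = c)"
    "\<And>M h. realizable M h \<Longrightarrow> M \<subseteq> A \<Longrightarrow>
      \<exists>k. realizable A k \<and> (\<forall>a\<in>A. \<forall>b\<in>A. pr a b \<in> M \<longrightarrow> app (k a) b = Some (h (pr a b)))"
proof -
  have pr_arrow: "is_arrow X G (\<lambda>x. pr (f x) (g x))" if "is_arrow X G f" "is_arrow X G g" for X f g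
    using pr that unfolding is_pairing_def by blast
  obtain pr1 where pr1: "realizable {pr a b |a b. a \<in> A \<and> b \<in> A} pr1"
    "\<And>a b. a \<in> A \<Longrightarrow> b \<in> A \<Longrightarrow> pr1 (pr a b) = a"
    using pr unfolding is_pairing_def by blast
  obtain pr2 where pr2: "realizable {pr a b |a b. a \<in> A \<and> b \<in> A} pr2"
    "\<And>a b. a \<in> A \<Longrightarrow> b \<in> A \<Longrightarrow> pr2 (pr a b) = b"
    using pr unfolding is_pairing_def by blast
  \<comment> \<open>\<nabla> is defined on members of \<open>U\<close>, whose elements have type
    \<open>'u\<close>, so the subsets of \<open>A\<close> are named by the elements of a set
    \<open>D\<close>.\<close>
  obtain D d where D: "D \<in> U" and d: "bij_betw d D (Pow A)"
    by (rule small_code[OF small_Pow[OF small_member[OF A_in_U]]])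
  define name where "name = inv_into D d"
  have name: "name M \<in> D" "d (name M) = M" if "M \<subseteq> A" for M
    using that d unfolding name_def by (auto simp: bij_betw_def inv_into_into f_inv_into_f)
  let ?W = "{(s, a). s \<in> D \<and> a \<in> d s}"
  have d_sub: "d s \<subseteq> A" if "s \<in> D" for s
    using bij_betwE[OF d] that by blast
  have "small ?W"
    by (rule small_subset[OF small_Times[OF small_member[OF D] small_member[OF A_in_U]]]) (use d_sub in auto)
  then obtain J \<kappa> j where J: "J \<in> Obj C" and \<kappa>: "\<kappa> \<in> hom C J G" "closed \<kappa>"
    and j: "bij_betw j (hom C T J) ?W" and \<kappa>j: "\<And>x. x \<in> hom C T J \<Longrightarrow> \<kappa> \<cdot> x = snd (j x)"
  proof (rule assembly_exists[of ?W snd])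
    show "snd w \<in> A" if "w \<in> ?W" for w
      using that d_sub[of "fst w"] by auto
  qed blast
  have j_in: "fst (j x) \<in> D" "snd (j x) \<in> d (fst (j x))" if "x \<in> hom C T J" for x
    using bij_betwE[OF j] that by auto
  obtain u where u: "u \<in> hom C J (nabla D)" "\<And>x. x \<in> hom C T J \<Longrightarrow> counit D (u \<cdot> x) = fst (j x)"
    using j_in(1) by (auto intro: nabla_lift[OF D J, of "\<lambda>x. fst (j x)"])
  \<comment> \<open>An arrow into \<open>B\<close> over \<open>J\<close> is just an arrow into
    \<open>G\<close>, so sections of \<open>b\<close> over a fibre of \<open>u\<close> are
    realizable functions from a subset of \<open>A\<close> to \<open>A\<close>.\<close>
  obtain B b g where b: "b \<in> hom C B J" and g: "g \<in> hom C B G"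
    and pair: "\<And>W h k. is_arrow W J h \<Longrightarrow> is_arrow W G k \<Longrightarrow>
      \<exists>m\<in>hom C W B. \<forall>w\<in>hom C T W. b \<cdot> (m \<cdot> w) = h w \<and> g \<cdot> (m \<cdot> w) = k w"
    by (rule product_exists[OF finite_limits J G_obj]) blast
  obtain P p Q q1 q2 v where p: "p \<in> hom C P (nabla D)" and q1: "q1 \<in> hom C Q J" and q2: "q2 \<in> hom C Q P"
    and pb: "is_pullback C q1 q2 u p" and v: "v \<in> hom C Q B" "b \<cdot> v = q1"
    and cover: "\<And>X x. x \<in> hom C X (nabla D) \<Longrightarrow> \<exists>R. \<exists>r1\<in>hom C R J. \<exists>r2\<in>hom C R X. is_pullback C r1 r2 u x \<and>
      (\<forall>w\<in>hom C R B. b \<cdot> w = r1 \<longrightarrow> (\<exists>m\<in>hom C X P. p \<cdot> m = x \<and>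
        (\<exists>k\<in>hom C R Q. q1 \<cdot> k = r1 \<and> q2 \<cdot> k = m \<cdot> r2 \<and> v \<cdot> k = w)))"
    by (rule weakly_locally_cartesian_closedE[OF wlcc b u(1)]) blast
  note Q_pts = pullback_point[OF pb q1 q2 u(1) p]
  have P: "P \<in> Obj C" and Q: "Q \<in> Obj C"
    using hom_obj q2 by auto
  define e1 where "e1 q = code P \<cdot> (q2 \<cdot> q)" for q
  define e2 where "e2 q = \<kappa> \<cdot> (q1 \<cdot> q)" for q
  have e1: "is_arrow Q G e1"
    unfolding e1_def by (rule is_arrow_comp[OF is_arrow_hom[OF q2] is_arrow_hom[OF code(1)[OF P]]])
  have e2: "is_arrow Q G e2"
    unfolding e2_def by (rule is_arrow_comp[OF is_arrow_hom[OF q1] is_arrow_hom[OF \<kappa>(1)]])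
  \<comment> \<open>A point of \<open>Q\<close> is an index together with an argument in its domain;
    \<open>l\<close> sends it to the pair of their codes.\<close>
  obtain l where l: "l \<in> hom C Q G" "\<And>q. q \<in> hom C T Q \<Longrightarrow> l \<cdot> q = pr (e1 q) (e2 q)"
    using pr_arrow[OF e1 e2] by (rule is_arrowE) blast
  \<comment> \<open>The pair determines both codes realizably, the closed maps \<open>code P\<close>
    and \<kappa> lift these to arrows into \<open>P\<close> and \<open>J\<close>, and the pullback
    \<open>Q\<close> combines them.\<close>
  have "closed l"
  proof (rule closed_arrowI[OF l(1)])
    fix Z c assume Z: "Z \<in> Obj C" and lc: "is_arrow Z G (\<lambda>z. l \<cdot> c z)"
      and c: "\<And>z. z \<in> hom C T Z \<Longrightarrow> c z \<in> hom C T Q"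
    have e12: "l \<cdot> c z = pr (e1 (c z)) (e2 (c z))" "e1 (c z) \<in> A" "e2 (c z) \<in> A" if "z \<in> hom C T Z" for z
      using l(2)[OF c[OF that]] is_arrow_point[OF e1 c[OF that]] is_arrow_point[OF e2 c[OF that]] by auto
    have in_pr: "l \<cdot> c z \<in> {pr a b |a b. a \<in> A \<and> b \<in> A}" if "z \<in> hom C T Z" for z
      using e12[OF that] by blast
    have "is_arrow Z G (\<lambda>z. e1 (c z))"
      by (rule is_arrow_cong[OF realizableD[OF pr1(1) Z lc in_pr]]) (simp_all add: e12 pr1(2))
    then have c2: "is_arrow Z P (\<lambda>z. q2 \<cdot> c z)"
      unfolding e1_def by (rule is_arrow_closed[OF code(2,1)[OF P]]) (rule comp_hom[OF c q2])
    have "is_arrow Z G (\<lambda>z. e2 (c z))"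
      by (rule is_arrow_cong[OF realizableD[OF pr2(1) Z lc in_pr]]) (simp_all add: e12 pr2(2))
    then have c1: "is_arrow Z J (\<lambda>z. q1 \<cdot> c z)"
      unfolding e2_def by (rule is_arrow_closed[OF \<kappa>(2,1)]) (rule comp_hom[OF c q1])
    obtain m where m: "m \<in> hom C Z Q" "\<And>z. z \<in> hom C T Z \<Longrightarrow> q1 \<cdot> (m \<cdot> z) = q1 \<cdot> c z"
      "\<And>z. z \<in> hom C T Z \<Longrightarrow> q2 \<cdot> (m \<cdot> z) = q2 \<cdot> c z"
      using Q_pts(4)[OF c1 c2 Q_pts(1)[OF c]] by blast
    show "is_arrow Z Q c"
    proof (rule is_arrowI[OF m(1)])
      show "m \<cdot> z = c z" if z: "z \<in> hom C T Z" for z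
        by (rule Q_pts(3)[OF comp_hom[OF z m(1)] c[OF z] m(2,3)[OF z]])
    qed
  qed
  \<comment> \<open>By discreteness the value of an index at an argument depends only on the pair of
    codes, although distinct points of \<open>P\<close> may have the same code.\<close>
  then obtain r where r: "realizable ((\<lambda>q. l \<cdot> q) ` hom C T Q) r"
    and r_eq: "\<And>q. q \<in> hom C T Q \<Longrightarrow> g \<cdot> (v \<cdot> q) = r (l \<cdot> q)"
    using is_arrow_comp[OF is_arrow_hom[OF v(1)] is_arrow_hom[OF g]] l(1) by (auto intro: factor_closed)
  \<comment> \<open>For \<open>a\<close> and \<open>b\<close> in \<open>A\<close>, defined exactly
    where some index with code \<open>a\<close> has \<open>b\<close> in its domain.\<close>
  define app where "app a b = (if pr a b \<in> (\<lambda>q. l \<cdot> q) ` hom C T Q then Some (r (pr a b)) else None)" for a b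
  show ?thesis
  proof (rule that)
    have "realizable {pr a b |a b. a \<in> A \<and> b \<in> A \<and> app a b \<noteq> None} r"
      by (rule realizable_mono[OF r]) (auto simp: app_def)
    moreover have "\<forall>a\<in>A. \<forall>b\<in>A. \<forall>c. app a b = Some c \<longrightarrow> r (pr a b) = c"
      by (simp add: app_def)
    ultimately show "\<exists>f. realizable {pr a b |a b. a \<in> A \<and> b \<in> A \<and> app a b \<noteq> None} f \<and>
        (\<forall>a\<in>A. \<forall>b\<in>A. \<forall>c. app a b = Some c \<longrightarrow> f (pr a b) = c)"
      by blast
  next
    fix M h assume h: "realizable M h" and M: "M \<subseteq> A"
    define fibre where "fibre a = {b \<in> A. pr a b \<in> M}" for a
    have fibre: "fibre a \<subseteq> A" for a
      by (auto simp: fibre_def)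
    have "(\<lambda>a. name (fibre a)) \<in> A \<rightarrow> D"
      using name(1)[OF fibre] by blast
    \<comment> \<open>An arrow although \<open>M\<close> is arbitrary, because any function on
      points into \<open>nabla D\<close> is one. Pulling \<open>u\<close> back along it gives
      \<open>R\<close>, whose points are the pairs of a point \<open>a\<close> and an element of
      \<open>fibre a\<close>.\<close>
    then obtain x where x: "x \<in> hom C G (nabla D)" "\<And>a. a \<in> A \<Longrightarrow> counit D (x \<cdot> a) = name (fibre a)"
      by (rule nabla_lift[OF D G_obj]) blast
    obtain R r1 r2 where r1: "r1 \<in> hom C R J" and r2: "r2 \<in> hom C R G" and pbR: "is_pullback C r1 r2 u x"
      and mk: "\<And>w. w \<in> hom C R B \<Longrightarrow> b \<cdot> w = r1 \<Longrightarrow> \<exists>m\<in>hom C G P. p \<cdot> m = x \<and>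
        (\<exists>k\<in>hom C R Q. q1 \<cdot> k = r1 \<and> q2 \<cdot> k = m \<cdot> r2 \<and> v \<cdot> k = w)"
      using cover[OF x(1)] by blast
    note R_pts = pullback_point[OF pbR r1 r2 u(1) x(1)]
    have R: "R \<in> Obj C"
      using hom_obj r1 by blast
    define s where "s z = pr (r2 \<cdot> z) (\<kappa> \<cdot> (r1 \<cdot> z))" for z
    have s: "is_arrow R G s"
      unfolding s_def
      by (rule pr_arrow[OF is_arrow_hom[OF r2] is_arrow_comp[OF is_arrow_hom[OF r1] is_arrow_hom[OF \<kappa>(1)]]])
    have sM: "s z \<in> M" if z: "z \<in> hom C T R" for z
    proof -
      have "fst (j (r1 \<cdot> z)) = name (fibre (r2 \<cdot> z))"
        using u(2)[OF comp_hom[OF z r1]] x(2)[OF comp_hom[OF z r2]] R_pts(1)[OF z] by simp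
      then have "\<kappa> \<cdot> (r1 \<cdot> z) \<in> fibre (r2 \<cdot> z)"
        using j_in(2)[OF comp_hom[OF z r1]] name(2)[OF fibre] \<kappa>j[OF comp_hom[OF z r1]] by simp
      then show ?thesis
        by (simp add: fibre_def s_def)
    qed
    \<comment> \<open>\<open>h\<close>, evaluated at the pair of the two components, as an arrow
      over \<open>J\<close>; its weak transpose \<open>m\<close> assigns an index to each
      \<open>a\<close>.\<close>
    obtain w where w: "w \<in> hom C R B" "\<And>z. z \<in> hom C T R \<Longrightarrow> b \<cdot> (w \<cdot> z) = r1 \<cdot> z"
      "\<And>z. z \<in> hom C T R \<Longrightarrow> g \<cdot> (w \<cdot> z) = h (s z)"
      using pair[OF is_arrow_hom[OF r1] realizableD[OF h R s sM]] by blast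
    have "b \<cdot> w = r1"
      by (rule points_eqI[OF comp_hom[OF w(1) b] r1]) (simp add: assoc[OF _ w(1) b] w(2))
    from mk[OF w(1) this] obtain m k where m: "m \<in> hom C G P" "p \<cdot> m = x" and k: "k \<in> hom C R Q"
      "q1 \<cdot> k = r1" "q2 \<cdot> k = m \<cdot> r2" "v \<cdot> k = w"
      by blast
    let ?k = "\<lambda>a. code P \<cdot> (m \<cdot> a)"
    have "realizable A ?k"
      unfolding realizable_def
      using is_arrow_comp[OF _ is_arrow_comp[OF is_arrow_hom[OF m(1)] is_arrow_hom[OF code(1)[OF P]]]] by blast
    moreover have "app (?k a) c = Some (h (pr a c))" if a: "a \<in> A" and c: "c \<in> A" and ac: "pr a c \<in> M" for a c
    proof -
      \<comment> \<open>To evaluate the index of \<open>a\<close> at \<open>c\<close>, the point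
        \<open>y\<close> of \<open>J\<close> for \<open>c\<close> in \<open>fibre a\<close> is
        matched with \<open>a\<close>; this gives a point \<open>z\<close> of \<open>R\<close>,
        whose image under \<open>k\<close> is the point of \<open>Q\<close> to evaluate.\<close>
      have "(name (fibre a), c) \<in> ?W"
        using name[OF fibre] c ac by (simp add: fibre_def)
      then obtain y where y: "y \<in> hom C T J" "j y = (name (fibre a), c)"
        using j unfolding bij_betw_def by (metis (no_types, lifting) imageE)
      have "u \<cdot> y = x \<cdot> a"
        by (rule counit_inj[OF D comp_hom[OF y(1) u(1)] comp_hom[OF a x(1)]])
          (simp add: u(2)[OF y(1)] x(2)[OF a] y(2))
      then obtain z where z: "z \<in> hom C T R" "r1 \<cdot> z = y" "r2 \<cdot> z = a"
        using R_pts(2)[OF y(1) a] by blast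
      note kz = comp_hom[OF z(1) k(1)]
      have "q1 \<cdot> (k \<cdot> z) = y" "q2 \<cdot> (k \<cdot> z) = m \<cdot> a" "v \<cdot> (k \<cdot> z) = w \<cdot> z"
        using assoc[OF z(1) k(1) q1] assoc[OF z(1) k(1) q2] assoc[OF z(1) k(1) v(1)] assoc[OF z(1) r2 m(1)]
        by (simp_all add: k z)
      moreover have "s z = pr a c"
        using \<kappa>j[OF y(1)] y(2) by (simp add: s_def z)
      ultimately have "l \<cdot> (k \<cdot> z) = pr (?k a) c" "r (l \<cdot> (k \<cdot> z)) = h (pr a c)"
        using l(2)[OF kz] r_eq[OF kz] w(3)[OF z(1)] \<kappa>j[OF y(1)] y(2) by (simp_all add: e1_def e2_def)
      then show ?thesis
        using kz unfolding app_def by (metis image_eqI)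
    qed
    ultimately show "\<exists>k. realizable A k \<and> (\<forall>a\<in>A. \<forall>b\<in>A. pr a b \<in> M \<longrightarrow> app (k a) b = Some (h (pr a b)))"
      by blast
  qed
qed

lemma exists_algebra:
  obtains app where "pca A app"
    and "\<And>M f. M \<subseteq> A \<Longrightarrow> realizable M f \<longleftrightarrow> (\<exists>e\<in>A. \<forall>a\<in>M. app e a = Some (f a))"
proof -
  obtain pr where pr: "is_pairing pr"
    using pairing_exists by blast
  obtain app where app: "\<exists>f. realizable {pr a b |a b. a \<in> A \<and> b \<in> A \<and> app a b \<noteq> None} f \<and>
      (\<forall>a\<in>A. \<forall>b\<in>A. \<forall>c. app a b = Some c \<longrightarrow> f (pr a b) = c)"
    "\<And>M h. realizable M h \<Longrightarrow> M \<subseteq> A \<Longrightarrow>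
      \<exists>k. realizable A k \<and> (\<forall>a\<in>A. \<forall>b\<in>A. pr a b \<in> M \<longrightarrow> app (k a) b = Some (h (pr a b)))"
    using pr by (rule application_exists) blast
  \<comment> \<open>Elements of \<open>A\<close> are arrows out of \<open>T\<close>, so
    realizability tested at \<open>T\<close> gives the closure properties of
    \<open>A\<close>.\<close>
  have point: "is_arrow T G (\<lambda>_. a)" if "a \<in> A" for a
    using that by (rule is_arrow_const[OF T_obj])
  have point_in: "a \<in> A" if "is_arrow T G (\<lambda>_. a)" for a
    using is_arrow_point[OF that ide_hom[OF T_obj]] .
  interpret partial_function_algebra A realizable pr app
  proof
    show "A \<noteq> {}"
      using code(1)[OF T_obj] by blast
    show "f x \<in> A" if "realizable M f" "M \<subseteq> A" "x \<in> M" for M f x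
      by (rule point_in, rule realizableD[OF that(1) T_obj point]) (use that in auto)
    show "realizable M (\<lambda>x. x)" for M
      unfolding realizable_def by blast
    show "realizable M (\<lambda>_. a)" if "a \<in> A" for M a
      unfolding realizable_def using is_arrow_const that by blast
    show "realizable M (\<lambda>x. g (f x))"
      if f: "realizable M f" and g: "realizable M' g" "\<And>x. x \<in> M \<Longrightarrow> f x \<in> M'" for M M' f g
      unfolding realizable_def
    proof (intro allI impI)
      fix X h assume "is_arrow X G h" "X \<in> Obj C" "\<forall>x\<in>hom C T X. h x \<in> M"
      then show "is_arrow X G (\<lambda>x. g (f (h x)))"
        using realizableD[OF g(1) _ realizableD[OF f]] g(2) by blast
    qed
    show "realizable M g" if "realizable M f" "\<And>x. x \<in> M \<Longrightarrow> f x = g x" for M f g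
      using that by (rule realizable_cong)
    have pr_arrow: "is_arrow X G (\<lambda>x. pr (f x) (g x))" if "is_arrow X G f" "is_arrow X G g" for X f g
      using pr that unfolding is_pairing_def by blast
    show "pr a b \<in> A" if "a \<in> A" "b \<in> A" for a b
      by (rule point_in[OF pr_arrow[OF point[OF that(1)] point[OF that(2)]]])
    show "realizable M (\<lambda>x. pr (f x) (g x))" if "realizable M f" "realizable M g" for M f g
      using that pr_arrow unfolding realizable_def by blast
    show "\<exists>f. realizable {pr a b |a b. a \<in> A \<and> b \<in> A} f \<and> (\<forall>a\<in>A. \<forall>b\<in>A. f (pr a b) = a)"
      "\<exists>f. realizable {pr a b |a b. a \<in> A \<and> b \<in> A} f \<and> (\<forall>a\<in>A. \<forall>b\<in>A. f (pr a b) = b)"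
      using pr unfolding is_pairing_def by blast+
  qed (use app in auto)
  show ?thesis
    using that[OF pca R_iff_app] .
qed

text \<open>\<open>X\<close> is sent to its points with codes given by \<open>code X\<close>.
  Fullness is \<open>arrow_iff'\<close>, and essential surjectivity holds since two closed maps from
  the same object to \<open>G\<close> track each other.\<close>

lemma equivalent_to_PAsm:
  obtains app where "pca A app" "equivalent_cats C (PAsm U A app)"
proof -
  obtain app where app: "pca A app"
    and iff: "\<And>M f. M \<subseteq> A \<Longrightarrow> realizable M f \<longleftrightarrow> (\<exists>e\<in>A. \<forall>a\<in>M. app e a = Some (f a))"
    by (rule exists_algebra) blast
  interpret alg: combinatory_algebra A app
    by unfold_locales (rule app)
  let ?P = "PAsm U A app"
  have code_in: "(\<lambda>x. code X \<cdot> x) ` hom C T X \<subseteq> A" if "X \<in> Obj C" for X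
    using comp_hom[OF _ code(1)[OF that]] by blast
  \<comment> \<open>Discreteness gives tracking, through \<open>factor_closed\<close>; conversely
    application of \<open>e\<close> is realizable and can be composed with the arrow
    \<open>k\<close>. Any closed \<open>k\<close> is allowed, not just \<open>code X\<close>, for
    use in essential surjectivity.\<close>
  have arrow_iff: "is_arrow X G h \<longleftrightarrow> alg.tracked (hom C T X) (\<lambda>x. k \<cdot> x) h"
    if k: "k \<in> hom C X G" "closed k" for X k h
  proof
    have kA: "(\<lambda>x. k \<cdot> x) ` hom C T X \<subseteq> A"
      using comp_hom[OF _ k(1)] by blast
    {
      assume "is_arrow X G h"
      then obtain r where "realizable ((\<lambda>x. k \<cdot> x) ` hom C T X) r" "\<And>x. x \<in> hom C T X \<Longrightarrow> h x = r (k \<cdot> x)"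
        using k by (auto intro: factor_closed)
      then show "alg.tracked (hom C T X) (\<lambda>x. k \<cdot> x) h"
        unfolding iff[OF kA] alg.tracked_def by auto
    next
      assume "alg.tracked (hom C T X) (\<lambda>x. k \<cdot> x) h"
      then obtain e where e: "e \<in> A" "\<And>x. x \<in> hom C T X \<Longrightarrow> app e (k \<cdot> x) = Some (h x)"
        unfolding alg.tracked_def by blast
      have "realizable ((\<lambda>x. k \<cdot> x) ` hom C T X) (\<lambda>a. the (app e a))"
        unfolding iff[OF kA] using e by (intro bexI[OF _ e(1)]) auto
      from realizableD[OF this hom_obj(1)[OF k(1)] is_arrow_hom[OF k(1)]]
      have "is_arrow X G (\<lambda>x. the (app e (k \<cdot> x)))"
        by blast
      then show "is_arrow X G h"
        by (rule is_arrow_cong) (simp add: e(2))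
    }
  qed
  have arrow_iff': "is_arrow X Y h \<longleftrightarrow> alg.tracked (hom C T X) (\<lambda>x. code X \<cdot> x) (\<lambda>x. code Y \<cdot> h x)"
    if X: "X \<in> Obj C" and Y: "Y \<in> Obj C" and h: "\<And>x. x \<in> hom C T X \<Longrightarrow> h x \<in> hom C T Y" for X Y h
    unfolding arrow_iff[OF code[OF X], symmetric]
    using is_arrow_comp[OF _ is_arrow_hom[OF code(1)[OF Y]]] is_arrow_closed[OF code(2,1)[OF Y], of X h] h by blast
  define F where "F = \<lparr>FObj = (\<lambda>X. (hom C T X, restrict (\<lambda>x. code X \<cdot> x) (hom C T X))),
    FArr = (\<lambda>f. ((hom C T (Dom C f), restrict (\<lambda>x. code (Dom C f) \<cdot> x) (hom C T (Dom C f))),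
      restrict (\<lambda>x. f \<cdot> x) (hom C T (Dom C f)),
      (hom C T (Cod C f), restrict (\<lambda>x. code (Cod C f) \<cdot> x) (hom C T (Cod C f)))))\<rparr>"
  have F_obj: "FObj F X = (hom C T X, restrict (\<lambda>x. code X \<cdot> x) (hom C T X))" for X
    by (simp add: F_def)
  have F_arr: "FArr F f = (FObj F X, restrict (\<lambda>x. f \<cdot> x) (hom C T X), FObj F Y)" if "f \<in> hom C X Y" for f X Y
    using homD[OF that] by (simp add: F_def)
  have F_objP: "FObj F X \<in> Obj ?P" if "X \<in> Obj C" for X
    using points_in_U[OF that] code_in[OF that] by (auto simp: F_obj)
  have F_hom_iff: "a \<in> hom ?P (FObj F X) (FObj F Y) \<longleftrightarrow>
      (\<exists>h\<in>hom C T X \<rightarrow>\<^sub>E hom C T Y. a = (FObj F X, h, FObj F Y) \<and> is_arrow X Y h)"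
    if X: "X \<in> Obj C" and Y: "Y \<in> Obj C" for a X Y
  proof -
    have "is_arrow X Y h \<longleftrightarrow> (\<exists>e\<in>A. \<forall>i\<in>fst (FObj F X). app e (snd (FObj F X) i) = Some (snd (FObj F Y) (h i)))"
      if h: "h \<in> hom C T X \<rightarrow>\<^sub>E hom C T Y" for h
    proof -
      have h': "h x \<in> hom C T Y" if "x \<in> hom C T X" for x
        using h that by blast
      show ?thesis
        using arrow_iff'[OF X Y h'] h' by (simp add: alg.tracked_def F_obj)
    qed
    moreover have "fst (FObj F Z) = hom C T Z" for Z
      by (simp add: F_obj)
    ultimately show ?thesis
      unfolding pasm_hom_iff using F_objP[OF X] F_objP[OF Y] by metis
  qed
  have F: "is_functor C ?P F"
  proof (rule functorI)
    fix f X Y assume f: "f \<in> hom C X Y"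
    have "restrict (\<lambda>x. f \<cdot> x) (hom C T X) \<in> hom C T X \<rightarrow>\<^sub>E hom C T Y"
      using comp_hom[OF _ f] by auto
    then show "FArr F f \<in> hom ?P (FObj F X) (FObj F Y)"
      unfolding F_hom_iff[OF hom_obj(1,2)[OF f]] F_arr[OF f]
      by (intro bexI conjI refl) (auto intro: is_arrowI[OF f])
  next
    fix X assume "X \<in> Obj C"
    then show "FArr F (Ide C X) = Ide ?P (FObj F X)"
      by (auto simp: F_arr[OF ide_hom] F_obj fun_eq_iff ide_comp)
  next
    fix f g X Y Z assume f: "f \<in> hom C X Y" and g: "g \<in> hom C Y Z"
    show "FArr F (g \<cdot> f) = FArr F g \<cdot>\<^bsub>?P\<^esub> FArr F f"
      by (auto simp: F_arr[OF f] F_arr[OF g] F_arr[OF comp_hom[OF f g]] F_obj compose_def fun_eq_iff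
          assoc[OF _ f g] comp_hom[OF _ f])
  qed (rule is_cat alg.is_category_PAsm F_objP, assumption?)+
  have "equivalent_cats C ?P"
  proof (rule equivalence_of_fully_faithful[OF F])
    fix X Y assume X: "X \<in> Obj C" and Y: "Y \<in> Obj C"
    show "bij_betw (FArr F) (hom C X Y) (hom ?P (FObj F X) (FObj F Y))"
    proof (rule bij_betwI')
      fix f g assume f: "f \<in> hom C X Y" and g: "g \<in> hom C X Y"
      show "FArr F f = FArr F g \<longleftrightarrow> f = g"
      proof
        assume "FArr F f = FArr F g"
        then have "restrict (\<lambda>x. f \<cdot> x) (hom C T X) x = restrict (\<lambda>x. g \<cdot> x) (hom C T X) x" for x
          by (simp add: F_arr[OF f] F_arr[OF g])
        then show "f = g"
          by (intro points_eqI[OF f g]) (metis restrict_apply')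
      qed simp
    next
      fix a assume "a \<in> hom ?P (FObj F X) (FObj F Y)"
      then obtain h where h: "h \<in> hom C T X \<rightarrow>\<^sub>E hom C T Y" "a = (FObj F X, h, FObj F Y)" "is_arrow X Y h"
        unfolding F_hom_iff[OF X Y] by blast
      obtain f where f: "f \<in> hom C X Y" "\<And>x. x \<in> hom C T X \<Longrightarrow> f \<cdot> x = h x"
        using h(3) by (rule is_arrowE) blast
      have "restrict (\<lambda>x. f \<cdot> x) (hom C T X) = h"
        using h(1) f(2) by (auto simp: fun_eq_iff PiE_iff extensional_def)
      then show "\<exists>f\<in>hom C X Y. a = FArr F f"
        using f(1) h(2) F_arr by metis
    qed (rule functor_hom[OF F])
  next
    fix Y assume "Y \<in> Obj ?P"
    then obtain S \<phi> where Y: "Y = (S, \<phi>)" and S: "S \<in> U" and \<phi>: "\<phi> \<in> S \<rightarrow>\<^sub>E A"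
      by auto
    obtain X k j where X: "X \<in> Obj C" and k: "k \<in> hom C X G" "closed k" and j: "bij_betw j (hom C T X) S"
      and kj: "\<And>x. x \<in> hom C T X \<Longrightarrow> k \<cdot> x = \<phi> (j x)"
      by (rule assembly_in_U_exists[OF S, of \<phi>]) (use \<phi> in auto)
    define i where "i = inv_into (hom C T X) j"
    have i: "i s \<in> hom C T X" "j (i s) = s" if "s \<in> S" for s
      using that j unfolding i_def by (auto simp: bij_betw_def inv_into_into f_inv_into_f)
    have ij: "i (j x) = x" if "x \<in> hom C T X" for x
      using that j unfolding i_def by (simp add: bij_betw_def)
    have j_in: "j x \<in> S" if "x \<in> hom C T X" for x
      using bij_betwE[OF j] that by blast
    \<comment> \<open>\<open>k\<close> and \<open>code X\<close> are both closed arrows from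
      \<open>X\<close> to \<open>G\<close>, so each is tracked from the other. This makes the
      bijection \<open>j\<close> an isomorphism of assemblies.\<close>
    have t1: "alg.tracked (hom C T X) (\<lambda>x. code X \<cdot> x) (\<lambda>x. k \<cdot> x)"
      using arrow_iff[OF code[OF X]] is_arrow_hom[OF k(1)] by blast
    have t2: "alg.tracked S (\<lambda>s. k \<cdot> i s) (\<lambda>s. code X \<cdot> i s)"
    proof (rule alg.tracked_reindex[where h = i])
      show "alg.tracked (hom C T X) (\<lambda>x. k \<cdot> x) (\<lambda>x. code X \<cdot> x)"
        using arrow_iff[OF k] is_arrow_hom[OF code(1)[OF X]] by blast
    qed (rule i(1))
    let ?f = "(FObj F X, restrict j (hom C T X), Y)" and ?g = "(Y, restrict i S, FObj F X)"
    have YP: "Y \<in> Obj ?P"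
      using Y S \<phi> by auto
    have f: "?f \<in> hom ?P (FObj F X) Y"
    proof -
      have "\<exists>e\<in>A. \<forall>i\<in>fst (FObj F X). app e (snd (FObj F X) i) = Some (snd Y (restrict j (hom C T X) i))"
        using t1 unfolding alg.tracked_def by (simp add: F_obj Y kj)
      moreover have "restrict j (hom C T X) \<in> fst (FObj F X) \<rightarrow>\<^sub>E fst Y"
        using j_in by (auto simp: F_obj Y)
      ultimately show ?thesis
        unfolding pasm_hom_iff using F_objP[OF X] YP by blast
    qed
    have g: "?g \<in> hom ?P Y (FObj F X)"
    proof -
      have "\<exists>e\<in>A. \<forall>s\<in>fst Y. app e (snd Y s) = Some (snd (FObj F X) (restrict i S s))"
        using t2 i unfolding alg.tracked_def by (simp add: F_obj Y kj)
      moreover have "restrict i S \<in> fst Y \<rightarrow>\<^sub>E fst (FObj F X)"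
        using i by (auto simp: F_obj Y)
      ultimately show ?thesis
        unfolding pasm_hom_iff using F_objP[OF X] YP by blast
    qed
    interpret P: cat ?P
      by unfold_locales (rule alg.is_category_PAsm)
    have "is_iso ?P ?f"
    proof (rule P.isoI[OF f g])
      show "?g \<cdot>\<^bsub>?P\<^esub> ?f = Ide ?P (FObj F X)"
        using ij j_in by (auto simp: F_obj compose_def fun_eq_iff)
      show "?f \<cdot>\<^bsub>?P\<^esub> ?g = Ide ?P Y"
        using i by (auto simp: Y compose_def fun_eq_iff)
    qed
    then show "\<exists>X\<in>Obj C. \<exists>f\<in>hom ?P (FObj F X) Y. is_iso ?P f"
      using X f by blast
  qed
  then show ?thesis
    by (rule that[OF app])
qed

end

section \<open>Categories equivalent to partitioned assemblies\<close>

lemma (in combinatory_algebra) nonempty: "A \<noteq> {}"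
  using abstraction1[of "Var 0"] by auto

text \<open>Products of finitely many copies of \<open>A\<close> inside \<open>A\<close>, by
  iterated pairing: \<Phi> codes a family and has the usual projections and tupling. The quantifier
  over \<open>W\<close> sits inside the statement so that one \<Phi> serves all sets of that
  type.\<close>

lemma (in combinatory_algebra) finite_tupling:
  fixes I :: "'i set"
  assumes "finite I"
  shows "\<exists>\<Phi>. (\<forall>a\<in>I \<rightarrow>\<^sub>E A. \<Phi> a \<in> A) \<and> (\<forall>i\<in>I. tracked (I \<rightarrow>\<^sub>E A) \<Phi> (\<lambda>a. a i)) \<and>
    (\<forall>(W :: 'w set) f g. (\<forall>w\<in>W. f w \<in> A) \<longrightarrow> (\<forall>i\<in>I. tracked W f (g i)) \<longrightarrow>
      tracked W f (\<lambda>w. \<Phi> (\<lambda>i\<in>I. g i w)))"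
  using assms
proof (induction I)
  case empty
  obtain a where "a \<in> A"
    using nonempty by blast
  then show ?case
    by (intro exI[of _ "\<lambda>_. a"]) (auto intro: tracked_const)
next
  case (insert k I)
  then obtain \<Phi> where "\<forall>a\<in>I \<rightarrow>\<^sub>E A. \<Phi> a \<in> A" "\<forall>i\<in>I. tracked (I \<rightarrow>\<^sub>E A) \<Phi> (\<lambda>a. a i)"
    and "\<forall>(W :: 'w set) f g. (\<forall>w\<in>W. f w \<in> A) \<longrightarrow> (\<forall>i\<in>I. tracked W f (g i)) \<longrightarrow>
      tracked W f (\<lambda>w. \<Phi> (\<lambda>i\<in>I. g i w))"
    by (elim exE conjE)
  note \<Phi> = this(1,2)[rule_format] and tup = this(3)[rule_format]
  let ?\<Psi> = "\<lambda>a. pr (a k) (\<Phi> (restrict a I))"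
  have in_A: "a k \<in> A" "\<Phi> (restrict a I) \<in> A" "restrict a I \<in> I \<rightarrow>\<^sub>E A" if "a \<in> insert k I \<rightarrow>\<^sub>E A" for a
    using that by (auto intro!: \<Phi>(1))
  have pr_A: "?\<Psi> a \<in> A" if "a \<in> insert k I \<rightarrow>\<^sub>E A" for a
    using pr_in in_A[OF that] by blast
  have fst: "tracked (insert k I \<rightarrow>\<^sub>E A) ?\<Psi> (\<lambda>a. a k)"
    and snd: "tracked (insert k I \<rightarrow>\<^sub>E A) ?\<Psi> (\<lambda>a. \<Phi> (restrict a I))"
    using in_A by (auto intro: tracked_fst tracked_snd)
  have component: "tracked (insert k I \<rightarrow>\<^sub>E A) ?\<Psi> (\<lambda>a. a i)" if i: "i \<in> insert k I" for i
  proof (cases "i = k")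
    case False
    with i have i: "i \<in> I" by simp
    have "tracked (insert k I \<rightarrow>\<^sub>E A) (\<lambda>a. \<Phi> (restrict a I)) (\<lambda>a. restrict a I i)"
      using \<Phi>(2)[OF i] by (rule tracked_reindex) (rule in_A(3))
    from tracked_trans[OF pr_A snd this] show ?thesis
      using i by simp
  qed (simp add: fst)
  have tupling: "tracked W f (\<lambda>w. ?\<Psi> (\<lambda>i\<in>insert k I. g i w))"
    if f: "\<And>w. w \<in> W \<Longrightarrow> f w \<in> A" and g: "\<And>i. i \<in> insert k I \<Longrightarrow> tracked W f (g i)"
    for W :: "'w set" and f g
  proof -
    have "tracked W f (\<lambda>w. \<Phi> (\<lambda>i\<in>I. g i w))"
      by (rule tup) (simp_all add: f g)
    moreover have "restrict (\<lambda>i\<in>insert k I. g i w) I = (\<lambda>i\<in>I. g i w)" for w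
      by (auto simp: fun_eq_iff)
    ultimately show ?thesis
      using tracked_pr[OF f g[of k]] by simp
  qed
  show ?case
    by (intro exI[of _ ?\<Psi>] conjI ballI allI impI pr_A component tupling) auto
qed

text \<open>What an equivalence with \<open>PAsm\<close> leaves on \<open>C\<close> itself:
  \<open>fn_eqI\<close> is faithfulness, \<open>fn_tracked\<close> and \<open>fn_full\<close>
  describe the image on arrows, \<open>realize\<close> is essential surjectivity. Working with these
  avoids transporting limits, adjoint and dependent products along the equivalence.\<close>

locale assembly_presentation = grothendieck_universe U + combinatory_algebra A app + cat C
  for U :: "'u set set" and A :: "'u set" and app and C :: "('o, 'u) category" (structure) +
  fixes pts :: "'o \<Rightarrow> 'u set" and ph :: "'o \<Rightarrow> 'u \<Rightarrow> 'u" and fn :: "'u \<Rightarrow> 'u \<Rightarrow> 'u"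
  assumes A_in_U: "A \<in> U"
    and pts_in_U: "X \<in> Obj C \<Longrightarrow> pts X \<in> U"
    and ph_in: "X \<in> Obj C \<Longrightarrow> x \<in> pts X \<Longrightarrow> ph X x \<in> A"
    and fn_in: "f \<in> hom C X Y \<Longrightarrow> x \<in> pts X \<Longrightarrow> fn f x \<in> pts Y"
    and fn_comp: "f \<in> hom C X Y \<Longrightarrow> g \<in> hom C Y Z \<Longrightarrow> x \<in> pts X \<Longrightarrow> fn (g \<cdot> f) x = fn g (fn f x)"
    and fn_ide: "X \<in> Obj C \<Longrightarrow> x \<in> pts X \<Longrightarrow> fn (Ide C X) x = x"
    and fn_eqI: "f \<in> hom C X Y \<Longrightarrow> g \<in> hom C X Y \<Longrightarrow> (\<And>x. x \<in> pts X \<Longrightarrow> fn f x = fn g x) \<Longrightarrow> f = g"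
    and fn_tracked: "f \<in> hom C X Y \<Longrightarrow> tracked (pts X) (ph X) (\<lambda>x. ph Y (fn f x))"
    and fn_full: "X \<in> Obj C \<Longrightarrow> Y \<in> Obj C \<Longrightarrow> (\<And>x. x \<in> pts X \<Longrightarrow> h x \<in> pts Y) \<Longrightarrow>
      tracked (pts X) (ph X) (\<lambda>x. ph Y (h x)) \<Longrightarrow> \<exists>f\<in>hom C X Y. \<forall>x\<in>pts X. fn f x = h x"
    and realize: "W \<in> U \<Longrightarrow> (\<And>w. w \<in> W \<Longrightarrow> \<phi> w \<in> A) \<Longrightarrow> \<exists>X\<in>Obj C. \<exists>j. bij_betw j (pts X) W \<and>
      tracked (pts X) (ph X) (\<lambda>x. \<phi> (j x)) \<and> tracked (pts X) (\<lambda>x. \<phi> (j x)) (ph X)"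
begin

text \<open>\<open>X\<close> is isomorphic to the assembly of \<open>W\<close> with codes \<phi>;
  \<open>l\<close> labels the points and \<open>i\<close> is its inverse. Codes are only required to
  track each other, and \<open>W\<close> may have any type.\<close>

definition represents :: "'o \<Rightarrow> 'w set \<Rightarrow> ('w \<Rightarrow> 'u) \<Rightarrow> ('w \<Rightarrow> 'u) \<Rightarrow> ('u \<Rightarrow> 'w) \<Rightarrow> bool" where
  "represents X W \<phi> i l \<longleftrightarrow> X \<in> Obj C \<and>
     (\<forall>x\<in>pts X. l x \<in> W \<and> i (l x) = x) \<and> (\<forall>w\<in>W. i w \<in> pts X \<and> l (i w) = w) \<and>
     tracked (pts X) (ph X) (\<lambda>x. \<phi> (l x)) \<and> tracked W \<phi> (\<lambda>w. ph X (i w))"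

lemma representsD:
  assumes "represents X W \<phi> i l"
  shows "X \<in> Obj C" "\<And>x. x \<in> pts X \<Longrightarrow> l x \<in> W" "\<And>x. x \<in> pts X \<Longrightarrow> i (l x) = x"
    "\<And>w. w \<in> W \<Longrightarrow> i w \<in> pts X" "\<And>w. w \<in> W \<Longrightarrow> l (i w) = w"
    "tracked (pts X) (ph X) (\<lambda>x. \<phi> (l x))" "tracked W \<phi> (\<lambda>w. ph X (i w))"
  using assms unfolding represents_def by auto

lemma object_of_assembly:
  assumes "small W" and \<phi>: "\<And>w. w \<in> W \<Longrightarrow> \<phi> w \<in> A"
  shows "\<exists>X i l. represents X W \<phi> i l"
proof -
  obtain S c where S: "S \<in> U" and c: "bij_betw c S W"
    using assms(1) by (rule small_code)
  obtain X j where X: "X \<in> Obj C" and j: "bij_betw j (pts X) S"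
    and t: "tracked (pts X) (ph X) (\<lambda>x. \<phi> (c (j x)))" "tracked (pts X) (\<lambda>x. \<phi> (c (j x))) (ph X)"
    using realize[OF S, of "\<lambda>s. \<phi> (c s)"] \<phi> bij_betwE[OF c] by blast
  define l where "l x = c (j x)" for x
  have l: "bij_betw l (pts X) W"
    using bij_betw_trans[OF j c] by (simp add: l_def[abs_def] comp_def)
  define i where "i = inv_into (pts X) l"
  have i: "i w \<in> pts X" "l (i w) = w" if "w \<in> W" for w
    using that l unfolding i_def by (auto simp: bij_betw_def inv_into_into f_inv_into_f)
  have il: "l x \<in> W" "i (l x) = x" if "x \<in> pts X" for x
    using that l bij_betwE[OF l] unfolding i_def by (auto simp: bij_betw_def)
  have "tracked W (\<lambda>w. \<phi> (l (i w))) (\<lambda>w. ph X (i w))"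
    using t(2)[folded l_def] by (rule tracked_reindex) (rule i(1))
  then have "tracked W \<phi> (\<lambda>w. ph X (i w))"
    by (rule tracked_cong) (simp_all add: i)
  then have "represents X W \<phi> i l"
    unfolding represents_def using X i il t(1) by (simp add: l_def)
  then show ?thesis
    by blast
qed

text \<open>As in sets: compatible families, coded by the tuple of the codes of their components.
  Projections are then tracked by untupling and mediating arrows by tupling.\<close>

lemma finite_limits: "has_finite_limits C"
  unfolding has_finite_limits_def
proof (intro allI impI)
  fix J :: "(nat, nat) category" and D
  assume "finite (Obj J) \<and> finite (Arr J) \<and> is_functor J C D"
  then have fin: "finite (Obj J)" and D: "is_functor J C D"
    by auto
  interpret J: cat J
    by unfold_locales (rule functor_cats[OF D])
  note D_obj = functor_obj[OF D]
  have D_hom: "FArr D k \<in> hom C (FObj D (Dom J k)) (FObj D (Cod J k))" if "k \<in> Arr J" for k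
    using functor_hom[OF D J.arr_hom[OF that]] .
  define Fam where "Fam = {x \<in> PiE (Obj J) (\<lambda>j. pts (FObj D j)).
    \<forall>k\<in>Arr J. fn (FArr D k) (x (Dom J k)) = x (Cod J k)}"
  have small_Fam: "small Fam"
    by (rule small_subset[OF small_finite_PiE[OF fin]])
      (use pts_in_U[OF D_obj] small_member Fam_def in auto)
  obtain \<Phi> where "\<forall>a\<in>Obj J \<rightarrow>\<^sub>E A. \<Phi> a \<in> A" "\<forall>j\<in>Obj J. tracked (Obj J \<rightarrow>\<^sub>E A) \<Phi> (\<lambda>a. a j)"
    and "\<forall>(W :: 'u set) f g. (\<forall>w\<in>W. f w \<in> A) \<longrightarrow> (\<forall>j\<in>Obj J. tracked W f (g j)) \<longrightarrow>
      tracked W f (\<lambda>w. \<Phi> (\<lambda>j\<in>Obj J. g j w))"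
    using finite_tupling[OF fin] by (elim exE conjE)
  note \<Phi> = this(1,2)[rule_format] and tup = this(3)[rule_format]
  define tag where "tag x = (\<lambda>j\<in>Obj J. ph (FObj D j) (x j))" for x
  have tag: "tag x \<in> Obj J \<rightarrow>\<^sub>E A" if "x \<in> Fam" for x
    using that ph_in[OF D_obj] by (auto simp: tag_def Fam_def)
  obtain L i l where rep: "represents L Fam (\<lambda>x. \<Phi> (tag x)) i l"
    using object_of_assembly[OF small_Fam, of "\<lambda>x. \<Phi> (tag x)"] \<Phi>(1)[OF tag] by blast
  note L = representsD(1)[OF rep] and l = representsD(2,3)[OF rep] and i = representsD(4,5)[OF rep]
    and t = representsD(6,7)[OF rep]
  have "\<exists>p\<in>hom C L (FObj D j). \<forall>x\<in>pts L. fn p x = l x j" if j: "j \<in> Obj J" for j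
  proof (rule fn_full[OF L D_obj[OF j]])
    show "l x j \<in> pts (FObj D j)" if "x \<in> pts L" for x
      using l(1)[OF that] j by (auto simp: Fam_def)
    have "tracked (pts L) (\<lambda>x. \<Phi> (tag (l x))) (\<lambda>x. tag (l x) j)"
      using \<Phi>(2)[OF j] by (rule tracked_reindex) (rule tag[OF l(1)])
    from tracked_trans[OF ph_in[OF L] t(1) this]
    show "tracked (pts L) (ph L) (\<lambda>x. ph (FObj D j) (l x j))"
      using j by (simp add: tag_def)
  qed
  then obtain \<pi> where \<pi>: "\<And>j. j \<in> Obj J \<Longrightarrow> \<pi> j \<in> hom C L (FObj D j)"
    "\<And>j x. j \<in> Obj J \<Longrightarrow> x \<in> pts L \<Longrightarrow> fn (\<pi> j) x = l x j"
    by metis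
  have "is_limit C J D L \<pi>"
    unfolding is_limit_def
  proof (intro conjI allI impI)
    have "FArr D k \<cdot> \<pi> (Dom J k) = \<pi> (Cod J k)" if k: "k \<in> Arr J" for k
    proof (rule fn_eqI[OF comp_hom[OF \<pi>(1) D_hom[OF k]] \<pi>(1)])
      fix x assume x: "x \<in> pts L"
      show "fn (FArr D k \<cdot> \<pi> (Dom J k)) x = fn (\<pi> (Cod J k)) x"
        using l(1)[OF x] k J.arr_obj[OF k] x
        by (simp add: fn_comp[OF \<pi>(1) D_hom[OF k]] \<pi>(2) Fam_def)
    qed (use J.arr_obj[OF k] in auto)
    then show "is_cone C J D L \<pi>"
      unfolding is_cone_def using L \<pi>(1) by blast
  next
    fix M \<mu> assume "is_cone C J D M \<mu>"
    then have M: "M \<in> Obj C" and \<mu>: "\<And>j. j \<in> Obj J \<Longrightarrow> \<mu> j \<in> hom C M (FObj D j)"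
      and comm: "\<And>k. k \<in> Arr J \<Longrightarrow> FArr D k \<cdot> \<mu> (Dom J k) = \<mu> (Cod J k)"
      unfolding is_cone_def by auto
    define fam where "fam m = (\<lambda>j\<in>Obj J. fn (\<mu> j) m)" for m
    have fam: "fam m \<in> Fam" if m: "m \<in> pts M" for m
      unfolding Fam_def
    proof (intro CollectI conjI ballI)
      show "fam m \<in> PiE (Obj J) (\<lambda>j. pts (FObj D j))"
        using fn_in[OF \<mu> m] by (simp add: fam_def)
      fix k assume k: "k \<in> Arr J"
      then show "fn (FArr D k) (fam m (Dom J k)) = fam m (Cod J k)"
        using fn_comp[OF \<mu> D_hom[OF k] m] J.arr_obj[OF k] comm[OF k] by (simp add: fam_def)
    qed
    obtain h where h: "h \<in> hom C M L" "\<And>m. m \<in> pts M \<Longrightarrow> fn h m = i (fam m)"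
    proof -
      have "tracked (pts M) (ph M) (\<lambda>m. \<Phi> (tag (fam m)))"
        using tup[OF ph_in[OF M] fn_tracked[OF \<mu>]] by (simp add: tag_def fam_def cong: restrict_cong)
      moreover have "tracked (pts M) (\<lambda>m. \<Phi> (tag (fam m))) (\<lambda>m. ph L (i (fam m)))"
        using t(2) by (rule tracked_reindex) (rule fam)
      ultimately have "tracked (pts M) (ph M) (\<lambda>m. ph L (i (fam m)))"
        by (rule tracked_trans[rotated]) (rule ph_in[OF M])
      from fn_full[OF M L i(1)[OF fam] this] show ?thesis
        using that by blast
    qed
    show "\<exists>!h. h \<in> hom C M L \<and> (\<forall>j\<in>Obj J. \<pi> j \<cdot> h = \<mu> j)"
    proof (intro ex1I[of _ h] conjI ballI h(1))
      fix j assume j: "j \<in> Obj J"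
      show "\<pi> j \<cdot> h = \<mu> j"
      proof (rule fn_eqI[OF comp_hom[OF h(1) \<pi>(1)[OF j]] \<mu>[OF j]])
        fix m assume m: "m \<in> pts M"
        show "fn (\<pi> j \<cdot> h) m = fn (\<mu> j) m"
          using \<pi>(2)[OF j fn_in[OF h(1) m]] i(2)[OF fam[OF m]] j
          by (simp add: fn_comp[OF h(1) \<pi>(1)[OF j] m] h(2)[OF m] fam_def)
      qed
    next
      fix h' assume h': "h' \<in> hom C M L \<and> (\<forall>j\<in>Obj J. \<pi> j \<cdot> h' = \<mu> j)"
      then have h'M: "h' \<in> hom C M L" by blast
      show "h' = h"
      proof (rule fn_eqI[OF h'M h(1)])
        fix m assume m: "m \<in> pts M"
        have "l (fn h' m) = fam m"
        proof (rule PiE_ext)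
          show "l (fn h' m) \<in> PiE (Obj J) (\<lambda>j. pts (FObj D j))" "fam m \<in> PiE (Obj J) (\<lambda>j. pts (FObj D j))"
            using l(1)[OF fn_in[OF h'M m]] fam[OF m] by (auto simp: Fam_def)
          fix j assume j: "j \<in> Obj J"
          show "l (fn h' m) j = fam m j"
            using fn_comp[OF h'M \<pi>(1)[OF j] m] \<pi>(2)[OF j fn_in[OF h'M m]] h' j by (simp add: fam_def)
        qed
        then show "fn h' m = fn h m"
          using l(2)[OF fn_in[OF h'M m]] h(2)[OF m] by simp
      qed
    qed
  qed
  then show "\<exists>L \<pi>. is_limit C J D L \<pi>"
    by blast
qed

text \<open>The weak dependent product has to work for arbitrary pullback squares, so a given
  \<open>R\<close> is compared with the assembly \<open>V\<close> of matching pairs coded by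
  \<open>pr\<close>. The comparison yields the last clause: a code of a point of \<open>R\<close>
  can be computed from the codes of its two projections.\<close>

lemma pullback_points:
  assumes pb: "is_pullback C p q f g" and p: "p \<in> hom C R X" and q: "q \<in> hom C R Y"
    and f: "f \<in> hom C X Z" and g: "g \<in> hom C Y Z"
  obtains s where
    "\<And>x y. x \<in> pts X \<Longrightarrow> y \<in> pts Y \<Longrightarrow> fn f x = fn g y \<Longrightarrow> s x y \<in> pts R \<and> fn p (s x y) = x \<and> fn q (s x y) = y"
    "\<And>r. r \<in> pts R \<Longrightarrow> s (fn p r) (fn q r) = r"
    "tracked {(x, y). x \<in> pts X \<and> y \<in> pts Y \<and> fn f x = fn g y} (\<lambda>(x, y). pr (ph X x) (ph Y y))
      (\<lambda>(x, y). ph R (s x y))"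
proof -
  have X: "X \<in> Obj C" and Y: "Y \<in> Obj C" and R: "R \<in> Obj C"
    using hom_obj p q by auto
  define W where "W = {(x, y). x \<in> pts X \<and> y \<in> pts Y \<and> fn f x = fn g y}"
  define \<phi> where "\<phi> = (\<lambda>(x, y). pr (ph X x) (ph Y y))"
  have "small W"
    by (rule small_subset[OF small_Times[OF small_member[OF pts_in_U[OF X]] small_member[OF pts_in_U[OF Y]]]]) (auto simp: W_def)
  have W\<phi>: "\<phi> w \<in> A" if "w \<in> W" for w
    using that ph_in[OF X] ph_in[OF Y] by (auto simp: W_def \<phi>_def intro: pr_in)
  obtain V i l where rep: "represents V W \<phi> i l"
    using object_of_assembly[OF \<open>small W\<close>, of \<phi>] W\<phi> by blast
  note V = representsD(1)[OF rep] and l = representsD(2,3)[OF rep] and i = representsD(4,5)[OF rep]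
    and t = representsD(6,7)[OF rep]
  have fst: "tracked W \<phi> (\<lambda>w. ph X (fst w))" and snd: "tracked W \<phi> (\<lambda>w. ph Y (snd w))"
    using tracked_fst[of W "\<lambda>w. ph X (fst w)" "\<lambda>w. ph Y (snd w)"]
      tracked_snd[of W "\<lambda>w. ph X (fst w)" "\<lambda>w. ph Y (snd w)"] ph_in[OF X] ph_in[OF Y]
    by (auto simp: W_def \<phi>_def case_prod_unfold)
  have l': "fst (l x) \<in> pts X" "snd (l x) \<in> pts Y" "fn f (fst (l x)) = fn g (snd (l x))" if "x \<in> pts V" for x
    using l(1)[OF that] by (auto simp: W_def)
  obtain a where a: "a \<in> hom C V X" "\<And>x. x \<in> pts V \<Longrightarrow> fn a x = fst (l x)"
  proof -
    have "\<exists>a\<in>hom C V X. \<forall>x\<in>pts V. fn a x = fst (l x)"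
      by (rule fn_full[OF V X l'(1) tracked_trans[OF ph_in[OF V] t(1) tracked_reindex[OF fst l(1)]]])
    then show ?thesis
      using that by blast
  qed
  obtain b where b: "b \<in> hom C V Y" "\<And>x. x \<in> pts V \<Longrightarrow> fn b x = snd (l x)"
  proof -
    have "\<exists>b\<in>hom C V Y. \<forall>x\<in>pts V. fn b x = snd (l x)"
      by (rule fn_full[OF V Y l'(2) tracked_trans[OF ph_in[OF V] t(1) tracked_reindex[OF snd l(1)]]])
    then show ?thesis
      using that by blast
  qed
  have "f \<cdot> a = g \<cdot> b"
    by (rule fn_eqI[OF comp_hom[OF a(1) f] comp_hom[OF b(1) g]])
      (simp add: fn_comp[OF a(1) f] fn_comp[OF b(1) g] a(2) b(2) l'(3))
  from pullback_ex1[OF pb p q a(1) b(1) this]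
  obtain h where h: "h \<in> hom C V R" "p \<cdot> h = a" "q \<cdot> h = b"
    by blast
  have pq: "(fn p r, fn q r) \<in> W" if r: "r \<in> pts R" for r
    using fn_in[OF p r] fn_in[OF q r] fn_comp[OF p f r] fn_comp[OF q g r] pullback_comm[OF pb] by (simp add: W_def)
  obtain k where k: "k \<in> hom C R V" "\<And>r. r \<in> pts R \<Longrightarrow> fn k r = i (fn p r, fn q r)"
  proof -
    have "tracked (pts R) (ph R) (\<lambda>r. \<phi> (fn p r, fn q r))"
      using tracked_pr[OF ph_in[OF R] fn_tracked[OF p] fn_tracked[OF q]] by (simp add: \<phi>_def)
    from tracked_trans[OF ph_in[OF R] this tracked_reindex[OF t(2) pq]]
    have "\<exists>k\<in>hom C R V. \<forall>r\<in>pts R. fn k r = i (fn p r, fn q r)"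
      by (intro fn_full[OF R V i(1)[OF pq]])
    then show ?thesis
      using that by blast
  qed
  \<comment> \<open>Both sides have the same components after \<open>p\<close> and \<open>q\<close>,
    so uniqueness in the pullback identifies them.\<close>
  have hk: "h \<cdot> k = Ide C R"
  proof -
    note hkR = comp_hom[OF k(1) h(1)]
    have "p \<cdot> (h \<cdot> k) = p"
    proof (rule fn_eqI[OF comp_hom[OF hkR p] p])
      fix r assume r: "r \<in> pts R"
      have "p \<cdot> (h \<cdot> k) = a \<cdot> k"
        using assoc[OF k(1) h(1) p] h(2) by simp
      then show "fn (p \<cdot> (h \<cdot> k)) r = fn p r"
        using a(2)[OF fn_in[OF k(1) r]] i(2)[OF pq[OF r]] k(2)[OF r] fn_comp[OF k(1) a(1) r] by simp
    qed
    moreover have "q \<cdot> (h \<cdot> k) = q"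
    proof (rule fn_eqI[OF comp_hom[OF hkR q] q])
      fix r assume r: "r \<in> pts R"
      have "q \<cdot> (h \<cdot> k) = b \<cdot> k"
        using assoc[OF k(1) h(1) q] h(3) by simp
      then show "fn (q \<cdot> (h \<cdot> k)) r = fn q r"
        using b(2)[OF fn_in[OF k(1) r]] i(2)[OF pq[OF r]] k(2)[OF r] fn_comp[OF k(1) b(1) r] by simp
    qed
    ultimately show ?thesis
      using pullback_ex1[OF pb p q p q pullback_comm[OF pb]] hkR ide_hom[OF R] comp_ide[OF p] comp_ide[OF q]
      by blast
  qed
  show ?thesis
  proof (rule that[of "\<lambda>x y. fn h (i (x, y))"])
    fix x y assume xy: "x \<in> pts X" "y \<in> pts Y" "fn f x = fn g y"
    then have w: "(x, y) \<in> W"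
      by (simp add: W_def)
    show "fn h (i (x, y)) \<in> pts R \<and> fn p (fn h (i (x, y))) = x \<and> fn q (fn h (i (x, y))) = y"
      using fn_in[OF h(1) i(1)[OF w]] fn_comp[OF h(1) p i(1)[OF w]] fn_comp[OF h(1) q i(1)[OF w]]
        a(2)[OF i(1)[OF w]] b(2)[OF i(1)[OF w]] i(2)[OF w] h(2,3) by simp
  next
    fix r assume r: "r \<in> pts R"
    show "fn h (i (fn p r, fn q r)) = r"
      using fn_comp[OF k(1) h(1) r] k(2)[OF r] hk fn_ide[OF R r] by simp
  next
    have "tracked W (\<lambda>w. ph V (i w)) (\<lambda>w. ph R (fn h (i w)))"
      by (rule tracked_reindex[OF fn_tracked[OF h(1)] i(1)])
    from tracked_trans[OF W\<phi> t(2) this]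
    show "tracked {(x, y). x \<in> pts X \<and> y \<in> pts Y \<and> fn f x = fn g y}
        (\<lambda>(x, y). pr (ph X x) (ph Y y)) (\<lambda>(x, y). ph R (fn h (i (x, y))))"
      by (simp add: case_prod_unfold W_def \<phi>_def)
  qed
qed

text \<open>
  The weak dependent product of \<open>b\<close> along \<open>u\<close> consists of a point \<open>i\<close> of \<open>I\<close>, a section of \<open>b\<close> over
  the fibre of \<open>u\<close> at \<open>i\<close>, and an element of \<open>A\<close> tracking that section.  Outside the fibre the
  section takes the junk value \<open>undefined\<close>.
\<close>

lemma weak_dependent_product:
  assumes b: "b \<in> hom C B J" and u: "u \<in> hom C J I"
  shows "\<exists>P. \<exists>p\<in>hom C P I. \<forall>Q. \<forall>q1\<in>hom C Q J. \<forall>q2\<in>hom C Q P. is_pullback C q1 q2 u p \<longrightarrow>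
    (\<exists>v\<in>hom C Q B. b \<cdot> v = q1 \<and> (\<forall>X. \<forall>x\<in>hom C X I. \<forall>R. \<forall>r1\<in>hom C R J. \<forall>r2\<in>hom C R X.
       is_pullback C r1 r2 u x \<longrightarrow> (\<forall>w\<in>hom C R B. b \<cdot> w = r1 \<longrightarrow>
         (\<exists>m\<in>hom C X P. p \<cdot> m = x \<and>
           (\<forall>k\<in>hom C R Q. q1 \<cdot> k = r1 \<and> q2 \<cdot> k = m \<cdot> r2 \<longrightarrow> v \<cdot> k = w)))))"
proof -
  have B: "B \<in> Obj C" and J: "J \<in> Obj C" and I: "I \<in> Obj C"
    using hom_obj b u by auto
  define W where "W = {(i, e, s). i \<in> pts I \<and> e \<in> A \<and> s \<in> pts J \<rightarrow>\<^sub>E insert undefined (pts B) \<and>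
    (\<forall>j\<in>pts J. fn u j = i \<longrightarrow> s j \<in> pts B \<and> fn b (s j) = j \<and> app e (ph J j) = Some (ph B (s j)))}"
  \<comment> \<open>The section itself is not coded: the code remembers only its tracker
    \<open>e\<close> and the base point.\<close>
  define \<phi> :: "'u \<times> 'u \<times> ('u \<Rightarrow> 'u) \<Rightarrow> 'u" where "\<phi> = (\<lambda>(i, e, s). pr (ph I i) e)"
  have "small W"
  proof -
    have "small (insert undefined (pts B))"
      by (rule small_insert[OF small_member[OF pts_in_U[OF B]]])
    then have "small (pts I \<times> A \<times> (pts J \<rightarrow>\<^sub>E insert undefined (pts B)))"
      by (intro small_Times small_PiE small_member[OF A_in_U] small_member[OF pts_in_U[OF I]]
          small_member[OF pts_in_U[OF J]])
    then show ?thesis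
      by (rule small_subset) (auto simp: W_def)
  qed
  have W\<phi>: "\<phi> w \<in> A" if "w \<in> W" for w
    using that ph_in[OF I] by (auto simp: W_def \<phi>_def intro: pr_in)
  obtain P i l where rep: "represents P W \<phi> i l"
    using object_of_assembly[OF \<open>small W\<close>, of \<phi>] W\<phi> by blast
  note P = representsD(1)[OF rep] and l = representsD(2,3)[OF rep] and i = representsD(4,5)[OF rep]
    and t = representsD(6,7)[OF rep]
  define base where "base x = fst (l x)" for x
  define index where "index x = fst (snd (l x))" for x
  define sec where "sec x = snd (snd (l x))" for x
  have l_eq: "l x = (base x, index x, sec x)" for x
    by (simp add: base_def index_def sec_def)
  have P_pts: "base x \<in> pts I" "index x \<in> A" if "x \<in> pts P" for x
    using l(1)[OF that] by (auto simp: l_eq W_def)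
  have sec: "sec x j \<in> pts B" "fn b (sec x j) = j" "app (index x) (ph J j) = Some (ph B (sec x j))"
    if "x \<in> pts P" "j \<in> pts J" "fn u j = base x" for x j
    using l(1)[OF that(1)] that(2,3) by (auto simp: l_eq W_def)
  have \<phi>l: "tracked (pts P) (ph P) (\<lambda>x. pr (ph I (base x)) (index x))"
    using t(1) by (simp add: \<phi>_def l_eq)
  have base: "tracked (pts P) (ph P) (\<lambda>x. ph I (base x))"
    by (rule tracked_trans[OF ph_in[OF P] \<phi>l tracked_fst]) (use P_pts ph_in[OF I] in auto)
  have index: "tracked (pts P) (ph P) index"
    by (rule tracked_trans[OF ph_in[OF P] \<phi>l tracked_snd]) (use P_pts ph_in[OF I] in auto)
  obtain p where p: "p \<in> hom C P I" "\<And>x. x \<in> pts P \<Longrightarrow> fn p x = base x"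
    using fn_full[OF P I P_pts(1) base] by blast
  have "\<exists>v\<in>hom C Q B. b \<cdot> v = q1 \<and> (\<forall>X. \<forall>x\<in>hom C X I. \<forall>R. \<forall>r1\<in>hom C R J. \<forall>r2\<in>hom C R X.
       is_pullback C r1 r2 u x \<longrightarrow> (\<forall>w\<in>hom C R B. b \<cdot> w = r1 \<longrightarrow>
         (\<exists>m\<in>hom C X P. p \<cdot> m = x \<and>
           (\<forall>k\<in>hom C R Q. q1 \<cdot> k = r1 \<and> q2 \<cdot> k = m \<cdot> r2 \<longrightarrow> v \<cdot> k = w))))"
    if q1: "q1 \<in> hom C Q J" and q2: "q2 \<in> hom C Q P" and pb: "is_pullback C q1 q2 u p" for Q q1 q2
  proof -
    have Q: "Q \<in> Obj C"
      using hom_obj q1 by blast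
    have Q_fibre: "fn u (fn q1 q) = base (fn q2 q)" if q: "q \<in> pts Q" for q
      using fn_comp[OF q1 u q] fn_comp[OF q2 p(1) q] pullback_comm[OF pb] p(2)[OF fn_in[OF q2 q]] by simp
    note sec_Q = sec[OF fn_in[OF q2] fn_in[OF q1] Q_fibre]
    \<comment> \<open>Evaluation is application of the stored tracker to the code of the
      argument.\<close>
    have "tracked (pts Q) (ph Q) (\<lambda>q. ph B (sec (fn q2 q) (fn q1 q)))"
    proof (rule tracked_app[OF ph_in[OF Q] _ fn_tracked[OF q1]])
      show "tracked (pts Q) (ph Q) (\<lambda>q. index (fn q2 q))"
        by (rule tracked_trans[OF ph_in[OF Q] fn_tracked[OF q2] tracked_reindex[OF index fn_in[OF q2]]])
    qed (simp_all add: sec_Q(3))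
    from fn_full[OF Q B sec_Q(1) this]
    obtain v where v: "v \<in> hom C Q B" "\<And>q. q \<in> pts Q \<Longrightarrow> fn v q = sec (fn q2 q) (fn q1 q)"
      by blast
    have "b \<cdot> v = q1"
      by (rule fn_eqI[OF comp_hom[OF v(1) b] q1]) (simp add: fn_comp[OF v(1) b] v(2) sec_Q(2))
    moreover have "\<exists>m\<in>hom C X P. p \<cdot> m = x \<and>
        (\<forall>k\<in>hom C R Q. q1 \<cdot> k = r1 \<and> q2 \<cdot> k = m \<cdot> r2 \<longrightarrow> v \<cdot> k = w)"
      if x: "x \<in> hom C X I" and r1: "r1 \<in> hom C R J" and r2: "r2 \<in> hom C R X"
        and pbR: "is_pullback C r1 r2 u x" and w: "w \<in> hom C R B" "b \<cdot> w = r1" for X x R r1 r2 w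
    proof -
      have X: "X \<in> Obj C" and R: "R \<in> Obj C"
        using hom_obj x r1 by auto
      obtain s where s: "\<And>j y. j \<in> pts J \<Longrightarrow> y \<in> pts X \<Longrightarrow> fn u j = fn x y \<Longrightarrow>
          s j y \<in> pts R \<and> fn r1 (s j y) = j \<and> fn r2 (s j y) = y"
        "\<And>r. r \<in> pts R \<Longrightarrow> s (fn r1 r) (fn r2 r) = r"
        and ts: "tracked {(j, y). j \<in> pts J \<and> y \<in> pts X \<and> fn u j = fn x y}
          (\<lambda>(j, y). pr (ph J j) (ph X y)) (\<lambda>(j, y). ph R (s j y))"
        by (rule pullback_points[OF pbR r1 r2 u x]) blast
      \<comment> \<open>Pairs are reordered so that the point of \<open>X\<close> comes first:
        currying then abstracts over the fibre of \<open>u\<close> above it.\<close>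
      let ?V = "{(y, j). y \<in> pts X \<and> j \<in> pts J \<and> fn u j = fn x y}"
      have V\<phi>: "(case z of (y, j) \<Rightarrow> pr (ph X y) (ph J j)) \<in> A" if "z \<in> ?V" for z
        using that ph_in[OF X] ph_in[OF J] by (auto intro: pr_in)
      have swap: "tracked ?V (\<lambda>(y, j). pr (ph X y) (ph J j)) (\<lambda>(y, j). pr (ph J j) (ph X y))"
      proof -
        have "ph X (fst z) \<in> A" "ph J (snd z) \<in> A" if "z \<in> ?V" for z
          using that ph_in[OF X] ph_in[OF J] by auto
        note * = tracked_fst[of ?V "\<lambda>z. ph X (fst z)" "\<lambda>z. ph J (snd z)", OF this]
          tracked_snd[of ?V "\<lambda>z. ph X (fst z)" "\<lambda>z. ph J (snd z)", OF this]
        show ?thesis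
          using tracked_pr[OF _ *(2) *(1)] V\<phi> by (simp add: case_prod_unfold)
      qed
      have s1: "tracked ?V (\<lambda>(y, j). pr (ph J j) (ph X y)) (\<lambda>(y, j). ph R (s j y))"
        using tracked_reindex[OF ts, of ?V "\<lambda>(y, j). (j, y)"] by (auto simp: case_prod_unfold)
      have s2: "tracked ?V (\<lambda>(y, j). ph R (s j y)) (\<lambda>(y, j). ph B (fn w (s j y)))"
        using tracked_reindex[OF fn_tracked[OF w(1)], of ?V "\<lambda>(y, j). s j y"] s(1) by (auto simp: case_prod_unfold)
      have "tracked ?V (\<lambda>(y, j). pr (ph X y) (ph J j)) (\<lambda>(y, j). ph R (s j y))"
        by (rule tracked_trans[OF V\<phi> swap s1])
      then have "tracked ?V (\<lambda>(y, j). pr (ph X y) (ph J j)) (\<lambda>(y, j). ph B (fn w (s j y)))"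
        by (rule tracked_trans[rotated, OF _ s2]) (rule V\<phi>)
      then obtain e where e: "tracked (pts X) (ph X) e"
        "\<And>y j. (y, j) \<in> ?V \<Longrightarrow> app (e y) (ph J j) = Some (ph B (fn w (s j y)))"
        by (rule tracked_curry[of ?V "ph X" "ph J" _ "pts X"]) (use ph_in[OF X] ph_in[OF J] in auto)
      \<comment> \<open>\<open>w\<close> restricted to the fibre over \<open>y\<close>, with the
        tracker \<open>e y\<close> obtained by currying; the value \<open>undefined\<close> off the
        fibre is the one that \<open>W\<close> admits.\<close>
      define c where "c y = (fn x y, e y, \<lambda>j\<in>pts J. if fn u j = fn x y then fn w (s j y) else undefined)" for y
      have c: "c y \<in> W" if y: "y \<in> pts X" for y
      proof -
        have "(\<lambda>j\<in>pts J. if fn u j = fn x y then fn w (s j y) else undefined) \<in>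
            pts J \<rightarrow>\<^sub>E insert undefined (pts B)"
          using s(1)[OF _ y] fn_in[OF w(1)] by auto
        moreover have "fn w (s j y) \<in> pts B \<and> fn b (fn w (s j y)) = j \<and>
            app (e y) (ph J j) = Some (ph B (fn w (s j y)))" if j: "j \<in> pts J" "fn u j = fn x y" for j
        proof -
          note sj = s(1)[OF j(1) y j(2)]
          have "app (e y) (ph J j) = Some (ph B (fn w (s j y)))"
            by (rule e(2)) (use j y in simp)
          then show ?thesis
            using fn_in[OF w(1)] fn_comp[OF w(1) b, of "s j y"] w(2) sj by simp
        qed
        ultimately show ?thesis
          using fn_in[OF x y] tracked_in[OF e(1) ph_in[OF X] y] by (simp add: W_def c_def)
      qed
      have "tracked (pts X) (ph X) (\<lambda>y. \<phi> (c y))"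
        using tracked_pr[OF ph_in[OF X] fn_tracked[OF x] e(1)] by (simp add: c_def \<phi>_def)
      then have "tracked (pts X) (ph X) (\<lambda>y. ph P (i (c y)))"
        by (rule tracked_trans[rotated, OF _ tracked_reindex[OF t(2) c]]) (simp_all add: ph_in[OF X])
      from fn_full[OF X P _ this] obtain m where m: "m \<in> hom C X P" "\<And>y. y \<in> pts X \<Longrightarrow> fn m y = i (c y)"
        using i(1)[OF c] by blast
      have m_pts: "base (fn m y) = fn x y" "j \<in> pts J \<Longrightarrow> fn u j = fn x y \<Longrightarrow> sec (fn m y) j = fn w (s j y)"
        if "y \<in> pts X" for y j
        using i(2)[OF c[OF that]] by (auto simp: m(2)[OF that] base_def sec_def c_def)
      have "p \<cdot> m = x"
        by (rule fn_eqI[OF comp_hom[OF m(1) p(1)] x]) (simp add: fn_comp[OF m(1) p(1)] p(2)[OF fn_in[OF m(1)]] m_pts)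
      moreover have "v \<cdot> k = w" if k: "k \<in> hom C R Q" and kq: "q1 \<cdot> k = r1" "q2 \<cdot> k = m \<cdot> r2" for k
      proof (rule fn_eqI[OF comp_hom[OF k v(1)] w(1)])
        fix r assume r: "r \<in> pts R"
        have "fn q1 (fn k r) = fn r1 r" "fn q2 (fn k r) = fn m (fn r2 r)"
          using fn_comp[OF k q1 r] fn_comp[OF k q2 r] fn_comp[OF r2 m(1) r] kq by simp_all
        moreover have "fn u (fn r1 r) = fn x (fn r2 r)"
          using fn_comp[OF r1 u r] fn_comp[OF r2 x r] pullback_comm[OF pbR] by simp
        ultimately show "fn (v \<cdot> k) r = fn w r"
          using m_pts(2)[OF fn_in[OF r2 r] fn_in[OF r1 r]] s(2)[OF r]
          by (simp add: fn_comp[OF k v(1) r] v(2)[OF fn_in[OF k r]])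
      qed
      ultimately show ?thesis
        using m(1) by blast
    qed
    ultimately show ?thesis
      using v(1) by blast
  qed
  then show ?thesis
    using p(1) by blast
qed

lemma weakly_lcc: "weakly_locally_cartesian_closed C"
  using finite_limits weak_dependent_product by (rule weakly_locally_cartesian_closedI)

text \<open>\<open>T\<close> is the one-point assembly, and \<open>N0 S\<close> is \<open>S\<close>
  with all codes equal to \<open>a0\<close>. Closedness is translated into tracking in both
  directions before genericity and discreteness are checked.\<close>

lemma well_pointed_with_generic:
  "\<exists>T N \<eta>. well_pointed_local U C T N \<eta> \<and>
    (\<exists>G. generic_object C T N \<eta> G \<and> discrete_object C T N \<eta> G)"
proof -
  obtain a0 where a0: "a0 \<in> A"
    using nonempty by blast
  have const: "tracked W f (\<lambda>_. a0)" if "\<And>w. w \<in> W \<Longrightarrow> f w \<in> A" for W :: "'u set" and f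
    using that a0 by (rule tracked_const)
  obtain T iT lT where repT: "represents T {()} (\<lambda>_. a0) iT lT"
    using object_of_assembly[OF small_singleton[of "()"], of "\<lambda>_. a0"] a0 by blast
  note T = representsD(1)[OF repT] and lT = representsD(2,3)[OF repT] and iT = representsD(4)[OF repT]
  define t0 where "t0 = iT ()"
  have ptsT: "pts T = {t0}"
  proof -
    have "x = t0" if "x \<in> pts T" for x
      using lT(2)[OF that] by (simp add: t0_def)
    moreover have "t0 \<in> pts T"
      unfolding t0_def by (rule iT) simp
    ultimately show ?thesis
      by blast
  qed
  have to_t0: "tracked W f (\<lambda>_. ph T t0)" if "\<And>w. w \<in> W \<Longrightarrow> f w \<in> A" for W :: "'u set" and f
    using that ph_in[OF T] by (intro tracked_const) (auto simp: ptsT)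
  have "\<exists>!h. h \<in> hom C X T" if X: "X \<in> Obj C" for X
  proof -
    obtain h where "h \<in> hom C X T"
      using fn_full[OF X T, of "\<lambda>_. t0"] to_t0[OF ph_in[OF X]] by (auto simp: ptsT)
    moreover have "f = g" if "f \<in> hom C X T" "g \<in> hom C X T" for f g
      using fn_in[OF that(1)] fn_in[OF that(2)] by (intro fn_eqI[OF that]) (auto simp: ptsT)
    ultimately show ?thesis
      by blast
  qed
  then have terminal: "is_terminal C T"
    unfolding is_terminal_def using T by blast
  have "hom C X Y \<in> U" if X: "X \<in> Obj C" and Y: "Y \<in> Obj C" for X Y
  proof (rule small_in_U, rule small_inj[OF small_PiE[OF small_member small_member]])
    show "pts X \<in> U" "pts Y \<in> U"
      using pts_in_U X Y by auto
    show "inj_on (\<lambda>f. restrict (fn f) (pts X)) (hom C X Y)"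
    proof (rule inj_onI, rule fn_eqI)
      fix f g x assume "restrict (fn f) (pts X) = restrict (fn g) (pts X)" "x \<in> pts X"
      then show "fn f x = fn g x"
        by (metis restrict_apply')
    qed
    show "(\<lambda>f. restrict (fn f) (pts X)) \<in> hom C X Y \<rightarrow> pts X \<rightarrow>\<^sub>E pts Y"
      using fn_in by auto
  qed
  then have "locally_small U C"
    unfolding locally_small_def by blast
  then interpret based_cat C U T
    using terminal by unfold_locales
  \<comment> \<open>Evaluation at the only point of \<open>T\<close> identifies global points of
    \<open>X\<close> with \<open>pts X\<close>; \<open>pt\<close> below is its inverse.\<close>
  define ev where "ev x = fn x t0" for x
  have ev_in: "ev x \<in> pts X" if "x \<in> hom C T X" for x X
    unfolding ev_def by (rule fn_in[OF that]) (simp add: ptsT)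
  have ev_inj: "x = y" if "x \<in> hom C T X" "y \<in> hom C T X" "ev x = ev y" for x y X
    using that by (intro fn_eqI[of x T X y]) (auto simp: ptsT ev_def)
  have ev_comp: "ev (f \<cdot> x) = fn f (ev x)" if "x \<in> hom C T X" "f \<in> hom C X Y" for f x X Y
    unfolding ev_def by (rule fn_comp[OF that]) (simp add: ptsT)
  have "\<exists>y\<in>hom C T X. ev y = x" if X: "X \<in> Obj C" and x: "x \<in> pts X" for x X
  proof -
    have "tracked (pts T) (ph T) (\<lambda>_. ph X x)"
      by (rule tracked_const[OF ph_in[OF T] ph_in[OF X x]])
    from fn_full[OF T X _ this] show ?thesis
      using x by (auto simp: ptsT ev_def)
  qed
  then obtain pt where pt: "\<And>X x. X \<in> Obj C \<Longrightarrow> x \<in> pts X \<Longrightarrow> pt X x \<in> hom C T X"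
    "\<And>X x. X \<in> Obj C \<Longrightarrow> x \<in> pts X \<Longrightarrow> ev (pt X x) = x"
    by metis
  have pt_ev: "pt X (ev x) = x" if x: "x \<in> hom C T X" for x X
    using pt[OF hom_obj(2)[OF x] ev_in[OF x]] by (intro ev_inj[OF _ x]) auto
  \<comment> \<open>With constant codes every function into the object is tracked, so the object is
    indiscrete.\<close>
  have "\<exists>X i l. represents X S (\<lambda>_. a0) i l" if "S \<in> U" for S
    using object_of_assembly[OF small_member[OF that], of "\<lambda>_. a0"] a0 by blast
  then obtain N0 iN lN where repN: "\<And>S. S \<in> U \<Longrightarrow> represents (N0 S) S (\<lambda>_. a0) (iN S) (lN S)"
    by metis
  note N0 = representsD(1)[OF repN] and lN = representsD(2,3)[OF repN] and iN = representsD(4,5)[OF repN]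
    and tN = representsD(7)[OF repN]
  have "\<exists>N \<eta> \<epsilon>. adjunction C (set_cat U) (global_sections C T) N \<eta> \<epsilon>"
  proof (rule adjunction_of_universal_arrows[of N0 "\<lambda>S x. lN S (ev x)"])
    show "N0 S \<in> Obj C" if "S \<in> U" for S
      using that by (rule N0)
    show "lN S (ev x) \<in> S" if "S \<in> U" "x \<in> hom C T (N0 S)" for S x
      using that(1) ev_in[OF that(2)] by (rule lN)
  next
    fix S X g assume S: "S \<in> U" and X: "X \<in> Obj C" and g: "g \<in> hom C T X \<rightarrow> S"
    have gS: "g (pt X x) \<in> S" if "x \<in> pts X" for x
      using g pt(1)[OF X that] by blast
    have "tracked (pts X) (ph X) (\<lambda>x. ph (N0 S) (iN S (g (pt X x))))"
      by (rule tracked_trans[OF ph_in[OF X] const[OF ph_in[OF X]] tracked_reindex[OF tN[OF S] gS]])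
    from fn_full[OF X N0[OF S] _ this]
    obtain h where h: "h \<in> hom C X (N0 S)" "\<And>x. x \<in> pts X \<Longrightarrow> fn h x = iN S (g (pt X x))"
      using iN(1)[OF S gS] by blast
    have "lN S (ev (h \<cdot> x)) = g x" if x: "x \<in> hom C T X" for x
      using iN(2)[OF S gS[OF ev_in[OF x]]] by (simp add: ev_comp[OF x h(1)] h(2)[OF ev_in[OF x]] pt_ev[OF x])
    then show "\<exists>h\<in>hom C X (N0 S). \<forall>x\<in>hom C T X. lN S (ev (h \<cdot> x)) = g x"
      using h(1) by blast
  next
    fix S X h h' assume S: "S \<in> U" and h: "h \<in> hom C X (N0 S)" and h': "h' \<in> hom C X (N0 S)"
      and eq: "\<And>x. x \<in> hom C T X \<Longrightarrow> lN S (ev (h \<cdot> x)) = lN S (ev (h' \<cdot> x))"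
    have X: "X \<in> Obj C"
      using hom_obj h by blast
    show "h = h'"
    proof (rule fn_eqI[OF h h'])
      fix x assume x: "x \<in> pts X"
      have "lN S (fn h x) = lN S (fn h' x)"
        using eq[OF pt(1)[OF X x]] by (simp add: ev_comp[OF pt(1)[OF X x] h] ev_comp[OF pt(1)[OF X x] h'] pt(2)[OF X x])
      then show "fn h x = fn h' x"
        using lN(2)[OF S fn_in[OF h x]] lN(2)[OF S fn_in[OF h' x]] by metis
    qed
  qed
  then obtain N \<eta> \<epsilon> where adj: "adjunction C (set_cat U) (global_sections C T) N \<eta> \<epsilon>"
    by blast
  have "faithful C (global_sections C T)"
    unfolding faithful_def
  proof (intro ballI inj_onI)
    fix X Y f g assume X: "X \<in> Obj C" and f: "f \<in> hom C X Y" and g: "g \<in> hom C X Y"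
      and eq: "FArr (global_sections C T) f = FArr (global_sections C T) g"
    show "f = g"
    proof (rule fn_eqI[OF f g])
      fix x assume x: "x \<in> pts X"
      note ptx = pt(1)[OF X x]
      have "restrict (\<lambda>x. f \<cdot> x) (hom C T X) (pt X x) = restrict (\<lambda>x. g \<cdot> x) (hom C T X) (pt X x)"
        using eq by (simp add: sections_arr[OF f] sections_arr[OF g])
      then have "ev (f \<cdot> pt X x) = ev (g \<cdot> pt X x)"
        using ptx by simp
      then show "fn f x = fn g x"
        by (simp add: ev_comp[OF ptx f] ev_comp[OF ptx g] pt(2)[OF X x])
    qed
  qed
  with adj interpret well_pointed_cat C U T N \<eta> \<epsilon>
    by unfold_locales
  \<comment> \<open>If the code of \<open>x\<close> can be computed from that of
    \<open>fn f x\<close>, a function into \<open>X\<close> lying over an arrow \<open>a\<close> is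
    tracked by first tracking \<open>a\<close> and then computing.\<close>
  have closed_of_tracked: "closed f"
    if f: "f \<in> hom C X Y" and tr: "tracked (pts X) (\<lambda>x. ph Y (fn f x)) (ph X)" for f X Y
  proof (rule closedI[OF f])
    fix Z a b assume a: "a \<in> hom C Z Y" and b: "\<And>z. z \<in> hom C T Z \<Longrightarrow> b z \<in> hom C T X"
      and eq: "\<And>z. z \<in> hom C T Z \<Longrightarrow> f \<cdot> b z = a \<cdot> z"
    have X: "X \<in> Obj C" and Z: "Z \<in> Obj C"
      using hom_obj f a by auto
    define h0 where "h0 z = ev (b (pt Z z))" for z
    have h0: "h0 z \<in> pts X" "fn f (h0 z) = fn a z" if z: "z \<in> pts Z" for z
      using ev_in[OF b[OF pt(1)[OF Z z]]] ev_comp[OF b[OF pt(1)[OF Z z]] f] eq[OF pt(1)[OF Z z]]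
        ev_comp[OF pt(1)[OF Z z] a] pt(2)[OF Z z] by (simp_all add: h0_def)
    have "tracked (pts Z) (ph Z) (\<lambda>z. ph Y (fn f (h0 z)))"
      by (rule tracked_cong[OF fn_tracked[OF a]]) (simp_all add: h0(2))
    moreover have "tracked (pts Z) (\<lambda>z. ph Y (fn f (h0 z))) (\<lambda>z. ph X (h0 z))"
      by (rule tracked_reindex[OF tr h0(1)])
    ultimately have "tracked (pts Z) (ph Z) (\<lambda>z. ph X (h0 z))"
      by (rule tracked_trans[rotated]) (rule ph_in[OF Z])
    from fn_full[OF Z X h0(1) this] obtain h where h: "h \<in> hom C Z X" "\<And>z. z \<in> pts Z \<Longrightarrow> fn h z = h0 z"
      by blast
    have "h \<cdot> z = b z" if z: "z \<in> hom C T Z" for z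
      by (rule ev_inj[OF comp_hom[OF z h(1)] b[OF z]])
        (simp add: ev_comp[OF z h(1)] h(2)[OF ev_in[OF z]] h0_def pt_ev[OF z])
    then show "\<exists>h\<in>hom C Z X. \<forall>z\<in>hom C T Z. h \<cdot> z = b z"
      using h(1) by blast
  qed
  have tracked_of_closed: "tracked (pts X) (\<lambda>x. ph Y (fn f x)) (ph X)"
    if cl: "closed f" and f: "f \<in> hom C X Y" for f X Y
  proof -
    have X: "X \<in> Obj C" and Y: "Y \<in> Obj C"
      using hom_obj f by auto
    have fA: "ph Y (fn f x) \<in> A" if "x \<in> pts X" for x
      by (rule ph_in[OF Y fn_in[OF f that]])
    \<comment> \<open>Test object: the points of \<open>X\<close> with the codes of their images.
      Its arrow to \<open>Y\<close> lifts along \<open>f\<close> to the labelling of its points by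
      points of \<open>X\<close>, and a tracker of this lift computes the code of \<open>x\<close>
      from that of \<open>fn f x\<close>.\<close>
    obtain Z i l where repZ: "represents Z (pts X) (\<lambda>x. ph Y (fn f x)) i l"
      using object_of_assembly[OF small_member[OF pts_in_U[OF X]], of "\<lambda>x. ph Y (fn f x)"] fA by blast
    note Z = representsD(1)[OF repZ] and l = representsD(2)[OF repZ] and i = representsD(4,5)[OF repZ]
      and t = representsD(6,7)[OF repZ]
    from fn_full[OF Z Y fn_in[OF f l] t(1)]
    obtain a where a: "a \<in> hom C Z Y" "\<And>z. z \<in> pts Z \<Longrightarrow> fn a z = fn f (l z)"
      by blast
    have b: "pt X (l (ev z)) \<in> hom C T X" "f \<cdot> pt X (l (ev z)) = a \<cdot> z" if z: "z \<in> hom C T Z" for z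
    proof -
      note lz = l[OF ev_in[OF z]]
      show b: "pt X (l (ev z)) \<in> hom C T X"
        by (rule pt(1)[OF X lz])
      show "f \<cdot> pt X (l (ev z)) = a \<cdot> z"
        by (rule ev_inj[OF comp_hom[OF b f] comp_hom[OF z a(1)]])
          (simp add: ev_comp[OF b f] ev_comp[OF z a(1)] pt(2)[OF X lz] a(2)[OF ev_in[OF z]])
    qed
    obtain h where h: "h \<in> hom C Z X" "\<And>z. z \<in> hom C T Z \<Longrightarrow> h \<cdot> z = pt X (l (ev z))"
      using cl[unfolded closed_iff[OF f], rule_format, OF a(1), of "\<lambda>z. pt X (l (ev z))"] b by auto
    have fn_h: "fn h z = l z" if z: "z \<in> pts Z" for z
      using ev_comp[OF pt(1)[OF Z z] h(1)] h(2)[OF pt(1)[OF Z z]] pt(2)[OF Z z] pt(2)[OF X l[OF z]] by simp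
    have "tracked (pts X) (\<lambda>x. ph Z (i x)) (\<lambda>x. ph X (fn h (i x)))"
      by (rule tracked_reindex[OF fn_tracked[OF h(1)] i(1)])
    then have "tracked (pts X) (\<lambda>x. ph Z (i x)) (ph X)"
      by (rule tracked_cong) (simp_all add: fn_h i)
    then show ?thesis
      by (rule tracked_trans[rotated, OF t(2)]) (rule fA)
  qed
  obtain G iG lG where repG: "represents G A (\<lambda>a. a) iG lG"
    using object_of_assembly[OF small_member[OF A_in_U], of "\<lambda>a. a"] by blast
  note G = representsD(1)[OF repG] and lG = representsD(2,3)[OF repG] and iG = representsD(4,5)[OF repG]
    and tG = representsD(6,7)[OF repG]
  have "generic_object C T N \<eta> G"
    unfolding generic_object_def
  proof (intro conjI G ballI)
    fix X assume X: "X \<in> Obj C"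
    \<comment> \<open>Each point is sent to the point of \<open>G\<close> labelled by its own code,
      so the code can be recovered and the arrow is closed.\<close>
    have "tracked (pts X) (ph X) (\<lambda>x. ph G (iG (ph X x)))"
      by (rule tracked_reindex[OF tG(2) ph_in[OF X]])
    from fn_full[OF X G iG(1)[OF ph_in[OF X]] this] obtain f where f: "f \<in> hom C X G" "\<And>x. x \<in> pts X \<Longrightarrow> fn f x = iG (ph X x)"
      by blast
    have "tracked (pts X) (\<lambda>x. ph G (fn f x)) (\<lambda>x. lG (fn f x))"
      by (rule tracked_reindex[OF tG(1) fn_in[OF f(1)]])
    then have "tracked (pts X) (\<lambda>x. ph G (fn f x)) (ph X)"
      by (rule tracked_cong) (simp_all add: f(2) iG(2) ph_in[OF X])
    then show "\<exists>f\<in>hom C X G. closed f"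
      using closed_of_tracked f(1) by blast
  qed
  moreover have "discrete_object C T N \<eta> G"
    unfolding discrete_object_def
  proof (intro conjI G ballI impI)
    fix X D e f assume X: "X \<in> Obj C" and D: "D \<in> Obj C" and e: "e \<in> hom C D X" and f: "f \<in> hom C D G"
      and ce: "closed e \<and> surjective (FArr (global_sections C T) e)"
    have surj: "\<exists>d\<in>pts D. fn e d = x" if x: "x \<in> pts X" for x
    proof -
      have "pt X x \<in> (\<lambda>d. restrict (\<lambda>y. e \<cdot> y) (hom C T D) d) ` hom C T D"
        using ce pt(1)[OF X x] unfolding surjective_def sections_arr[OF e] by simp
      then obtain d where d: "d \<in> hom C T D" "e \<cdot> d = pt X x"
        by auto
      then have "fn e (ev d) = x"
        using ev_comp[OF d(1) e] pt(2)[OF X x] by simp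
      then show ?thesis
        using ev_in[OF d(1)] by blast
    qed
    have eA: "ph X (fn e d) \<in> A" if "d \<in> pts D" for d
      by (rule ph_in[OF X fn_in[OF e that]])
    have "tracked (pts D) (\<lambda>d. ph X (fn e d)) (ph D)"
      using tracked_of_closed[OF _ e] ce by blast
    moreover have "tracked (pts D) (ph D) (\<lambda>d. lG (fn f d))"
      by (rule tracked_trans[OF ph_in[OF D] fn_tracked[OF f] tracked_reindex[OF tG(1) fn_in[OF f]]])
    ultimately have "tracked (pts D) (\<lambda>d. ph X (fn e d)) (\<lambda>d. lG (fn f d))"
      by (rule tracked_trans[rotated]) (rule eA)
    then obtain c where c: "c \<in> A" "\<And>d. d \<in> pts D \<Longrightarrow> app c (ph X (fn e d)) = Some (lG (fn f d))"
      unfolding tracked_def by blast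
    \<comment> \<open>A single \<open>c\<close> computes the value of \<open>f\<close> at
      \<open>d\<close> from the code of \<open>fn e d\<close>, so that value depends only on the
      image of \<open>d\<close>; surjectivity makes \<open>g0\<close> meaningful on all of
      \<open>pts X\<close>.\<close>
    define g0 where "g0 x = the (app c (ph X x))" for x
    have g0: "app c (ph X x) = Some (g0 x)" "g0 x \<in> A" if x: "x \<in> pts X" for x
    proof -
      obtain d where d: "d \<in> pts D" "fn e d = x"
        using surj[OF x] by blast
      then show "app c (ph X x) = Some (g0 x)" "g0 x \<in> A"
        using c(2)[OF d(1)] lG(1)[OF fn_in[OF f d(1)]] by (simp_all add: g0_def)
    qed
    have "tracked (pts X) (ph X) g0"
      using c(1) g0(1) by (rule trackedI)
    then have "tracked (pts X) (ph X) (\<lambda>x. ph G (iG (g0 x)))"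
      by (rule tracked_trans[rotated, OF _ tracked_reindex[OF tG(2) g0(2)]]) (simp_all add: ph_in[OF X])
    from fn_full[OF X G _ this] obtain g where g: "g \<in> hom C X G" "\<And>x. x \<in> pts X \<Longrightarrow> fn g x = iG (g0 x)"
      using iG(1)[OF g0(2)] by blast
    show "\<exists>!g. g \<in> hom C X G \<and> g \<cdot> e = f"
    proof (intro ex1I[of _ g] conjI g(1))
      show "g \<cdot> e = f"
      proof (rule fn_eqI[OF comp_hom[OF e g(1)] f])
        fix d assume d: "d \<in> pts D"
        show "fn (g \<cdot> e) d = fn f d"
          using c(2)[OF d] lG(2)[OF fn_in[OF f d]]
          by (simp add: fn_comp[OF e g(1) d] g(2)[OF fn_in[OF e d]] g0_def)
      qed
      fix g' assume g': "g' \<in> hom C X G \<and> g' \<cdot> e = f"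
      then have g'X: "g' \<in> hom C X G" by blast
      show "g' = g"
      proof (rule fn_eqI[OF g'X g(1)])
        fix x assume "x \<in> pts X"
        then obtain d where d: "d \<in> pts D" "fn e d = x"
          using surj by blast
        then show "fn g' x = fn g x"
          using fn_comp[OF e g'X d(1)] fn_comp[OF e g(1) d(1)] g' \<open>g \<cdot> e = f\<close> by simp
      qed
    qed
  qed
  moreover have "well_pointed_local U C T N \<eta>"
    unfolding well_pointed_local_iff using finite_limits well_pointed_cat_axioms by blast
  ultimately show ?thesis
    by blast
qed

end

text \<open>Functoriality, fullness and faithfulness give the axioms on arrows. For
  \<open>realize\<close>, an isomorphism onto the assembly supplies a bijection of points that is
  tracked in both directions.\<close>

lemma presentation_of_equivalence:
  fixes C :: "('o, 'u) category"
  assumes U: "universe U" and A: "A \<in> U" "pca A app" and eq: "equivalent_cats C (PAsm U A app)"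
  shows "\<exists>pts ph fn. assembly_presentation U A app C pts ph fn"
proof -
  interpret grothendieck_universe U
    by unfold_locales (rule U)
  interpret combinatory_algebra A app
    by unfold_locales (rule A(2))
  let ?P = "PAsm U A app"
  obtain F where F: "is_functor C ?P F"
    and faithful: "\<And>X Y f g. f \<in> hom C X Y \<Longrightarrow> g \<in> hom C X Y \<Longrightarrow> FArr F f = FArr F g \<Longrightarrow> f = g"
    and full: "\<And>X Y h. X \<in> Obj C \<Longrightarrow> Y \<in> Obj C \<Longrightarrow> h \<in> hom ?P (FObj F X) (FObj F Y) \<Longrightarrow>
      \<exists>f\<in>hom C X Y. FArr F f = h"
    and eso: "\<And>Y. Y \<in> Obj ?P \<Longrightarrow> \<exists>X\<in>Obj C. \<exists>f\<in>hom ?P (FObj F X) Y. is_iso ?P f"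
    by (rule equivalence_fully_faithful[OF eq]) blast
  interpret C: cat C
    by unfold_locales (rule functor_cats[OF F])
  interpret P: cat ?P
    by unfold_locales (rule functor_cats[OF F])
  define pts where "pts X = fst (FObj F X)" for X
  define ph where "ph X = snd (FObj F X)" for X
  define fn where "fn f = fst (snd (FArr F f))" for f
  have F_obj: "FObj F X = (pts X, ph X)" for X
    by (simp add: pts_def ph_def)
  have pts: "pts X \<in> U" "ph X \<in> pts X \<rightarrow>\<^sub>E A" if "X \<in> Obj C" for X
    using functor_obj[OF F that] by (auto simp: F_obj)
  have fn: "FArr F f = (FObj F X, fn f, FObj F Y)" "fn f \<in> pts X \<rightarrow>\<^sub>E pts Y"
    "tracked (pts X) (ph X) (\<lambda>x. ph Y (fn f x))" if f: "f \<in> hom C X Y" for f X Y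
  proof -
    obtain h where h: "FArr F f = (FObj F X, h, FObj F Y)" "h \<in> pts X \<rightarrow>\<^sub>E pts Y"
      "tracked (pts X) (ph X) (\<lambda>x. ph Y (h x))"
      using functor_hom[OF F f] unfolding pasm_hom_iff tracked_def F_obj fst_conv snd_conv by blast
    then show "FArr F f = (FObj F X, fn f, FObj F Y)" "fn f \<in> pts X \<rightarrow>\<^sub>E pts Y"
      "tracked (pts X) (ph X) (\<lambda>x. ph Y (fn f x))"
      by (simp_all add: fn_def)
  qed
  have "assembly_presentation U A app C pts ph fn"
  proof
    fix f g X Y Z x assume f: "f \<in> hom C X Y" and g: "g \<in> hom C Y Z" and x: "x \<in> pts X"
    show "fn (g \<cdot>\<^bsub>C\<^esub> f) x = fn g (fn f x)"
      using functor_comp[OF F f g] fn(1)[OF f] fn(1)[OF g] fn(1)[OF C.comp_hom[OF f g]] x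
      by (simp add: F_obj compose_eq)
  next
    fix X x assume X: "X \<in> Obj C" and x: "x \<in> pts X"
    show "fn (Ide C X) x = x"
      using functor_ide[OF F X] fn(1)[OF C.ide_hom[OF X]] x by (simp add: F_obj)
    show "ph X x \<in> A"
      using pts(2)[OF X] x by blast
  next
    fix f g X Y assume f: "f \<in> hom C X Y" and g: "g \<in> hom C X Y" and "\<And>x. x \<in> pts X \<Longrightarrow> fn f x = fn g x"
    then have "fn f = fn g"
      using fn(2)[OF f] fn(2)[OF g] by (intro PiE_ext) auto
    then show "f = g"
      by (intro faithful[OF f g]) (simp add: fn(1)[OF f] fn(1)[OF g])
  next
    fix X Y h assume X: "X \<in> Obj C" and Y: "Y \<in> Obj C" and h: "\<And>x. x \<in> pts X \<Longrightarrow> h x \<in> pts Y"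
      and t: "tracked (pts X) (ph X) (\<lambda>x. ph Y (h x))"
    have "(FObj F X, restrict h (pts X), FObj F Y) \<in> hom ?P (FObj F X) (FObj F Y)"
      unfolding pasm_hom_iff
      using functor_obj[OF F X] functor_obj[OF F Y] h t by (auto simp: F_obj tracked_def)
    then obtain f where f: "f \<in> hom C X Y" "FArr F f = (FObj F X, restrict h (pts X), FObj F Y)"
      using full[OF X Y] by blast
    then show "\<exists>f\<in>hom C X Y. \<forall>x\<in>pts X. fn f x = h x"
      by (intro bexI[OF _ f(1)]) (simp add: fn_def)
  next
    fix W \<phi> assume W: "W \<in> U" and \<phi>: "\<And>w. w \<in> W \<Longrightarrow> \<phi> w \<in> A"
    let ?Y = "(W, restrict \<phi> W)"
    have "?Y \<in> Obj ?P"
      using W \<phi> by auto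
    then obtain X f where X: "X \<in> Obj C" and f: "f \<in> hom ?P (FObj F X) ?Y" "is_iso ?P f"
      using eso by blast
    obtain g where g: "g \<in> hom ?P ?Y (FObj F X)" "g \<cdot>\<^bsub>?P\<^esub> f = Ide ?P (FObj F X)" "f \<cdot>\<^bsub>?P\<^esub> g = Ide ?P ?Y"
      using f(2,1) by (rule P.isoE) blast
    obtain j where j: "f = (FObj F X, j, ?Y)" "j \<in> pts X \<rightarrow>\<^sub>E W" "tracked (pts X) (ph X) (\<lambda>x. restrict \<phi> W (j x))"
      using f(1) unfolding pasm_hom_iff tracked_def by (auto simp: F_obj)
    obtain i where i: "g = (?Y, i, FObj F X)" "i \<in> W \<rightarrow>\<^sub>E pts X" "tracked W (restrict \<phi> W) (\<lambda>w. ph X (i w))"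
      using g(1) unfolding pasm_hom_iff tracked_def by (auto simp: F_obj)
    have ij: "i (j x) = x" if "x \<in> pts X" for x
    proof -
      have "compose (pts X) i j = restrict (\<lambda>x. x) (pts X)"
        using g(2) by (simp add: i(1) j(1) F_obj)
      from fun_cong[OF this, of x] show ?thesis
        using that by (simp add: compose_eq)
    qed
    have ji: "j (i w) = w" if "w \<in> W" for w
    proof -
      have "compose W j i = restrict (\<lambda>x. x) W"
        using g(3) by (simp add: i(1) j(1))
      from fun_cong[OF this, of w] show ?thesis
        using that by (simp add: compose_eq)
    qed
    have "bij_betw j (pts X) W"
      using j(2) i(2) ij ji by (intro bij_betw_byWitness[of _ i]) auto
    moreover have "tracked (pts X) (ph X) (\<lambda>x. \<phi> (j x))"
      by (rule tracked_cong[OF j(3)]) (use j(2) in auto)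
    moreover have "tracked (pts X) (\<lambda>x. \<phi> (j x)) (ph X)"
    proof (rule tracked_cong[OF tracked_reindex[OF i(3)]])
      show "j x \<in> W" if "x \<in> pts X" for x
        using j(2) that by blast
    qed (use j(2) ij in auto)
    ultimately show "\<exists>X\<in>Obj C. \<exists>j. bij_betw j (pts X) W \<and>
        tracked (pts X) (ph X) (\<lambda>x. \<phi> (j x)) \<and> tracked (pts X) (\<lambda>x. \<phi> (j x)) (ph X)"
      using X by blast
  next
    fix f X Y x assume f: "f \<in> hom C X Y"
    show "tracked (pts X) (ph X) (\<lambda>x. ph Y (fn f x))"
      by (rule fn(3)[OF f])
    show "fn f x \<in> pts Y" if "x \<in> pts X"
      using fn(2)[OF f] that by blast
  qed (rule A(1) pts(1), assumption?)+
  then show ?thesis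
    by blast
qed

theorem theorem3p8:
  fixes U :: "'u set set" and C :: "('o, 'u) category"
  assumes "universe U" and "is_category C"
  shows "(\<exists>A app. A \<in> U \<and> pca A app \<and> equivalent_cats C (PAsm U A app)) \<longleftrightarrow>
    weakly_locally_cartesian_closed C \<and>
    (\<exists>T N \<eta>. well_pointed_local U C T N \<eta> \<and>
       (\<exists>G. generic_object C T N \<eta> G \<and> discrete_object C T N \<eta> G))"
proof
  assume "\<exists>A app. A \<in> U \<and> pca A app \<and> equivalent_cats C (PAsm U A app)"
  then obtain A app where A: "A \<in> U" "pca A app" "equivalent_cats C (PAsm U A app)"
    by blast
  from presentation_of_equivalence[OF assms(1) A]
  obtain pts ph fn where "assembly_presentation U A app C pts ph fn"
    by blast
  then interpret assembly_presentation U A app C pts ph fn .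
  show "weakly_locally_cartesian_closed C \<and>
    (\<exists>T N \<eta>. well_pointed_local U C T N \<eta> \<and>
       (\<exists>G. generic_object C T N \<eta> G \<and> discrete_object C T N \<eta> G))"
    using weakly_lcc well_pointed_with_generic by blast
next
  assume "weakly_locally_cartesian_closed C \<and>
    (\<exists>T N \<eta>. well_pointed_local U C T N \<eta> \<and>
       (\<exists>G. generic_object C T N \<eta> G \<and> discrete_object C T N \<eta> G))"
  then obtain T N \<eta> G \<epsilon> where wlcc: "weakly_locally_cartesian_closed C" and "well_pointed_cat C U T N \<eta> \<epsilon>"
    and G: "generic_object C T N \<eta> G" "discrete_object C T N \<eta> G"
    unfolding well_pointed_local_iff by blast
  then interpret well_pointed_cat C U T N \<eta> \<epsilon>
    by blast
  interpret generic_cat C U T N \<eta> \<epsilon> G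
    by unfold_locales (use assms(1) wlcc G in auto)
  show "\<exists>A app. A \<in> U \<and> pca A app \<and> equivalent_cats C (PAsm U A app)"
    using equivalent_to_PAsm A_in_U by blast
qed

end
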